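(* Let $n\ge 1$ and let $\lambda=(\lambda_1\ge\cdots\ge\lambda_n\ge 0)$ be a partition with $n$ parts (zero parts allowed). Then: (i) the images in the symplectic Schur module $E^{\lambda,f}$ of the symplectic tableaux of shape $\lambda$ form a basis of $E^{\lambda,f}$; (ii) the $G_n$-module $E^{\lambda,f}$ is isomorphic to the irreducible representation $V_\lambda$ of $G_n=\mathrm{Sp}_{2n}\mathbb C$ with highest weight $\lambda$; (iii) the vanishing ideal $I$ of the flag variety of $G_n$ is generated by quadratic polynomials (polynomials of degree at most two) corresponding to the alternating, exchange, and symplectic relations, namely by the polynomials $x_\rho\in R$ where $\rho$ ranges over the alternating, exchange and symplectic relations on tableaux (of shapes given by partitions with $n$ parts) having at most two columns.
   Context: Let $E=\mathbb C^{2n}$ with basis $e_1,\ldots,e_n,e_{\bar 1},\ldots,e_{\bar n}$, indexed by the set $[n]'=\{1,\ldots,n,\bar 1,\ldots,\bar n\}$. Let $f$ be the nondegenerate skew form on $E$ with $f(e_i,e_j)=f(e_{\bar i},e_{\bar j})=0$ and $f(e_i,e_{\bar j})=\delta_{ij}=-f(e_{\bar j},e_i)$; $G_n=\mathrm{Sp}_{2n}\mathbb C$ is its isometry group (equivalently the stabilizer in $GL(E)$ of $\sum_i(e_i\otimes e_{\bar i}-e_{\bar i}\otimes e_i)$). Tableaux: for a partition $\lambda$ with $n$ parts and $r=|\lambda|$, draw its Young diagram in English convention (row $i$ has $\lambda_i$ left-justified boxes, rows top to bottom). A tableau of shape $\lambda$ with entries in $[n]'$ is a filling of the boxes by elements of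 $[n]'$; fixing an enumeration $b_1,\ldots,b_r$ of the boxes, a tableau $T$ is identified with the decomposable tensor $e_{T(b_1)}\otimes\cdots\otimes e_{T(b_r)}\in\bigotimes^rE$ (entry $a$ corresponds to $e_a$). Alternating relations: $T+T'=0$ where $T'$ is obtained from $T$ by interchanging two entries in one column. Exchange relations: $T=\sum_w T_w$, where for two fixed columns, the second strictly to the right of the first, and $k$ at most the length of the right column, the sum runs over all tableaux $T_w$ obtained from $T$ by interchanging the top $k$ entries of the right column with any $k$ entries of the left column, preserving the vertical order of the chosen entries. The Schur module $E^\lambda$ is the quotient of $\bigotimes^rE$ by the span of all alternating and exchange relations. Symplectic relations: given a tableau $T$ of shape $\lambda$ and two distinct boxes $B,B'$, let $F$ be the partial filling obtained by erasing the entries of $B,B'$; set $S_F=\sum_{i=1}^n(F_i-F_i')$, where $F_i$ (resp. $F_i'$) is obtained from $F$ by putting $i$ in $B$ and $\bar i$ in $B'$ (resp. $\bar i$ in $B$ and $i$ in $B'$). The symplectic Schur module $E^{\lambda,f}$ is the quotient of $E^\lambda$ by the span of the images of all $S_F$; $G_n$ acts on it. Order $[n]'$ by $1<\bar 1<2<\bar 2<\cdots<n<\bar n$. A tableau is semistandard if its entries weakly increase along each row (left to right) and strictly increase down each column. It is symplectic if it is semistandard and every entry in its $i$th row is $\ge i$ in this order (the symplectic condition). Weights: the diagonal torus of $G_n$ consists of the matrices acting by $x_i$ on $e_i$ and $x_i^{-1}$ on $e_{\bar i}$; the weight $(b_1,\ldots,b_n)$ is the character $\prod x_i^{b_i}$.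 Highest weights are taken with respect to the Borel subgroup stabilizing the isotropic flag $\langle e_1\rangle\subset\langle e_1,e_2\rangle\subset\cdots\subset\langle e_1,\ldots,e_n\rangle$. Flag variety and polynomials: let $R=\mathbb C[x_{(a_1,\ldots,a_k)}: 1\le k\le n,\ a_j\in[n]']$. For a tableau $T$ whose columns, read top to bottom, are $(a_1,\ldots,a_k),\ldots$, let $x_T$ be the product over the columns of the variables $x_{(a_1,\ldots,a_k)}$; a relation $\rho=\sum_j c_jT_j$ corresponds to $x_\rho=\sum_jc_jx_{T_j}\in R$. For a $2n\times n$ matrix $M$ with rows indexed by $[n]'$ (in the order $1,\ldots,n,\bar1,\ldots,\bar n$) and columns $v_1,\ldots,v_n$, evaluate $x_{(a_1,\ldots,a_k)}(M)=\det(M_{a_p,q})_{1\le p,q\le k}$. The flag variety of $G_n$ is the set of flags $E_1\subset\cdots\subset E_n$ in $E$ with $\dim E_k=k$ and $E_n$ isotropic for $f$; its vanishing ideal is $I=\{p\in R: p(M)=0$ for every $M$ whose columns are linearly independent and span an $f$-isotropic subspace$\}$ (the multihomogeneous ideal of the image of the flag variety in $\prod_k\mathbb P(\wedge^kE)$ under the Plücker embeddings). *)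

theory Defs
  imports Complex_Main "HOL-Library.Poly_Mapping" "HOL-Combinatorics.Permutations"
begin

text \<open>P i stands for the index i, Q i for the barred index i-bar.\<close>
datatype ix = P nat | Q nat

definition idxs :: "nat \<Rightarrow> ix set" where
  "idxs n = {P i | i. 1 \<le> i \<and> i \<le> n} \<union> {Q i | i. 1 \<le> i \<and> i \<le> n}"

text \<open>Order 1 < 1bar < 2 < 2bar < ... encoded by a numeric key.\<close>
fun ixkey :: "ix \<Rightarrow> nat" where
  "ixkey (P i) = 2 * i"
| "ixkey (Q i) = 2 * i + 1"

text \<open>Vectors of E are functions ix => complex (only values on idxs n matter).
  The skew form f.\<close>
definition fform :: "nat \<Rightarrow> (ix \<Rightarrow> complex) \<Rightarrow> (ix \<Rightarrow> complex) \<Rightarrow> complex" where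
  "fform n u v = (\<Sum>i\<in>{1..n}. u (P i) * v (Q i) - u (Q i) * v (P i))"

definition mvec :: "nat \<Rightarrow> (ix \<Rightarrow> ix \<Rightarrow> complex) \<Rightarrow> (ix \<Rightarrow> complex) \<Rightarrow> (ix \<Rightarrow> complex)" where
  "mvec n g u = (\<lambda>a. \<Sum>b\<in>idxs n. g a b * u b)"

definition Sp :: "nat \<Rightarrow> (ix \<Rightarrow> ix \<Rightarrow> complex) set" where
  "Sp n = {g. (\<forall>a b. a \<notin> idxs n \<or> b \<notin> idxs n \<longrightarrow> g a b = 0)
             \<and> (\<forall>u v. fform n (mvec n g u) (mvec n g v) = fform n u v)}"

text \<open>Borel subgroup: stabilizer of the isotropic flag <e_1> < <e_1,e_2> < ... < <e_1..e_n>.\<close>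
definition Borel :: "nat \<Rightarrow> (ix \<Rightarrow> ix \<Rightarrow> complex) set" where
  "Borel n = {g \<in> Sp n. \<forall>k\<in>{1..n}. \<forall>j\<in>{1..k}. \<forall>a. g a (P j) \<noteq> 0 \<longrightarrow> a \<in> {P i | i. 1 \<le> i \<and> i \<le> k}}"

definition bchar :: "nat list \<Rightarrow> (ix \<Rightarrow> ix \<Rightarrow> complex) \<Rightarrow> complex" where
  "bchar lam g = (\<Prod>i\<in>{1..length lam}. g (P i) (P i) ^ (lam ! (i - 1)))"

definition is_partition :: "nat \<Rightarrow> nat list \<Rightarrow> bool" where
  "is_partition n lam \<longleftrightarrow> length lam = n \<and> sorted_wrt (\<ge>) lam"

text \<open>Boxes (row, column), 1-indexed, English convention.\<close>
definition boxes :: "nat list \<Rightarrow> (nat \<times> nat) set" where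
  "boxes lam = {(i, j). 1 \<le> i \<and> i \<le> length lam \<and> 1 \<le> j \<and> j \<le> lam ! (i - 1)}"

definition ncols :: "nat list \<Rightarrow> nat" where
  "ncols lam = (if lam = [] then 0 else hd lam)"

definition collen :: "nat list \<Rightarrow> nat \<Rightarrow> nat" where
  "collen lam j = card {i. 1 \<le> i \<and> i \<le> length lam \<and> j \<le> lam ! (i - 1)}"

text \<open>Tableaux of shape lam with entries in [n]'; canonically P 0 outside the diagram.\<close>
definition fillings :: "nat \<Rightarrow> nat list \<Rightarrow> ((nat \<times> nat) \<Rightarrow> ix) set" where
  "fillings n lam = {T. (\<forall>b\<in>boxes lam. T b \<in> idxs n) \<and> (\<forall>b. b \<notin> boxes lam \<longrightarrow> T b = P 0)}"

definition semistandard :: "nat list \<Rightarrow> ((nat \<times> nat) \<Rightarrow> ix) \<Rightarrow> bool" where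
  "semistandard lam T \<longleftrightarrow>
     (\<forall>i j. (i, j) \<in> boxes lam \<and> (i, Suc j) \<in> boxes lam \<longrightarrow> ixkey (T (i, j)) \<le> ixkey (T (i, Suc j)))
   \<and> (\<forall>i j. (i, j) \<in> boxes lam \<and> (Suc i, j) \<in> boxes lam \<longrightarrow> ixkey (T (i, j)) < ixkey (T (Suc i, j)))"

definition symplectic_tab :: "nat \<Rightarrow> nat list \<Rightarrow> ((nat \<times> nat) \<Rightarrow> ix) \<Rightarrow> bool" where
  "symplectic_tab n lam T \<longleftrightarrow> T \<in> fillings n lam \<and> semistandard lam T
     \<and> (\<forall>i j. (i, j) \<in> boxes lam \<longrightarrow> ixkey (P i) \<le> ixkey (T (i, j)))"

text \<open>Tensor space: complex linear combinations of tableaux of shape lam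
  (identified with decomposable tensors of the standard basis of the r-th tensor power of E).\<close>
definition tens :: "nat \<Rightarrow> nat list \<Rightarrow> (((nat \<times> nat) \<Rightarrow> ix) \<Rightarrow> complex) set" where
  "tens n lam = {\<phi>. \<forall>T. \<phi> T \<noteq> 0 \<longrightarrow> T \<in> fillings n lam}"

definition delta :: "((nat \<times> nat) \<Rightarrow> ix) \<Rightarrow> ((nat \<times> nat) \<Rightarrow> ix) \<Rightarrow> complex" where
  "delta T = (\<lambda>S. if S = T then 1 else 0)"

definition cspan :: "('a \<Rightarrow> complex) set \<Rightarrow> ('a \<Rightarrow> complex) set" where
  "cspan A = {(\<lambda>x. \<Sum>v\<in>F. c v * v x) | F c. finite F \<and> F \<subseteq> A}"

definition csubspace :: "('a \<Rightarrow> complex) set \<Rightarrow> bool" where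
  "csubspace U \<longleftrightarrow> (\<lambda>x. 0) \<in> U \<and> (\<forall>u\<in>U. \<forall>v\<in>U. (\<lambda>x. u x + v x) \<in> U)
                    \<and> (\<forall>c. \<forall>u\<in>U. (\<lambda>x. c * u x) \<in> U)"

definition alt_rels :: "nat \<Rightarrow> nat list \<Rightarrow> (((nat \<times> nat) \<Rightarrow> ix) \<Rightarrow> complex) set" where
  "alt_rels n lam = {(\<lambda>S. delta T S + delta (T(b := T b', b' := T b)) S) | T b b'.
      T \<in> fillings n lam \<and> b \<in> boxes lam \<and> b' \<in> boxes lam \<and> b \<noteq> b' \<and> snd b = snd b'}"

text \<open>Interchange the top card R entries of column j2 with the entries of column j1 in the
  rows R, preserving vertical order.\<close>
definition exch_tab :: "((nat \<times> nat) \<Rightarrow> ix) \<Rightarrow> nat \<Rightarrow> nat \<Rightarrow> nat set \<Rightarrow> ((nat \<times> nat) \<Rightarrow> ix)" where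
  "exch_tab T j1 j2 R = (\<lambda>(r, c).
      if c = j2 \<and> 1 \<le> r \<and> r \<le> card R then T (sorted_list_of_set R ! (r - 1), j1)
      else if c = j1 \<and> r \<in> R then T (card {r' \<in> R. r' \<le> r}, j2)
      else T (r, c))"

definition exch_rels :: "nat \<Rightarrow> nat list \<Rightarrow> (((nat \<times> nat) \<Rightarrow> ix) \<Rightarrow> complex) set" where
  "exch_rels n lam = {(\<lambda>S. delta T S -
        (\<Sum>R\<in>{R. R \<subseteq> {1..collen lam j1} \<and> card R = k}. delta (exch_tab T j1 j2 R) S))
      | T j1 j2 k. T \<in> fillings n lam \<and> 1 \<le> j1 \<and> j1 < j2 \<and> j2 \<le> ncols lam \<and> k \<le> collen lam j2}"

definition symp_rels :: "nat \<Rightarrow> nat list \<Rightarrow> (((nat \<times> nat) \<Rightarrow> ix) \<Rightarrow> complex) set" where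
  "symp_rels n lam = {(\<lambda>S. \<Sum>i\<in>{1..n}. delta (T(B := P i, B' := Q i)) S - delta (T(B := Q i, B' := P i)) S)
      | T B B'. T \<in> fillings n lam \<and> B \<in> boxes lam \<and> B' \<in> boxes lam \<and> B \<noteq> B'}"

text \<open>The kernel of the projection from the tensor space onto E^{lam,f}.\<close>
definition Wrel :: "nat \<Rightarrow> nat list \<Rightarrow> (((nat \<times> nat) \<Rightarrow> ix) \<Rightarrow> complex) set" where
  "Wrel n lam = cspan (alt_rels n lam \<union> exch_rels n lam \<union> symp_rels n lam)"

text \<open>Action of a matrix g on the tensor space: g(e_{T b_1} x ... x e_{T b_r}) = g e_{T b_1} x ... \<close>
definition act :: "nat \<Rightarrow> nat list \<Rightarrow> (ix \<Rightarrow> ix \<Rightarrow> complex)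
                    \<Rightarrow> (((nat \<times> nat) \<Rightarrow> ix) \<Rightarrow> complex) \<Rightarrow> (((nat \<times> nat) \<Rightarrow> ix) \<Rightarrow> complex)" where
  "act n lam g \<phi> = (\<lambda>S. if S \<in> fillings n lam
       then (\<Sum>T\<in>fillings n lam. \<phi> T * (\<Prod>b\<in>boxes lam. g (S b) (T b))) else 0)"

text \<open>The quotient E^{lam,f} = tens / Wrel is a G_n-module isomorphic to V_lam, i.e. the
  action is well defined, the module is irreducible, and it has a highest weight vector of
  weight lam (a B-eigenvector with character bchar lam).\<close>
definition iso_to_V_lambda :: "nat \<Rightarrow> nat list \<Rightarrow> bool" where
  "iso_to_V_lambda n lam \<longleftrightarrow>
     (\<forall>g\<in>Sp n. \<forall>\<phi>\<in>Wrel n lam. act n lam g \<phi> \<in> Wrel n lam)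
   \<and> Wrel n lam \<noteq> tens n lam
   \<and> (\<forall>U. csubspace U \<and> Wrel n lam \<subseteq> U \<and> U \<subseteq> tens n lam
          \<and> (\<forall>g\<in>Sp n. \<forall>\<phi>\<in>U. act n lam g \<phi> \<in> U)
          \<longrightarrow> U = Wrel n lam \<or> U = tens n lam)
   \<and> (\<exists>v\<in>tens n lam. v \<notin> Wrel n lam \<and>
        (\<forall>g\<in>Borel n. (\<lambda>S. act n lam g v S - bchar lam g * v S) \<in> Wrel n lam))"

text \<open>Polynomials in the variables x_(a_1..a_k), represented by lists of indices.\<close>
type_synonym mpoly = "(ix list \<Rightarrow>\<^sub>0 nat) \<Rightarrow>\<^sub>0 complex"

definition pvar :: "ix list \<Rightarrow> mpoly" where
  "pvar a = Poly_Mapping.single (Poly_Mapping.single a 1) 1"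

definition pconst :: "complex \<Rightarrow> mpoly" where
  "pconst c = Poly_Mapping.single 0 c"

definition pvars :: "nat \<Rightarrow> ix list set" where
  "pvars n = {a. 1 \<le> length a \<and> length a \<le> n \<and> set a \<subseteq> idxs n}"

definition Rring :: "nat \<Rightarrow> mpoly set" where
  "Rring n = {p. \<forall>m\<in>Poly_Mapping.keys p. Poly_Mapping.keys m \<subseteq> pvars n}"

definition plueck :: "ix list \<Rightarrow> (ix \<Rightarrow> nat \<Rightarrow> complex) \<Rightarrow> complex" where
  "plueck a M = (\<Sum>\<sigma>\<in>{\<sigma>. \<sigma> permutes {1..length a}}.
      of_int (sign \<sigma>) * (\<Prod>p\<in>{1..length a}. M (a ! (p - 1)) (\<sigma> p)))"

definition evalp :: "mpoly \<Rightarrow> (ix \<Rightarrow> nat \<Rightarrow> complex) \<Rightarrow> complex" where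
  "evalp p M = (\<Sum>m\<in>Poly_Mapping.keys p. Poly_Mapping.lookup p m * (\<Prod>v\<in>Poly_Mapping.keys m. plueck v M ^ Poly_Mapping.lookup m v))"

definition good_matrix :: "nat \<Rightarrow> (ix \<Rightarrow> nat \<Rightarrow> complex) \<Rightarrow> bool" where
  "good_matrix n M \<longleftrightarrow>
     (\<forall>c. (\<forall>a\<in>idxs n. (\<Sum>q\<in>{1..n}. c q * M a q) = 0) \<longrightarrow> (\<forall>q\<in>{1..n}. c q = 0))
   \<and> (\<forall>p\<in>{1..n}. \<forall>q\<in>{1..n}. fform n (\<lambda>a. M a p) (\<lambda>a. M a q) = 0)"

definition flag_ideal :: "nat \<Rightarrow> mpoly set" where
  "flag_ideal n = {p \<in> Rring n. \<forall>M. good_matrix n M \<longrightarrow> evalp p M = 0}"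

definition gen_ideal :: "nat \<Rightarrow> mpoly set \<Rightarrow> mpoly set" where
  "gen_ideal n G = {(\<Sum>g\<in>F. q g * g) | F q. finite F \<and> F \<subseteq> G \<and> (\<forall>g\<in>F. q g \<in> Rring n)}"

definition column :: "nat list \<Rightarrow> ((nat \<times> nat) \<Rightarrow> ix) \<Rightarrow> nat \<Rightarrow> ix list" where
  "column lam T j = map (\<lambda>i. T (i, j)) [1..<Suc (collen lam j)]"

definition xtab :: "nat list \<Rightarrow> ((nat \<times> nat) \<Rightarrow> ix) \<Rightarrow> mpoly" where
  "xtab lam T = (\<Prod>j\<in>{1..ncols lam}. pvar (column lam T j))"

definition xrel :: "nat \<Rightarrow> nat list \<Rightarrow> (((nat \<times> nat) \<Rightarrow> ix) \<Rightarrow> complex) \<Rightarrow> mpoly" where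
  "xrel n lam \<rho> = (\<Sum>T\<in>fillings n lam. pconst (\<rho> T) * xtab lam T)"

definition quad_rels :: "nat \<Rightarrow> mpoly set" where
  "quad_rels n = {xrel n lam \<rho> | lam \<rho>. is_partition n lam \<and> ncols lam \<le> 2
      \<and> \<rho> \<in> alt_rels n lam \<union> exch_rels n lam \<union> symp_rels n lam}"

end

theory Submission
  imports Defs "HOL-Library.Function_Algebras"
begin

text \<open>Products of minors of isotropic frames satisfy all relations, so every tableau of shape \<open>lam\<close> is a function
  on isotropic frames, and \<open>Wrel n lam\<close> lies in the kernel of this evaluation.

  Symplectic tableaux span the quotient by straightening: exchange relations restore semistandardness, and a violation
  of the symplectic condition forces more than half of the available indices in the first column to occur in pairs
  \<open>P j\<close>, \<open>Q j\<close>, which a hard Lefschetz argument trades for pairs with larger indices. They are independent even as functions: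
  on a one-parameter family of isotropic frames the minor of a symplectic column is dominated by its diagonal
  term, and the leading exponent of a product of minors determines the shape and the tableau. Hence \<open>Wrel n lam\<close> is exactly
  the kernel of evaluation, and in particular invariant under the group.

  The frames of the family are translates of the standard frame, so a nonzero submodule contains a vector not vanishing at
  the standard frame; among symplectic tableaux only the highest weight tableau has this property, and torus
  elements isolate it. Since the group is closed under conjugate transposition, invariant subspaces have invariant
  complements, and the module is irreducible.

  For the ideal, straightening uses relations on at most two columns at a time, so it reduces every polynomial modulo the quadratic
  relations to a combination of symplectic tableaux of various shapes, and these are independent as functions.\<close>

subsection \<open>Linear algebra of complex functions\<close>

text \<open>The Lefschetz bound comes from a count. If the first \<open>i\<close> entries of a
  column all have indices below \<open>i\<close> and form \<open>p\<close> pairs and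
  \<open>s\<close> singles, then \<open>2 * p + s = i\<close>, so only
  \<open>i - 1 - s = 2 * p - 1\<close> indices are open to the \<open>p\<close> pairs. Straightening
  moves entries in both directions at once, so it is phrased for a linear functional killing all
  relations: one looks at a single extremal tableau on which it is nonzero, and each relation used
  there has all its other terms already killed. On the side of functions the obstacle is that the
  coordinates of an isotropic frame are not free. Once the unbarred block is lower triangular, the
  constrained coordinates in column \<open>q\<close> are \<open>P i\<close> and \<open>Q i\<close>
  with \<open>i < q\<close>, that is, the keys below \<open>2 * q\<close>. These are the entries
  which the symplectic condition forbids in row \<open>q\<close>, so the frame can be prescribed at
  leading order exactly where diagonal terms of symplectic columns need it. The exponential
  exponents let one entry of a minor outweigh a whole column of others, so the constrained entries
  cannot disturb the leading term.\<close>

definition fscale :: "complex \<Rightarrow> ('a \<Rightarrow> complex) \<Rightarrow> 'a \<Rightarrow> complex" where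
  "fscale c f = (\<lambda>x. c * f x)"

interpretation fs: vector_space fscale
  by standard (auto simp: fscale_def fun_eq_iff algebra_simps)

lemma csubspace_subspace: "csubspace U \<Longrightarrow> fs.subspace U"
  by (auto simp: csubspace_def fs.subspace_def fscale_def plus_fun_def zero_fun_def)

lemma sum_fun_apply: "(\<Sum>v\<in>F. f v) x = (\<Sum>v\<in>F. f v x)"
  by (induction F rule: infinite_finite_induct) auto

lemma cspan_eq_span: "cspan A = fs.span A"
proof -
  have "(\<lambda>x. \<Sum>v\<in>F. c v * v x) = (\<Sum>v\<in>F. fscale (c v) v)" for F :: "('a \<Rightarrow> complex) set" and c
    by (auto simp: fun_eq_iff fscale_def sum_fun_apply)
  then show ?thesis unfolding cspan_def fs.span_explicit by auto
qed

lemma csubspace_cspan: "csubspace (cspan A)"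
  using fs.span_zero[of A] fs.span_add[of _ A] fs.span_scale[of _ A]
  by (auto simp: csubspace_def cspan_eq_span fscale_def plus_fun_def zero_fun_def)

lemma cspan_base: "a \<in> A \<Longrightarrow> a \<in> cspan A"
  by (simp add: cspan_eq_span fs.span_base)

lemma cspan_minimal: "csubspace U \<Longrightarrow> A \<subseteq> U \<Longrightarrow> cspan A \<subseteq> U"
  by (simp add: cspan_eq_span csubspace_subspace fs.span_minimal)

lemma csubspace_add: "csubspace U \<Longrightarrow> u \<in> U \<Longrightarrow> v \<in> U \<Longrightarrow> (\<lambda>x. u x + v x) \<in> U"
  by (auto simp: csubspace_def)

lemma csubspace_scale: "csubspace U \<Longrightarrow> u \<in> U \<Longrightarrow> (\<lambda>x. c * u x) \<in> U"
  by (auto simp: csubspace_def)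

lemma csubspace_zero: "csubspace U \<Longrightarrow> (\<lambda>x. 0) \<in> U"
  by (auto simp: csubspace_def)

lemma csubspace_diff: "csubspace U \<Longrightarrow> u \<in> U \<Longrightarrow> v \<in> U \<Longrightarrow> (\<lambda>x. u x - v x) \<in> U"
  using csubspace_add[of U u "\<lambda>x. -1 * v x"] csubspace_scale[of U v "-1"] by simp

lemma csubspace_sum:
  assumes "csubspace U" "\<And>i. i \<in> I \<Longrightarrow> f i \<in> U"
  shows "(\<lambda>x. \<Sum>i\<in>I. f i x) \<in> U"
  using assms(2)
proof (induction I rule: infinite_finite_induct)
  case (insert i I)
  then show ?case using csubspace_add[OF assms(1), of "f i" "\<lambda>x. \<Sum>i\<in>I. f i x"] by simp
qed (auto intro: csubspace_zero[OF assms(1)])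

text \<open>Extend a basis of \<open>U\<close> by \<open>x\<close> and take the functional that is 1
  at \<open>x\<close> and 0 on the basis. Finite support allows it to be recorded by its values
  \<open>h T\<close> at the point masses, so that spanning and complements become questions about
  coefficients of tableaux.\<close>

lemma separating_functional:
  fixes x :: "'a \<Rightarrow> complex"
  assumes U: "csubspace U" and x: "x \<notin> U" and F: "finite F"
    and supp: "\<And>u T. u \<in> insert x U \<Longrightarrow> u T \<noteq> 0 \<Longrightarrow> T \<in> F"
  obtains h where "\<And>u. u \<in> U \<Longrightarrow> (\<Sum>T\<in>F. u T * h T) = 0" "(\<Sum>T\<in>F. x T * h T) = 1"
proof -
  interpret fsp: vector_space_pair "fscale :: complex \<Rightarrow> ('a \<Rightarrow> complex) \<Rightarrow> _" "(*) :: complex \<Rightarrow> complex \<Rightarrow> complex"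
    by standard (auto simp: algebra_simps)
  have sU: "fs.subspace U" by (rule csubspace_subspace[OF U])
  obtain B where B: "B \<subseteq> U" "fs.independent B" "U \<subseteq> fs.span B"
    by (rule fs.maximal_independent_subset)
  have spB: "fs.span B = U" using B sU by (simp add: fs.span_minimal subset_antisym)
  have ind: "fs.independent (insert x B)"
    using fs.independent_insertI[of x B] B x spB by auto
  obtain g where g: "Vector_Spaces.linear fscale (*) g" "\<forall>b\<in>insert x B. g b = (if b = x then 1 else 0)"
    using fsp.linear_independent_extend[OF ind, of "\<lambda>b. if b = x then 1 else 0"] by blast
  interpret g: Vector_Spaces.linear fscale "(*) :: complex \<Rightarrow> _" g by (rule g(1))
  have gB: "g b = 0" if "b \<in> B" for b using g(2) that x B(1) by auto
  have gU: "g u = 0" if "u \<in> U" for u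
  proof -
    have "u \<in> fs.span B" using that spB by simp
    then show ?thesis using g.eq_0_on_span[of B u] gB by blast
  qed
  define h where "h T = g (\<lambda>S. if S = T then 1 else 0)" for T
  have rep: "g u = (\<Sum>T\<in>F. u T * h T)" if "u \<in> insert x U" for u
  proof -
    have "u = (\<Sum>T\<in>F. fscale (u T) (\<lambda>S. if S = T then 1 else 0))"
      using supp[OF that] F by (auto simp: fun_eq_iff fscale_def sum_fun_apply if_distrib cong: if_cong)
    then have "g u = g (\<Sum>T\<in>F. fscale (u T) (\<lambda>S. if S = T then 1 else 0))" by simp
    also have "\<dots> = (\<Sum>T\<in>F. u T * h T)" by (simp add: g.sum g.scale h_def)
    finally show ?thesis .
  qed
  show thesis
  proof
    show "\<And>u. u \<in> U \<Longrightarrow> (\<Sum>T\<in>F. u T * h T) = 0" using rep gU by auto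
    show "(\<Sum>T\<in>F. x T * h T) = 1" using rep[of x] g(2) by auto
  qed
qed

text \<open>The rows of \<open>A\<close> are independent because \<open>B\<close> recovers the
  coefficients of any combination of them. By a dimension count they span the unit vectors, and the
  coefficients expressing a unit vector are a row of \<open>B\<close>. \<open>Sp_transpose\<close>
  uses this to pass from columns to rows.\<close>

lemma matrix_left_right_inverse_on:
  fixes A B :: "'a \<Rightarrow> 'a \<Rightarrow> complex"
  assumes I: "finite I"
    and AB: "\<And>i j. i \<in> I \<Longrightarrow> j \<in> I \<Longrightarrow> (\<Sum>k\<in>I. A i k * B k j) = (if i = j then 1 else 0)"
    and ij: "i \<in> I" "j \<in> I"
  shows "(\<Sum>k\<in>I. B i k * A k j) = (if i = j then 1 else 0)"
proof -
  define al where "al m = (\<lambda>k. if k \<in> I then A m k else 0)" for m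
  define un :: "'a \<Rightarrow> 'a \<Rightarrow> complex" where "un m = (\<lambda>k. if k = m then 1 else 0)" for m
  have key: "(\<Sum>k\<in>I. (\<Sum>m\<in>I. x m * al m k) * B k j') = x j'" if "j' \<in> I" for x j'
  proof -
    have "(\<Sum>k\<in>I. (\<Sum>m\<in>I. x m * al m k) * B k j') = (\<Sum>k\<in>I. \<Sum>m\<in>I. x m * (A m k * B k j'))"
    proof (rule sum.cong)
      fix k assume "k \<in> I"
      then have "al m k = A m k" for m by (simp add: al_def)
      then show "(\<Sum>m\<in>I. x m * al m k) * B k j' = (\<Sum>m\<in>I. x m * (A m k * B k j'))"
        by (simp only: sum_distrib_right mult.assoc)
    qed simp
    also have "\<dots> = (\<Sum>m\<in>I. \<Sum>k\<in>I. x m * (A m k * B k j'))" by (rule sum.swap)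
    also have "\<dots> = (\<Sum>m\<in>I. x m * (\<Sum>k\<in>I. A m k * B k j'))" by (simp add: sum_distrib_left)
    also have "\<dots> = x j'" using that I by (simp add: AB if_distrib cong: if_cong)
    finally show ?thesis .
  qed
  have inj: "inj_on al I"
  proof (rule inj_onI, rule ccontr)
    fix m m' assume h: "m \<in> I" "m' \<in> I" "al m = al m'" "m \<noteq> m'"
    have "A m k = A m' k" if "k \<in> I" for k using fun_cong[OF h(3), of k] that by (simp add: al_def)
    then have "(\<Sum>k\<in>I. A m k * B k m) = (\<Sum>k\<in>I. A m' k * B k m)" by simp
    then show False using AB[OF h(1) h(1)] AB[OF h(2) h(1)] h(4) by simp
  qed
  have injun: "inj un"
    by (rule injI) (metis un_def one_neq_zero)
  have unspan: "un ` I \<subseteq> fs.span (al ` I)"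
  proof -
    have ind: "fs.independent (al ` I)"
    proof (rule fs.independent_if_scalars_zero)
      fix f x assume h: "(\<Sum>x\<in>al ` I. fscale (f x) x) = 0" "x \<in> al ` I"
      then obtain m where m: "m \<in> I" "x = al m" by auto
      have "(\<Sum>m\<in>I. f (al m) * al m k) = 0" for k
        using fun_cong[OF h(1), of k] by (simp add: sum.reindex[OF inj] sum_fun_apply fscale_def)
      then have "f (al m) = 0" using key[OF m(1), of "\<lambda>m. f (al m)"] by simp
      then show "f x = 0" using m by simp
    qed (simp add: I)
    have sp: "al ` I \<subseteq> fs.span (un ` I)"
    proof
      fix v assume "v \<in> al ` I"
      then obtain m where m: "m \<in> I" "v = al m" by auto
      have "v = (\<Sum>k\<in>I. fscale (al m k) (un k))"
        using I m by (auto simp: fun_eq_iff sum_fun_apply fscale_def un_def if_distrib al_def cong: if_cong)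
      also have "\<dots> \<in> fs.span (un ` I)"
        by (intro fs.span_sum fs.span_scale fs.span_base) auto
      finally show "v \<in> fs.span (un ` I)" .
    qed
    show ?thesis
    proof (rule ccontr)
      \<comment> \<open>Otherwise \<open>card I + 1\<close> independent vectors would lie in the
        span of \<open>card I\<close> unit vectors.\<close>
      assume "\<not> un ` I \<subseteq> fs.span (al ` I)"
      then obtain w where w: "w \<in> un ` I" "w \<notin> fs.span (al ` I)" by auto
      have "fs.independent (insert w (al ` I))" by (rule fs.independent_insertI[OF w(2) ind])
      moreover have "insert w (al ` I) \<subseteq> fs.span (un ` I)"
        using sp w(1) by (auto intro: fs.span_base)
      ultimately obtain t' where t: "card t' = card (un ` I)" "finite t'" "insert w (al ` I) \<subseteq> t'"
        using fs.exchange_lemma[of "un ` I" "insert w (al ` I)"] I by auto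
      have "w \<notin> al ` I" using w(2) by (auto intro: fs.span_base)
      then have "card (insert w (al ` I)) = Suc (card I)" using I by (simp add: card_image[OF inj])
      moreover have "card (insert w (al ` I)) \<le> card t'" using t by (intro card_mono) auto
      moreover have "card (un ` I) = card I" using injun by (simp add: card_image inj_on_def)
      ultimately show False using t(1) by simp
    qed
  qed
  have "un i \<in> fs.span (al ` I)" using unspan ij by auto
  then obtain c where c: "un i = (\<Sum>v\<in>al ` I. fscale (c v) v)"
    using fs.span_finite[of "al ` I"] I by auto
  have un: "un i k = (\<Sum>m\<in>I. c (al m) * al m k)" for k
    using fun_cong[OF c, of k] by (simp add: sum.reindex[OF inj] sum_fun_apply fscale_def)
  have "c (al m) = B i m" if "m \<in> I" for m
  proof -
    have "c (al m) = (\<Sum>k\<in>I. un i k * B k m)" using key[OF that, of "\<lambda>m. c (al m)"] by (simp add: un)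
    also have "\<dots> = B i m" using I ij by (simp add: un_def if_distrib[of "\<lambda>x. x * _"] cong: if_cong)
    finally show ?thesis .
  qed
  then have "un i j = (\<Sum>m\<in>I. B i m * A m j)" using un[of j] ij by (simp add: al_def)
  then show ?thesis by (auto simp: un_def)
qed

subsection \<open>Diagrams and tableaux\<close>

lemma downward_closed_eq_interval:
  assumes "finite S" "0 \<notin> S" "\<And>i j. i \<in> S \<Longrightarrow> 1 \<le> j \<Longrightarrow> j \<le> i \<Longrightarrow> j \<in> S"
  shows "S = {1..card S}"
proof (cases "S = {}")
  case False
  have "S = {1..Max S}"
  proof
    show "S \<subseteq> {1..Max S}" using assms(1,2) False by (auto simp: Suc_le_eq intro: gr0I)
    show "{1..Max S} \<subseteq> S" using assms(3)[OF Max_in[OF assms(1) False]] by auto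
  qed
  moreover have "card {1..Max S} = Max S" by simp
  ultimately show ?thesis by metis
qed simp

text \<open>Parts decrease weakly, so the rows that reach column \<open>j\<close> are the topmost
  ones; the cardinality in \<open>collen\<close> thereby becomes a bound on row numbers.\<close>

lemma collen_set:
  assumes "is_partition n lam"
  shows "{i. 1 \<le> i \<and> i \<le> length lam \<and> j \<le> lam ! (i - 1)} = {1..collen lam j}"
proof -
  have s: "lam ! b \<le> lam ! a" if "a \<le> b" "b < length lam" for a b
    using assms that unfolding is_partition_def
    by (metis le_eq_less_or_eq order_refl sorted_wrt_nth_less)
  have "{i. 1 \<le> i \<and> i \<le> length lam \<and> j \<le> lam ! (i - 1)}
      = {1..card {i. 1 \<le> i \<and> i \<le> length lam \<and> j \<le> lam ! (i - 1)}}"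
  proof (rule downward_closed_eq_interval)
    fix i k assume h: "i \<in> {i. 1 \<le> i \<and> i \<le> length lam \<and> j \<le> lam ! (i - 1)}" "1 \<le> k" "k \<le> i"
    then have "lam ! (i - 1) \<le> lam ! (k - 1)" by (intro s) auto
    then show "k \<in> {i. 1 \<le> i \<and> i \<le> length lam \<and> j \<le> lam ! (i - 1)}" using h by auto
  qed auto
  then show ?thesis by (simp add: collen_def)
qed

lemma le_collen_iff:
  assumes "is_partition n lam"
  shows "1 \<le> i \<and> i \<le> collen lam j \<longleftrightarrow> 1 \<le> i \<and> i \<le> n \<and> j \<le> lam ! (i - 1)"
  using collen_set[OF assms, of j] assms unfolding is_partition_def by (auto simp: set_eq_iff)

lemma collen_le: "is_partition n lam \<Longrightarrow> collen lam j \<le> n"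
  using le_collen_iff[of n lam "collen lam j" j] by (cases "collen lam j") auto

lemma collen_antimono: "is_partition n lam \<Longrightarrow> j \<le> j' \<Longrightarrow> collen lam j' \<le> collen lam j"
  using le_collen_iff[of n lam "collen lam j'" j'] le_collen_iff[of n lam "collen lam j'" j]
  by (cases "collen lam j'") auto

lemma part_nth_le_ncols:
  assumes "is_partition n lam" "i < n"
  shows "lam ! i \<le> ncols lam"
proof -
  have "lam \<noteq> []" using assms by (auto simp: is_partition_def)
  then have "ncols lam = lam ! 0" by (simp add: ncols_def hd_conv_nth)
  then show ?thesis using assms unfolding is_partition_def
    by (metis bot_nat_0.not_eq_extremum order_refl sorted_wrt_nth_less)
qed

lemma collen_pos:
  assumes "is_partition n lam" "j \<le> ncols lam" "1 \<le> j"
  shows "1 \<le> collen lam j"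
proof -
  have "lam \<noteq> []" using assms by (auto simp: ncols_def)
  then have "ncols lam = lam ! 0" "0 < n" using assms(1)
    by (auto simp: ncols_def hd_conv_nth is_partition_def)
  then have "(1::nat) \<le> 1 \<and> 1 \<le> n \<and> j \<le> lam ! (1 - 1)" using assms by simp
  then show ?thesis using le_collen_iff[OF assms(1), of 1 j] by blast
qed

lemma mem_boxes_iff:
  assumes "is_partition n lam"
  shows "(i, j) \<in> boxes lam \<longleftrightarrow> 1 \<le> j \<and> j \<le> ncols lam \<and> 1 \<le> i \<and> i \<le> collen lam j"
proof -
  have "i - 1 < n" if "1 \<le> i \<and> i \<le> n" using that by auto
  then show ?thesis
    using le_collen_iff[OF assms, of i j] part_nth_le_ncols[OF assms, of "i - 1"] assms
    unfolding boxes_def is_partition_def by fastforce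
qed

lemma boxes_eq_Sigma:
  assumes "is_partition n lam"
  shows "boxes lam = (\<lambda>(j, i). (i, j)) ` (SIGMA j:{1..ncols lam}. {1..collen lam j})"
  using mem_boxes_iff[OF assms] by (auto simp: image_iff) 

lemma finite_boxes: "is_partition n lam \<Longrightarrow> finite (boxes lam)"
  by (simp add: boxes_eq_Sigma)

lemma prod_boxes:
  fixes f :: "nat \<times> nat \<Rightarrow> 'b::comm_monoid_mult"
  assumes "is_partition n lam"
  shows "(\<Prod>b\<in>boxes lam. f b) = (\<Prod>j=1..ncols lam. \<Prod>i=1..collen lam j. f (i, j))"
proof -
  have "(\<Prod>b\<in>boxes lam. f b) = (\<Prod>(j, i)\<in>(SIGMA j:{1..ncols lam}. {1..collen lam j}). f (i, j))"
    unfolding boxes_eq_Sigma[OF assms]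
    by (subst prod.reindex) (auto simp: inj_on_def case_prod_unfold)
  then show ?thesis by (simp add: prod.Sigma)
qed

lemma sum_boxes:
  fixes f :: "nat \<times> nat \<Rightarrow> 'b::comm_monoid_add"
  assumes "is_partition n lam"
  shows "(\<Sum>b\<in>boxes lam. f b) = (\<Sum>j=1..ncols lam. \<Sum>i=1..collen lam j. f (i, j))"
proof -
  have "(\<Sum>b\<in>boxes lam. f b) = (\<Sum>(j, i)\<in>(SIGMA j:{1..ncols lam}. {1..collen lam j}). f (i, j))"
    unfolding boxes_eq_Sigma[OF assms]
    by (subst sum.reindex) (auto simp: inj_on_def case_prod_unfold)
  then show ?thesis by (simp add: sum.Sigma)
qed

lemma boxes_eq_Sigma_rows:
  assumes "is_partition n lam"
  shows "boxes lam = (SIGMA i:{1..n}. {1..lam ! (i - 1)})"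
  using assms by (auto simp: boxes_def is_partition_def)

section \<open>Index set, fillings and the tensor space\<close>

lemma idxs_eq: "idxs n = P ` {1..n} \<union> Q ` {1..n}"
  by (auto simp: idxs_def)

lemma finite_idxs: "finite (idxs n)"
  by (simp add: idxs_eq)

lemma P_in_idxs[simp]: "P i \<in> idxs n \<longleftrightarrow> 1 \<le> i \<and> i \<le> n"
  and Q_in_idxs[simp]: "Q i \<in> idxs n \<longleftrightarrow> 1 \<le> i \<and> i \<le> n"
  by (auto simp: idxs_def)

lemma sum_idxs: "(\<Sum>a\<in>idxs n. f a) = (\<Sum>i=1..n. f (P i) + f (Q i))"
proof -
  have "(\<Sum>a\<in>idxs n. f a) = (\<Sum>a\<in>P ` {1..n}. f a) + (\<Sum>a\<in>Q ` {1..n}. f a)"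
    unfolding idxs_eq by (rule sum.union_disjoint) auto
  also have "\<dots> = (\<Sum>i=1..n. f (P i)) + (\<Sum>i=1..n. f (Q i))"
    by (simp add: sum.reindex inj_on_def)
  finally show ?thesis by (simp add: sum.distrib)
qed

lemma ixkey_inj: "ixkey a = ixkey b \<longleftrightarrow> a = b"
  by (cases a; cases b) (auto, presburger+)

lemma fillings_entry: "T \<in> fillings n lam \<Longrightarrow> b \<in> boxes lam \<Longrightarrow> T b \<in> idxs n"
  by (auto simp: fillings_def)

lemma filling_outside: "T \<in> fillings n lam \<Longrightarrow> b \<notin> boxes lam \<Longrightarrow> T b = P 0"
  unfolding fillings_def by blast

lemma finite_fillings:
  assumes "is_partition n lam"
  shows "finite (fillings n lam)"
proof (rule finite_subset)
  show "fillings n lam \<subseteq> (\<lambda>f b. if b \<in> boxes lam then f b else P 0) ` (\<Pi>\<^sub>E b\<in>boxes lam. idxs n)"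
  proof
    fix T assume T: "T \<in> fillings n lam"
    have "T = (\<lambda>b. if b \<in> boxes lam then restrict T (boxes lam) b else P 0)"
      using T by (auto simp: fillings_def)
    moreover have "restrict T (boxes lam) \<in> (\<Pi>\<^sub>E b\<in>boxes lam. idxs n)"
      using T by (auto simp: fillings_def)
    ultimately show "T \<in> (\<lambda>f b. if b \<in> boxes lam then f b else P 0) ` (\<Pi>\<^sub>E b\<in>boxes lam. idxs n)"
      by (rule image_eqI)
  qed
  show "finite ((\<lambda>f b. if b \<in> boxes lam then f b else P 0) ` (\<Pi>\<^sub>E b\<in>boxes lam. idxs n))"
    using finite_boxes[OF assms] finite_idxs by (intro finite_imageI finite_PiE) auto
qed

text \<open>Expanding one sum per box produces one term per tableau: this is how a tensor power of a
  matrix acts in the basis of tableaux.\<close>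

lemma prod_sum_fillings:
  fixes f :: "nat \<times> nat \<Rightarrow> ix \<Rightarrow> 'b::comm_semiring_1"
  assumes "is_partition n lam"
  shows "(\<Prod>b\<in>boxes lam. \<Sum>a\<in>idxs n. f b a) = (\<Sum>S\<in>fillings n lam. \<Prod>b\<in>boxes lam. f b (S b))"
proof -
  have "(\<Prod>b\<in>boxes lam. \<Sum>a\<in>idxs n. f b a) = (\<Sum>S\<in>(\<Pi>\<^sub>E b\<in>boxes lam. idxs n). \<Prod>b\<in>boxes lam. f b (S b))"
    using finite_boxes[OF assms] finite_idxs by (intro prod_sum_PiE) auto
  also have "\<dots> = (\<Sum>S\<in>fillings n lam. \<Prod>b\<in>boxes lam. f b (S b))"
    by (rule sum.reindex_bij_witness[of _ "\<lambda>S. restrict S (boxes lam)"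
          "\<lambda>f b. if b \<in> boxes lam then f b else P 0"])
       (auto simp: fillings_def PiE_def extensional_def fun_eq_iff intro!: prod.cong)
  finally show ?thesis .
qed

lemma delta_in_tens: "delta T \<in> tens n lam \<longleftrightarrow> T \<in> fillings n lam"
  by (auto simp: tens_def delta_def)

lemma csubspace_tens: "csubspace (tens n lam)"
  by (auto simp: csubspace_def tens_def) (metis add.right_neutral)

lemma filling_swap: 
  "T \<in> fillings n lam \<Longrightarrow> b \<in> boxes lam \<Longrightarrow> b' \<in> boxes lam \<Longrightarrow> T(b := T b', b' := T b) \<in> fillings n lam"
  by (auto simp: fillings_def)

lemma filling_upd:
  "T \<in> fillings n lam \<Longrightarrow> b \<in> boxes lam \<Longrightarrow> a \<in> idxs n \<Longrightarrow> T(b := a) \<in> fillings n lam"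
  by (auto simp: fillings_def)

lemma sorted_nth_in_card_le:
  assumes "finite R" "1 \<le> r" "r \<le> card R"
  shows "sorted_list_of_set R ! (r - 1) \<in> R"
  using assms by (metis (no_types, lifting) Suc_le_eq Suc_pred' less_le_trans nth_mem set_sorted_list_of_set
    sorted_list_of_set.length_sorted_key_list_of_set zero_less_one)

lemma card_le_bounds:
  assumes "finite R" "r \<in> (R::nat set)"
  shows "1 \<le> card {r' \<in> R. r' \<le> r}" "card {r' \<in> R. r' \<le> r} \<le> card R"
  using assms by (auto simp: card_mono card_gt_0_iff Suc_le_eq)

lemma filling_exch:
  assumes lam: "is_partition n lam" and T: "T \<in> fillings n lam"
    and j: "1 \<le> j1" "j1 < j2" "j2 \<le> ncols lam" and R: "R \<subseteq> {1..collen lam j1}" "card R \<le> collen lam j2"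
  shows "exch_tab T j1 j2 R \<in> fillings n lam"
proof -
  have fR: "finite R" using R finite_subset by blast
  have "exch_tab T j1 j2 R (r, c) \<in> idxs n" if "(r, c) \<in> boxes lam" for r c
    using that j R T sorted_nth_in_card_le[OF fR, of r] card_le_bounds[OF fR, of r]
    unfolding exch_tab_def
    by (auto intro!: fillings_entry[OF T] simp: mem_boxes_iff[OF lam])
  moreover have "exch_tab T j1 j2 R (r, c) = P 0" if "(r, c) \<notin> boxes lam" for r c
    using that j R T unfolding exch_tab_def
    by (auto simp: mem_boxes_iff[OF lam] fillings_def subset_iff)
  ultimately show ?thesis by (auto simp: fillings_def)
qed

lemma rels_subset_tens:
  assumes lam: "is_partition n lam"
  shows "alt_rels n lam \<union> exch_rels n lam \<union> symp_rels n lam \<subseteq> tens n lam"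
proof -
  have 1: "alt_rels n lam \<subseteq> tens n lam"
    by (auto simp: alt_rels_def delta_in_tens filling_swap
        intro!: csubspace_add[OF csubspace_tens])
  have 2: "exch_rels n lam \<subseteq> tens n lam"
    unfolding exch_rels_def
    by (safe intro!: csubspace_diff[OF csubspace_tens] csubspace_sum[OF csubspace_tens])
       (simp_all add: delta_in_tens filling_exch[OF lam])
  have 3: "symp_rels n lam \<subseteq> tens n lam"
    by (auto simp: symp_rels_def delta_in_tens
        intro!: csubspace_diff[OF csubspace_tens] csubspace_sum[OF csubspace_tens] filling_upd)
  show ?thesis using 1 2 3 by auto
qed

lemma Wrel_subset_tens: "is_partition n lam \<Longrightarrow> Wrel n lam \<subseteq> tens n lam"
  unfolding Wrel_def using cspan_minimal[OF csubspace_tens rels_subset_tens] .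

subsection \<open>Determinants and the exchange identity\<close>

text \<open>Rows are functions, so replacing a row is a function update; values outside the leading
  \<open>p\<close> columns are ignored.\<close>

definition detp :: "nat \<Rightarrow> (nat \<Rightarrow> nat \<Rightarrow> complex) \<Rightarrow> complex" where
  "detp p u = (\<Sum>\<sigma>\<in>{\<sigma>. \<sigma> permutes {1..p}}. of_int (sign \<sigma>) * (\<Prod>i=1..p. u i (\<sigma> i)))"

lemma plueck_eq_detp: "plueck a M = detp (length a) (\<lambda>i. M (a ! (i - 1)))"
  by (simp add: plueck_def detp_def)

lemma detp_cong:
  assumes "\<And>i q. i \<in> {1..p} \<Longrightarrow> q \<in> {1..p} \<Longrightarrow> u i q = v i q"
  shows "detp p u = detp p v"
  unfolding detp_def
proof (rule sum.cong[OF refl])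
  fix \<sigma> assume "\<sigma> \<in> {\<sigma>. \<sigma> permutes {1..p}}"
  then have "\<sigma> i \<in> {1..p}" if "i \<in> {1..p}" for i using that by (simp only: mem_Collect_eq permutes_in_image)
  then show "of_int (sign \<sigma>) * (\<Prod>i=1..p. u i (\<sigma> i)) = of_int (sign \<sigma>) * (\<Prod>i=1..p. v i (\<sigma> i))"
    using assms by (intro arg_cong2[where f = "(*)"] refl prod.cong) blast
qed

lemma permutes_finite_interval: "\<sigma> permutes {1..p::nat} \<Longrightarrow> permutation \<sigma>"
  using permutation_permutes by blast

lemma detp_permute:
  assumes \<pi>: "\<pi> permutes {1..p}"
  shows "detp p (\<lambda>i. u (\<pi> i)) = of_int (sign \<pi>) * detp p u"
proof -
  have "detp p (\<lambda>i. u (\<pi> i)) = (\<Sum>\<sigma>\<in>{\<sigma>. \<sigma> permutes {1..p}}. of_int (sign (\<sigma> \<circ> \<pi>)) * (\<Prod>i=1..p. u (\<pi> i) ((\<sigma> \<circ> \<pi>) i)))"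
    unfolding detp_def by (rule sum_permutations_compose_right[OF \<pi>])
  also have "\<dots> = (\<Sum>\<sigma>\<in>{\<sigma>. \<sigma> permutes {1..p}}. of_int (sign \<pi>) * (of_int (sign \<sigma>) * (\<Prod>i=1..p. u i (\<sigma> i))))"
  proof (rule sum.cong[OF refl])
    fix \<sigma> assume "\<sigma> \<in> {\<sigma>. \<sigma> permutes {1..p}}"
    then have "sign (\<sigma> \<circ> \<pi>) = sign \<sigma> * sign \<pi>"
      using \<pi> by (intro sign_compose permutes_finite_interval) auto
    moreover have "(\<Prod>i=1..p. u (\<pi> i) ((\<sigma> \<circ> \<pi>) i)) = (\<Prod>i=1..p. u i (\<sigma> i))"
      using prod.permute[OF \<pi>, of "\<lambda>i. u i (\<sigma> i)"] by (simp add: o_def)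
    ultimately show "of_int (sign (\<sigma> \<circ> \<pi>)) * (\<Prod>i=1..p. u (\<pi> i) ((\<sigma> \<circ> \<pi>) i))
        = of_int (sign \<pi>) * (of_int (sign \<sigma>) * (\<Prod>i=1..p. u i (\<sigma> i)))" by simp
  qed
  finally show ?thesis by (simp add: detp_def sum_distrib_left)
qed

lemma detp_swap:
  assumes "i \<in> {1..p}" "j \<in> {1..p}" "i \<noteq> j"
  shows "detp p (u(i := u j, j := u i)) = - detp p u"
proof -
  have "u(i := u j, j := u i) = (\<lambda>k. u (transpose i j k))"
    by (auto simp: fun_eq_iff transpose_def)
  then show ?thesis using detp_permute[OF permutes_swap_id[OF assms(1,2)], of u] assms(3)
    by (simp add: sign_swap_id)
qed

lemma detp_row_expand:
  assumes "r \<in> {1..p}"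
  shows "detp p (u(r := x)) = (\<Sum>c=1..p. x c * detp p (u(r := (\<lambda>k. if k = c then 1 else 0))))"
proof -
  have pr: "(\<Prod>i=1..p. (u(r := y)) i (\<sigma> i)) = y (\<sigma> r) * (\<Prod>i\<in>{1..p}-{r}. u i (\<sigma> i))" for y \<sigma>
    using assms by (subst prod.remove[of _ r]) (auto intro!: prod.cong)
  have "(\<Sum>c=1..p. x c * detp p (u(r := (\<lambda>k. if k = c then 1 else 0))))
      = (\<Sum>c=1..p. \<Sum>\<sigma>\<in>{\<sigma>. \<sigma> permutes {1..p}}. x c * (of_int (sign \<sigma>) * ((if \<sigma> r = c then 1 else 0) * (\<Prod>i\<in>{1..p}-{r}. u i (\<sigma> i)))))"
    unfolding detp_def pr by (simp add: sum_distrib_left)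
  also have "\<dots> = (\<Sum>\<sigma>\<in>{\<sigma>. \<sigma> permutes {1..p}}. \<Sum>c=1..p. x c * (of_int (sign \<sigma>) * ((if \<sigma> r = c then 1 else 0) * (\<Prod>i\<in>{1..p}-{r}. u i (\<sigma> i)))))"
    by (rule sum.swap)
  also have "\<dots> = (\<Sum>\<sigma>\<in>{\<sigma>. \<sigma> permutes {1..p}}. of_int (sign \<sigma>) * (x (\<sigma> r) * (\<Prod>i\<in>{1..p}-{r}. u i (\<sigma> i))))"
  proof (rule sum.cong[OF refl])
    fix \<sigma> assume "\<sigma> \<in> {\<sigma>. \<sigma> permutes {1..p}}"
    then have s: "\<sigma> r \<in> {1..p}" using assms by (simp only: mem_Collect_eq permutes_in_image)
    have "(\<Sum>c=1..p. x c * (of_int (sign \<sigma>) * ((if \<sigma> r = c then 1 else 0) * (\<Prod>i\<in>{1..p}-{r}. u i (\<sigma> i)))))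
      = (\<Sum>c=1..p. if \<sigma> r = c then x c * (of_int (sign \<sigma>) * (\<Prod>i\<in>{1..p}-{r}. u i (\<sigma> i))) else 0)"
      by (rule sum.cong) auto
    then show "(\<Sum>c=1..p. x c * (of_int (sign \<sigma>) * ((if \<sigma> r = c then 1 else 0) * (\<Prod>i\<in>{1..p}-{r}. u i (\<sigma> i)))))
      = of_int (sign \<sigma>) * (x (\<sigma> r) * (\<Prod>i\<in>{1..p}-{r}. u i (\<sigma> i)))"
      using s by simp
  qed
  also have "\<dots> = detp p (u(r := x))" unfolding detp_def pr by simp
  finally show ?thesis by simp
qed

text \<open>The terms of the double sum with \<open>\<sigma> m \<noteq> c\<close> cancel in pairs under the involution \<open>h\<close>.\<close>
lemma detp_cramer:
  assumes c: "c \<in> {1..p}"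
  shows "(\<Sum>m=1..p. detp p (al(m := be)) * al m c) = detp p al * be c"
proof -
  define S where "S = {\<sigma>. \<sigma> permutes {1..p}}"
  define F where "F = (\<lambda>(\<sigma>, m). of_int (sign \<sigma>) * ((\<Prod>i\<in>{1..p}-{m}. al i (\<sigma> i)) * be (\<sigma> m)) * al m c)"
  define A where "A = {x \<in> S \<times> {1..p}. fst x (snd x) \<noteq> c}"
  define B where "B = {x \<in> S \<times> {1..p}. fst x (snd x) = c}"
  have fin: "finite (S \<times> {1..p})" by (simp add: S_def finite_permutations)
  have pr: "(\<Prod>i=1..p. (al(m := be)) i (\<sigma> i)) = (\<Prod>i\<in>{1..p}-{m}. al i (\<sigma> i)) * be (\<sigma> m)"
    if "m \<in> {1..p}" for m \<sigma>
    using that by (subst prod.remove[of _ m]) (auto intro!: prod.cong)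
  have "(\<Sum>m=1..p. detp p (al(m := be)) * al m c) = (\<Sum>m=1..p. \<Sum>\<sigma>\<in>S. F (\<sigma>, m))"
    unfolding detp_def F_def S_def by (intro sum.cong refl) (simp only: pr sum_distrib_right prod.case)
  also have "\<dots> = (\<Sum>\<sigma>\<in>S. \<Sum>m=1..p. F (\<sigma>, m))" by (rule sum.swap)
  also have "\<dots> = (\<Sum>x\<in>S \<times> {1..p}. F x)" by (simp add: sum.cartesian_product case_prod_eta)
  also have "S \<times> {1..p} = A \<union> B" by (auto simp: A_def B_def)
  also have "(\<Sum>x\<in>A \<union> B. F x) = (\<Sum>x\<in>A. F x) + (\<Sum>x\<in>B. F x)"
    using fin by (intro sum.union_disjoint) (auto simp: A_def B_def)
  also have "(\<Sum>x\<in>A. F x) = 0"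
  proof -
    \<comment> \<open>The involution exchanges the values of \<sigma> at the marked row
      \<open>m\<close> and at the row where \<sigma> takes the value \<open>c\<close>, and marks the
      latter row instead.\<close>
    define h where "h = (\<lambda>(\<sigma> :: nat \<Rightarrow> nat, m :: nat). (\<sigma> \<circ> transpose m (inv \<sigma> c), inv \<sigma> c))"
    have h: "h x \<in> A \<and> h (h x) = x \<and> F (h x) = - F x" if "x \<in> A" for x
    proof -
      obtain \<sigma> m where x: "x = (\<sigma>, m)" by (cases x)
      have \<sigma>: "\<sigma> permutes {1..p}" and m: "m \<in> {1..p}" and ne: "\<sigma> m \<noteq> c"
        using that by (auto simp: A_def S_def x)
      define m' where "m' = inv \<sigma> c"
      have sm': "\<sigma> m' = c" unfolding m'_def using permutes_inverses(1)[OF \<sigma>] .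
      have m': "m' \<in> {1..p}" using c \<sigma> sm' by (metis permutes_in_image)
      have mm: "m \<noteq> m'" using sm' ne by auto
      define \<sigma>' where "\<sigma>' = \<sigma> \<circ> transpose m m'"
      have tp: "transpose m m' permutes {1..p}" by (rule permutes_swap_id[OF m m'])
      have \<sigma>': "\<sigma>' permutes {1..p}" unfolding \<sigma>'_def by (rule permutes_compose[OF tp \<sigma>])
      have hx: "h x = (\<sigma>', m')" by (simp add: h_def x m'_def \<sigma>'_def)
      have s'm: "\<sigma>' m = c" "\<sigma>' m' = \<sigma> m" by (auto simp: \<sigma>'_def sm')
      have inv': "inv \<sigma>' c = m" using s'm(1) permutes_inverses(2)[OF \<sigma>'] by metis
      have "\<sigma>' \<circ> transpose m' m = \<sigma>"
        by (auto simp: \<sigma>'_def fun_eq_iff transpose_def)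
      then have hh: "h (h x) = x" unfolding hx by (simp add: h_def inv' x)
      have sg: "sign \<sigma>' = - sign \<sigma>" unfolding \<sigma>'_def
        using mm by (subst sign_compose[OF permutes_finite_interval[OF \<sigma>] permutes_finite_interval[OF tp]]) (simp add: sign_swap_id)
      have "(\<Prod>i\<in>{1..p}-{m'}. al i (\<sigma>' i)) = al m c * (\<Prod>i\<in>{1..p}-{m'}-{m}. al i (\<sigma>' i))"
        using m mm by (subst prod.remove[of _ m]) (auto simp: s'm)
      also have "(\<Prod>i\<in>{1..p}-{m'}-{m}. al i (\<sigma>' i)) = (\<Prod>i\<in>{1..p}-{m}-{m'}. al i (\<sigma> i))"
        by (rule prod.cong) (auto simp: \<sigma>'_def)
      finally have 1: "(\<Prod>i\<in>{1..p}-{m'}. al i (\<sigma>' i)) = al m c * (\<Prod>i\<in>{1..p}-{m}-{m'}. al i (\<sigma> i))" .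
      have 2: "(\<Prod>i\<in>{1..p}-{m}. al i (\<sigma> i)) = al m' c * (\<Prod>i\<in>{1..p}-{m}-{m'}. al i (\<sigma> i))"
        using m' mm by (subst prod.remove[of _ m']) (auto simp: sm')
      have "F (\<sigma>', m') = - F (\<sigma>, m)" by (simp add: F_def 1 2 sg s'm del: One_nat_def)
      then have "F (h x) = - F x" using hx x by simp
      moreover have "h x \<in> A" unfolding hx A_def S_def using \<sigma>' m' s'm ne by simp
      ultimately show ?thesis using hh by simp
    qed
    have "(\<Sum>x\<in>A. F x) = (\<Sum>x\<in>A. - F x)"
    proof (rule sum.reindex_bij_witness[of _ h h])
      fix x assume "x \<in> A"
      then show "h (h x) = x" "h x \<in> A" "h (h x) = x" "h x \<in> A" "- F (h x) = F x" using h by auto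
    qed
    then show ?thesis by (simp add: sum_negf)
  qed
  also have "(\<Sum>x\<in>B. F x) = (\<Sum>\<sigma>\<in>S. of_int (sign \<sigma>) * (\<Prod>i=1..p. al i (\<sigma> i)) * be c)"
  proof (rule sum.reindex_bij_witness[of _ "\<lambda>\<sigma>. (\<sigma>, inv \<sigma> c)" fst])
    fix x assume "x \<in> B"
    then obtain \<sigma> m where x: "x = (\<sigma>, m)" "\<sigma> permutes {1..p}" "m \<in> {1..p}" "\<sigma> m = c"
      by (cases x) (auto simp: B_def S_def)
    show "(fst x, inv (fst x) c) = x" using x permutes_inverses(2)[OF x(2)] by auto
    show "fst x \<in> S" using x by (simp add: S_def)
    show "of_int (sign (fst x)) * (\<Prod>i=1..p. al i (fst x i)) * be c = F x"
    proof -
      have "(\<Prod>i=1..p. al i (\<sigma> i)) = al m c * (\<Prod>i\<in>{1..p}-{m}. al i (\<sigma> i))"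
        using prod.remove[OF _ x(3), of "\<lambda>i. al i (\<sigma> i)"] x(4) by (simp del: One_nat_def)
      then show ?thesis unfolding x(1) F_def prod.case fst_conv x(4) by (simp only: mult_ac)
    qed
  next
    fix \<sigma> assume "\<sigma> \<in> S"
    then have \<sigma>: "\<sigma> permutes {1..p}" by (simp add: S_def)
    have "\<sigma> (inv \<sigma> c) = c" using permutes_inverses(1)[OF \<sigma>] .
    moreover have "inv \<sigma> c \<in> {1..p}" using c permutes_in_image[OF permutes_inv[OF \<sigma>]] by blast
    ultimately show "(\<sigma>, inv \<sigma> c) \<in> B" using \<sigma> by (simp add: B_def S_def)
  qed simp
  also have "\<dots> = detp p al * be c" by (simp add: detp_def S_def sum_distrib_right)
  finally show ?thesis by (simp only: add_0_left)
qed

text \<open>Expand the second factor along row \<open>r\<close>. The coefficient of each cofactor is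
  then the left side of Cramer's identity \<open>detp_cramer\<close> for \<open>al\<close> with
  right-hand side \<open>be r\<close>.\<close>

lemma detp_exchange_one:
  assumes r: "r \<in> {1..p}"
  shows "detp p al * detp p be = (\<Sum>m=1..p. detp p (al(m := be r)) * detp p (be(r := al m)))"
proof -
  define cof where "cof c = detp p (be(r := (\<lambda>k. if k = c then 1 else 0)))" for c
  have ex: "detp p (be(r := x)) = (\<Sum>c=1..p. x c * cof c)" for x
    unfolding cof_def by (rule detp_row_expand[OF r])
  have "(\<Sum>m=1..p. detp p (al(m := be r)) * detp p (be(r := al m)))
      = (\<Sum>m=1..p. \<Sum>c=1..p. detp p (al(m := be r)) * al m c * cof c)"
    by (rule sum.cong[OF refl]) (simp only: ex sum_distrib_left mult.assoc)
  also have "\<dots> = (\<Sum>c=1..p. \<Sum>m=1..p. detp p (al(m := be r)) * al m c * cof c)"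
    by (rule sum.swap)
  also have "\<dots> = (\<Sum>c=1..p. detp p al * be r c * cof c)"
    by (rule sum.cong[OF refl]) (simp only: sum_distrib_right[symmetric] detp_cramer)
  also have "\<dots> = detp p al * detp p (be(r := be r))"
    by (simp only: ex sum_distrib_left mult.assoc)
  finally show ?thesis by (simp only: fun_upd_triv)
qed

text \<open>Two such bijections differ by a permutation of \<open>S\<close>, and transpositions
  generate all permutations. It is applied twice below to show that a quantity depends only on the
  image of an enumeration, not on its order.\<close>

lemma bij_betw_invariant:
  assumes S: "finite S" and f: "bij_betw f S A" and f': "bij_betw f' S A" and off: "\<And>x. x \<notin> S \<Longrightarrow> f x = f' x"
    and inv: "\<And>h a b. bij_betw h S A \<Longrightarrow> (\<And>x. x \<notin> S \<Longrightarrow> h x = f x) \<Longrightarrow> a \<in> S \<Longrightarrow> b \<in> S \<Longrightarrow> a \<noteq> b \<Longrightarrow> g (h \<circ> transpose a b) = g h"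
  shows "g f = g f'"
proof -
  define \<pi> where "\<pi> = (\<lambda>x. if x \<in> S then inv_into S f (f' x) else x)"
  have "bij_betw (\<lambda>x. inv_into S f (f' x)) S S"
    using bij_betw_trans[OF f' bij_betw_inv_into[OF f]] by (simp add: o_def)
  then have "bij_betw \<pi> S S" by (subst bij_betw_cong[of _ _ "\<lambda>x. inv_into S f (f' x)"]) (auto simp: \<pi>_def)
  then have \<pi>: "\<pi> permutes S" by (rule bij_imp_permutes) (simp add: \<pi>_def)
  have f'eq: "f' = f \<circ> \<pi>"
    using off f f' by (auto simp: fun_eq_iff \<pi>_def bij_betw_def intro!: f_inv_into_f[symmetric])
  have "\<forall>h. bij_betw h S A \<and> (\<forall>x. x \<notin> S \<longrightarrow> h x = f x) \<longrightarrow> g (h \<circ> \<pi>) = g h"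
    using \<pi> S
  proof (induction rule: permutes_induct)
    case id then show ?case by simp
  next
    case (swap a b p)
    show ?case
    proof (intro allI impI)
      fix h assume h: "bij_betw h S A \<and> (\<forall>x. x \<notin> S \<longrightarrow> h x = f x)"
      have "bij_betw (h \<circ> transpose a b) S A"
        using bij_betw_trans[OF permutes_imp_bij[OF permutes_swap_id[OF swap(1,2)]]] h by blast
      moreover have "\<forall>x. x \<notin> S \<longrightarrow> (h \<circ> transpose a b) x = f x"
        using h swap(1,2) by (auto simp: transpose_def)
      ultimately have "g ((h \<circ> transpose a b) \<circ> p) = g (h \<circ> transpose a b)" using swap by blast
      then show "g (h \<circ> (transpose a b \<circ> p)) = g h" using inv[of h a b] h swap(1-3) by (simp add: o_assoc)
    qed
  qed
  then show ?thesis using f f'eq by auto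
qed

text \<open>Here \<open>l\<close> lists the rows of \<open>al\<close> in the order in which they are
  exchanged for rows 1 to \<open>k\<close> of \<open>be\<close>. Ordered choices make an induction
  on \<open>k\<close> possible; increasing choices, as in \<open>exch_tab\<close>, are derived from
  them afterwards.\<close>

definition exa :: "nat \<Rightarrow> (nat \<Rightarrow> nat \<Rightarrow> complex) \<Rightarrow> (nat \<Rightarrow> nat \<Rightarrow> complex) \<Rightarrow> (nat \<Rightarrow> nat) \<Rightarrow> nat \<Rightarrow> nat \<Rightarrow> complex" where
  "exa k al be l = (\<lambda>r. if r \<in> l ` {1..k} then be (inv_into {1..k} l r) else al r)"

definition exb :: "nat \<Rightarrow> (nat \<Rightarrow> nat \<Rightarrow> complex) \<Rightarrow> (nat \<Rightarrow> nat \<Rightarrow> complex) \<Rightarrow> (nat \<Rightarrow> nat) \<Rightarrow> nat \<Rightarrow> nat \<Rightarrow> complex" where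
  "exb k al be l = (\<lambda>i. if i \<in> {1..k} then al (l i) else be i)"

definition injf :: "nat \<Rightarrow> nat \<Rightarrow> (nat \<Rightarrow> nat) set" where
  "injf k p = {l \<in> {1..k} \<rightarrow>\<^sub>E {1..p}. inj_on l {1..k}}"

lemma finite_injf: "finite (injf k p)"
  unfolding injf_def by (rule finite_subset[of _ "{1..k} \<rightarrow>\<^sub>E {1..p}"]) (auto intro: finite_PiE)

lemma injf_Suc:
  "(\<Sum>l\<in>injf (Suc k) p. f l) = (\<Sum>l\<in>injf k p. \<Sum>m\<in>{1..p} - l ` {1..k}. f (l(Suc k := m)))"
proof -
  have "(\<Sum>l\<in>injf k p. \<Sum>m\<in>{1..p} - l ` {1..k}. f (l(Suc k := m)))
      = (\<Sum>x\<in>Sigma (injf k p) (\<lambda>l. {1..p} - l ` {1..k}). f ((fst x)(Suc k := snd x)))"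
    by (subst sum.Sigma) (auto simp: finite_injf case_prod_unfold)
  also have "\<dots> = (\<Sum>l\<in>injf (Suc k) p. f l)"
  proof (rule sum.reindex_bij_witness[of _ "\<lambda>l. (restrict l {1..k}, l (Suc k))" "\<lambda>x. (fst x)(Suc k := snd x)"])
    fix x assume "x \<in> Sigma (injf k p) (\<lambda>l. {1..p} - l ` {1..k})"
    then obtain l m where x: "x = (l, m)" "l \<in> injf k p" "m \<in> {1..p}" "m \<notin> l ` {1..k}" by auto
    have S: "{1..Suc k} = insert (Suc k) {1..k}" by auto
    have le: "l \<in> {1..k} \<rightarrow>\<^sub>E {1..p}" and li: "inj_on l {1..k}" using x(2) by (auto simp: injf_def)
    have "restrict (l(Suc k := m)) {1..k} = l"
      using PiE_arb[OF le] by (auto simp: fun_eq_iff)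
    then show "(restrict ((fst x)(Suc k := snd x)) {1..k}, ((fst x)(Suc k := snd x)) (Suc k)) = x"
      by (simp add: x)
    have eq: "(l(Suc k := m)) i = l i" if "i \<in> {1..k}" for i using that by auto
    have "inj_on (l(Suc k := m)) {1..k}" using li by (subst inj_on_cong[of _ _ l]) (simp_all only: eq)
    moreover have "(l(Suc k := m)) ` {1..k} = l ` {1..k}" by (intro image_cong refl eq)
    ultimately have "inj_on (l(Suc k := m)) {1..Suc k}"
      unfolding S inj_on_insert using x(4) by (simp del: One_nat_def)
    moreover have "l(Suc k := m) \<in> {1..Suc k} \<rightarrow>\<^sub>E {1..p}"
      unfolding S by (rule PiE_fun_upd[OF x(3) le])
    ultimately show "(fst x)(Suc k := snd x) \<in> injf (Suc k) p" by (simp add: x(1) injf_def)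
  next
    fix l assume l: "l \<in> injf (Suc k) p"
    then have le: "l \<in> {1..Suc k} \<rightarrow>\<^sub>E {1..p}" and li: "inj_on l {1..Suc k}" by (auto simp: injf_def)
    show "(fst (restrict l {1..k}, l (Suc k)))(Suc k := snd (restrict l {1..k}, l (Suc k))) = l"
      using PiE_arb[OF le] by (auto simp: fun_eq_iff restrict_def)
    have "restrict l {1..k} \<in> injf k p"
    proof -
      have "inj_on l {1..k}" by (rule inj_on_subset[OF li]) auto
      then have "inj_on (restrict l {1..k}) {1..k}" by (subst inj_on_cong[of _ _ l]) auto
      moreover have "restrict l {1..k} \<in> {1..k} \<rightarrow>\<^sub>E {1..p}" using le by (auto simp: PiE_def Pi_def)
      ultimately show ?thesis by (simp add: injf_def)
    qed
    moreover have "l (Suc k) \<in> {1..p}" using le by (auto simp: PiE_def Pi_def)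
    moreover have "l (Suc k) \<notin> restrict l {1..k} ` {1..k}"
    proof
      assume "l (Suc k) \<in> restrict l {1..k} ` {1..k}"
      then obtain i where "i \<in> {1..k}" "l (Suc k) = l i" by auto
      then show False using inj_onD[OF li, of "Suc k" i] by auto
    qed
    ultimately show "(restrict l {1..k}, l (Suc k)) \<in> Sigma (injf k p) (\<lambda>l. {1..p} - l ` {1..k})" by simp
  qed simp
  finally show ?thesis by simp
qed

text \<open>Induction on \<open>k\<close>: exchanging one more row of \<open>be\<close>, the terms that hit a row exchanged before are
  the terms for \<open>k\<close> with two rows of \<open>be\<close> swapped, hence contribute \<open>- fact k\<close> each.\<close>
lemma detp_exchange_inj:
  "k \<le> p \<Longrightarrow> (\<Sum>l\<in>injf k p. detp p (exa k al be l) * detp p (exb k al be l)) = fact k * (detp p al * detp p be)"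
proof (induction k arbitrary: be)
  case 0
  have "injf 0 p = {\<lambda>x. undefined}" by (auto simp: injf_def)
  then show ?case by (simp add: exa_def exb_def)
next
  case (Suc k)
  define Y where "Y b = (\<Sum>l\<in>injf k p. detp p (exa k al b l) * detp p (exb k al b l))" for b
  define sw where "sw i = be(i := be (Suc k), Suc k := be i)" for i
  have kp: "Suc k \<in> {1..p}" using Suc.prems by simp
  have one: "detp p (exa k al be l) * detp p (exb k al be l)
      = (\<Sum>m\<in>{1..p} - l ` {1..k}. detp p (exa (Suc k) al be (l(Suc k := m))) * detp p (exb (Suc k) al be (l(Suc k := m))))
      + (\<Sum>i=1..k. detp p (exa k al (sw i) l) * detp p (exb k al (sw i) l))"
    if l: "l \<in> injf k p" for l
  proof -
    have le: "l \<in> {1..k} \<rightarrow>\<^sub>E {1..p}" and li: "inj_on l {1..k}" using l by (auto simp: injf_def)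
    have sub: "l ` {1..k} \<subseteq> {1..p}" using le by auto
    define t where "t m = detp p ((exa k al be l)(m := be (Suc k))) * detp p ((exb k al be l)(Suc k := exa k al be l m))" for m
    have "detp p (exa k al be l) * detp p (exb k al be l) = (\<Sum>m=1..p. t m)"
      unfolding t_def using detp_exchange_one[OF kp, of "exa k al be l" "exb k al be l"] by (simp add: exb_def)
    also have "\<dots> = (\<Sum>m\<in>{1..p} - l ` {1..k}. t m) + (\<Sum>m\<in>l ` {1..k}. t m)"
      using sub by (intro sum.subset_diff) auto
    also have "(\<Sum>m\<in>l ` {1..k}. t m) = (\<Sum>i=1..k. t (l i))"
      by (subst sum.reindex[OF li]) simp
    also have "\<dots> = (\<Sum>i=1..k. detp p (exa k al (sw i) l) * detp p (exb k al (sw i) l))"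
    proof (rule sum.cong[OF refl])
      fix i assume i: "i \<in> {1..k}"
      have iv: "inv_into {1..k} l (l j) = j" if "j \<in> {1..k}" for j using inv_into_f_f[OF li that] .
      have "exa k al be l (l i) = be i" using i by (simp add: exa_def iv del: One_nat_def)
      moreover have "(exa k al be l)(l i := be (Suc k)) = exa k al (sw i) l"
      proof
        fix r show "((exa k al be l)(l i := be (Suc k))) r = exa k al (sw i) l r"
        proof (cases "r \<in> l ` {1..k}")
          case True
          then obtain j where j: "r = l j" "j \<in> {1..k}" by auto
          have "l j = l i \<longleftrightarrow> j = i" by (rule inj_on_eq_iff[OF li j(2) i])
          moreover have "j \<noteq> Suc k" using j by auto
          ultimately show ?thesis using j i by (simp add: exa_def iv sw_def del: One_nat_def)
        next
          case False
          then have "r \<noteq> l i" using i by blast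
          then show ?thesis using False by (simp add: exa_def del: One_nat_def)
        qed
      qed
      moreover have "(exb k al be l)(Suc k := be i) = exb k al (sw i) l"
        using i by (auto simp: exb_def sw_def fun_eq_iff)
      ultimately show "t (l i) = detp p (exa k al (sw i) l) * detp p (exb k al (sw i) l)"
        by (simp add: t_def)
    qed
    also have "(\<Sum>m\<in>{1..p} - l ` {1..k}. t m) = (\<Sum>m\<in>{1..p} - l ` {1..k}. detp p (exa (Suc k) al be (l(Suc k := m))) * detp p (exb (Suc k) al be (l(Suc k := m))))"
    proof (rule sum.cong[OF refl])
      fix m assume m: "m \<in> {1..p} - l ` {1..k}"
      define l' where "l' = l(Suc k := m)"
      have S: "{1..Suc k} = insert (Suc k) {1..k}" by auto
      have eq: "l' i = l i" if "i \<in> {1..k}" for i using that by (auto simp: l'_def)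
      have im0: "l' ` {1..k} = l ` {1..k}" by (intro image_cong refl eq)
      have im: "l' ` {1..Suc k} = insert m (l ` {1..k})"
        unfolding S image_insert im0 by (simp add: l'_def)
      have "inj_on l' {1..k}" using li by (subst inj_on_cong[of _ _ l]) (simp_all only: eq)
      then have li': "inj_on l' {1..Suc k}"
        unfolding S inj_on_insert using m im0 by (simp add: l'_def del: One_nat_def)
      have iv: "inv_into {1..k} l (l j) = j" if "j \<in> {1..k}" for j using inv_into_f_f[OF li that] .
      have iv': "inv_into {1..Suc k} l' (l' j) = j" if "j \<in> {1..Suc k}" for j using inv_into_f_f[OF li' that] .
      have "(exa k al be l)(m := be (Suc k)) = exa (Suc k) al be l'"
      proof
        fix r
        consider "r = m" | j where "r = l j" "j \<in> {1..k}" | "r \<noteq> m" "r \<notin> l ` {1..k}" by blast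
        then show "((exa k al be l)(m := be (Suc k))) r = exa (Suc k) al be l' r"
        proof cases
          case 1
          then have "inv_into {1..Suc k} l' r = Suc k" using iv'[of "Suc k"] by (simp add: l'_def)
          then show ?thesis using 1 by (simp add: exa_def im del: One_nat_def)
        next
          case 2
          then have "inv_into {1..Suc k} l' r = j" using iv'[of j] eq[of j] by simp
          then show ?thesis using 2 m by (auto simp: exa_def im iv simp del: One_nat_def)
        next
          case 3
          then show ?thesis unfolding exa_def im by auto
        qed
      qed
      moreover have "exa k al be l m = al m" using m by (simp add: exa_def del: One_nat_def)
      moreover have "(exb k al be l)(Suc k := al m) = exb (Suc k) al be l'"
        by (auto simp: exb_def fun_eq_iff l'_def)
      ultimately show "t m = detp p (exa (Suc k) al be (l(Suc k := m))) * detp p (exb (Suc k) al be (l(Suc k := m)))"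
        by (simp add: t_def l'_def)
    qed
    finally show ?thesis .
  qed
  have "Y be = (\<Sum>l\<in>injf (Suc k) p. detp p (exa (Suc k) al be l) * detp p (exb (Suc k) al be l)) + (\<Sum>l\<in>injf k p. \<Sum>i=1..k. detp p (exa k al (sw i) l) * detp p (exb k al (sw i) l))"
    unfolding injf_Suc Y_def sum.distrib[symmetric] by (rule sum.cong[OF refl one])
  moreover have "(\<Sum>l\<in>injf k p. \<Sum>i=1..k. detp p (exa k al (sw i) l) * detp p (exb k al (sw i) l)) = (\<Sum>i=1..k. Y (sw i))"
    unfolding Y_def by (rule sum.swap)
  moreover have "Y b = fact k * (detp p al * detp p b)" for b
    unfolding Y_def using Suc by simp
  moreover have "(\<Sum>i=1..k. fact k * (detp p al * detp p (sw i))) = (\<Sum>i=1..k. fact k * (detp p al * - detp p be))"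
  proof (rule sum.cong[OF refl])
    fix i assume "i \<in> {1..k}"
    then have "detp p (sw i) = - detp p be" unfolding sw_def using kp by (intro detp_swap) auto
    then show "fact k * (detp p al * detp p (sw i)) = fact k * (detp p al * - detp p be)" by simp
  qed
  ultimately have "(\<Sum>l\<in>injf (Suc k) p. detp p (exa (Suc k) al be l) * detp p (exb (Suc k) al be l))
      = fact k * (detp p al * detp p be) - (\<Sum>i=1..k. fact k * (detp p al * - detp p be))"
    by simp
  also have "(\<Sum>i=1..k. fact k * (detp p al * - detp p be)) = - (of_nat k * (fact k * (detp p al * detp p be)))"
    by (simp only: sum_constant card_atLeastAtMost mult_minus_right) simp
  also have "fact k * (detp p al * detp p be) - - (of_nat k * (fact k * (detp p al * detp p be)))
      = of_nat (Suc k) * fact k * (detp p al * detp p be)"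
    by (simp only: of_nat_Suc distrib_right mult_1 diff_minus_eq_add mult.assoc)
  also have "of_nat (Suc k) * fact k = (fact (Suc k) :: complex)" by (simp only: fact_Suc)
  finally show ?case .
qed

section \<open>From ordered exchanges to exchanges along row sets\<close>

lemma nth_sorted_card:
  fixes R :: "nat set"
  assumes R: "finite R" and i: "i < card R"
  shows "card {r' \<in> R. r' \<le> sorted_list_of_set R ! i} = Suc i"
proof -
  define xs where "xs = sorted_list_of_set R"
  have xs: "sorted_wrt (<) xs" "set xs = R" "length xs = card R"
    using R by (auto simp: xs_def)
  have "{r' \<in> R. r' \<le> xs ! i} = (\<lambda>j. xs ! j) ` {..i}"
  proof safe
    fix r assume r: "r \<in> R" "r \<le> xs ! i"
    then obtain j where j: "j < length xs" "r = xs ! j" using xs(2) by (metis in_set_conv_nth)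
    have "j \<le> i"
    proof (rule ccontr)
      assume "\<not> j \<le> i"
      then have "xs ! i < xs ! j" using xs(1) j(1) by (auto simp: sorted_wrt_iff_nth_less)
      then show False using r j by simp
    qed
    then show "r \<in> (!) xs ` {..i}" using j by auto
  next
    fix j assume j: "j \<le> i"
    show "xs ! j \<in> R" using j i xs by (metis le_less_trans nth_mem)
    show "xs ! j \<le> xs ! i"
      using j i xs by (metis le_eq_less_or_eq order_refl sorted_wrt_nth_less)
  qed
  moreover have "inj_on (\<lambda>j. xs ! j) {..i}"
    using xs i by (auto simp: inj_on_def nth_eq_iff_index_eq strict_sorted_iff xs_def)
  ultimately show ?thesis by (simp add: card_image xs_def)
qed

text \<open>\<open>exch_tab\<close> fills one column through the sorted enumeration of
  \<open>R\<close> and the other through the rank in \<open>R\<close>; the two maps are inverse to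
  each other.\<close>

lemma bij_betw_sorted_nth:
  assumes R: "finite (R :: nat set)"
  shows "bij_betw (\<lambda>i. sorted_list_of_set R ! (i - 1)) {1..card R} R"
    and "bij_betw (\<lambda>r. card {r' \<in> R. r' \<le> r}) R {1..card R}"
proof -
  let ?f = "\<lambda>i. sorted_list_of_set R ! (i - 1)"
  have c: "card {r' \<in> R. r' \<le> ?f i} = i" if "i \<in> {1..card R}" for i
    using nth_sorted_card[OF R, of "i - 1"] that by auto
  have inj: "inj_on ?f {1..card R}" by (rule inj_on_inverseI[where g = "\<lambda>r. card {r' \<in> R. r' \<le> r}"]) (rule c)
  have im: "?f ` {1..card R} = R"
  proof (rule card_subset_eq[OF R])
    show "?f ` {1..card R} \<subseteq> R" using sorted_nth_in_card_le[OF R] by auto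
    show "card (?f ` {1..card R}) = card R" using card_image[OF inj] by simp
  qed
  show 1: "bij_betw ?f {1..card R} R" using inj im by (simp only: bij_betw_def simp_thms)
  show "bij_betw (\<lambda>r. card {r' \<in> R. r' \<le> r}) R {1..card R}"
  proof (rule bij_betw_byWitness[where f' = ?f])
    show "\<forall>r\<in>R. ?f (card {r' \<in> R. r' \<le> r}) = r"
    proof
      fix r assume "r \<in> R"
      then obtain i where "i \<in> {1..card R}" "r = ?f i" using im by blast
      then show "?f (card {r' \<in> R. r' \<le> r}) = r" using c by simp
    qed
  qed (use c card_le_bounds[OF R] im in auto)
qed

text \<open>The left column of \<open>exch_tab\<close>, with \<open>exL\<close> below as the right
  one. Both are polymorphic because they are applied to indices in tableaux and to rows of a
  matrix.\<close>

definition exR :: "(nat \<Rightarrow> 'b) \<Rightarrow> (nat \<Rightarrow> 'b) \<Rightarrow> nat set \<Rightarrow> nat \<Rightarrow> 'b" where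
  "exR al be R = (\<lambda>r. if r \<in> R then be (card {r' \<in> R. r' \<le> r}) else al r)"

definition exL :: "(nat \<Rightarrow> 'b) \<Rightarrow> (nat \<Rightarrow> 'b) \<Rightarrow> nat set \<Rightarrow> nat \<Rightarrow> 'b" where
  "exL al be R = (\<lambda>i. if 1 \<le> i \<and> i \<le> card R then al (sorted_list_of_set R ! (i - 1)) else be i)"

text \<open>Each set \<open>R\<close> of \<open>k\<close> rows is the image of \<open>fact k\<close>
  injections. Reordering an injection changes the signs of both determinants simultaneously, so all
  these injections contribute the same product and the factor \<open>fact k\<close> cancels.\<close>

lemma detp_exchange_sets:
  assumes kp: "k \<le> p"
  shows "(\<Sum>R\<in>{R. R \<subseteq> {1..p} \<and> card R = k}. detp p (exR al be R) * detp p (exL al be R)) = detp p al * detp p be"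
proof -
  define tm where "tm l = detp p (exa k al be l) * detp p (exb k al be l)" for l
  define TT where "TT = {R. R \<subseteq> {1..p} \<and> card R = k}"
  have finT: "finite TT" unfolding TT_def by (rule finite_subset[of _ "Pow {1..p}"]) auto
  have inR: "(\<Sum>l\<in>{l \<in> injf k p. l ` {1..k} = R}. tm l) = fact k * (detp p (exR al be R) * detp p (exL al be R))"
    if R: "R \<in> TT" for R
  proof -
    have fR: "finite R" and Rp: "R \<subseteq> {1..p}" and cR: "card R = k"
      using R finite_subset by (auto simp: TT_def)
    define l0 where "l0 = (\<lambda>i. if i \<in> {1..k} then sorted_list_of_set R ! (i - 1) else undefined)"
    have l0v: "l0 i = sorted_list_of_set R ! (i - 1)" if "1 \<le> i" "i \<le> k" for i using that by (simp add: l0_def)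
    have bij0: "bij_betw l0 {1..k} R"
      using bij_betw_sorted_nth(1)[OF fR] cR by (subst bij_betw_cong[of _ _ "\<lambda>i. sorted_list_of_set R ! (i - 1)"]) (auto simp: l0_def)
    then have inj0: "inj_on l0 {1..k}" and im0: "l0 ` {1..k} = R" by (auto simp: bij_betw_def)
    have inv: "tm (h \<circ> transpose a b) = tm h"
      if h: "bij_betw h {1..k} R" and a: "a \<in> {1..k}" and b: "b \<in> {1..k}" and ab: "a \<noteq> b" for h a b
    proof -
      have hi: "inj_on h {1..k}" and him: "h ` {1..k} = R" using h by (auto simp: bij_betw_def)
      define h' where "h' = h \<circ> transpose a b"
      have tp: "transpose a b permutes {1..k}" by (rule permutes_swap_id[OF a b])
      have h': "bij_betw h' {1..k} R" unfolding h'_def by (rule bij_betw_trans[OF permutes_imp_bij[OF tp] h])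
      have hi': "inj_on h' {1..k}" and him': "h' ` {1..k} = R" using h' by (auto simp: bij_betw_def)
      have ha: "h a \<in> {1..p}" "h b \<in> {1..p}" "h a \<noteq> h b"
        using Rp him a b ab inj_on_eq_iff[OF hi a b] by blast+
      have iv: "inv_into {1..k} h (h j) = j" if "j \<in> {1..k}" for j using inv_into_f_f[OF hi that] .
      have iv': "inv_into {1..k} h' (h' j) = j" if "j \<in> {1..k}" for j using inv_into_f_f[OF hi' that] .
      have "exa k al be h' = (exa k al be h)(h a := exa k al be h (h b), h b := exa k al be h (h a))"
      proof
        fix r
        show "exa k al be h' r = ((exa k al be h)(h a := exa k al be h (h b), h b := exa k al be h (h a))) r"
        proof (cases "r \<in> R")
          case True
          then obtain j where j: "j \<in> {1..k}" "r = h j" using him by blast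
          define j' where "j' = transpose a b j"
          have j': "j' \<in> {1..k}" unfolding j'_def using j(1) permutes_in_image[OF tp] by blast
          have "r = h' j'" by (simp add: j j'_def h'_def)
          then have "exa k al be h' r = be j'" using iv'[OF j'] True him' by (simp add: exa_def del: One_nat_def)
          moreover have "exa k al be h (h i) = be i" if "i \<in> {1..k}" for i
            using iv[OF that] that by (simp add: exa_def del: One_nat_def)
          moreover have "h j = h a \<longleftrightarrow> j = a" "h j = h b \<longleftrightarrow> j = b"
            by (rule inj_on_eq_iff[OF hi j(1) a], rule inj_on_eq_iff[OF hi j(1) b])
          ultimately show ?thesis using a b j by (simp add: j'_def transpose_def del: One_nat_def)
        next
          case False
          then have "r \<noteq> h a" "r \<noteq> h b" using a b him by blast+
          then show ?thesis using False him him' by (simp add: exa_def del: One_nat_def)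
        qed
      qed
      then have 1: "detp p (exa k al be h') = - detp p (exa k al be h)"
        using detp_swap[OF ha] by simp
      have "exb k al be h' = (exb k al be h)(a := exb k al be h b, b := exb k al be h a)"
        using a b by (auto simp: exb_def h'_def transpose_def fun_eq_iff)
      moreover have "a \<in> {1..p}" "b \<in> {1..p}" using a b kp by auto
      ultimately have 2: "detp p (exb k al be h') = - detp p (exb k al be h)"
        using detp_swap[of a p b "exb k al be h"] ab by simp
      show ?thesis unfolding tm_def h'_def[symmetric] 1 2 by simp
    qed
    have SR: "{l \<in> injf k p. l ` {1..k} = R} = {l \<in> extensional {1..k}. bij_betw l {1..k} R}"
      using Rp unfolding injf_def bij_betw_def PiE_def Pi_def by blast
    have tl: "tm l = tm l0" if "l \<in> {l \<in> extensional {1..k}. bij_betw l {1..k} R}" for l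
    proof (rule bij_betw_invariant[of "{1..k}" l R l0 "tm"])
      show "l x = l0 x" if "x \<notin> {1..k}" for x using that \<open>l \<in> _\<close> by (auto simp: l0_def extensional_def)
      show "tm (h \<circ> transpose a b) = tm h"
        if "bij_betw h {1..k} R" "\<And>x. x \<notin> {1..k} \<Longrightarrow> h x = l x" "a \<in> {1..k}" "b \<in> {1..k}" "a \<noteq> b" for h a b
        by (rule inv[OF that(1,3-5)])
    qed (use that bij0 in auto)
    have "bij_betw (\<lambda>\<pi>. restrict (l0 \<circ> \<pi>) {1..k}) {\<pi>. \<pi> permutes {1..k}} {l \<in> extensional {1..k}. bij_betw l {1..k} R}"
    proof (rule bij_betwI[where g = "\<lambda>l x. if x \<in> {1..k} then inv_into {1..k} l0 (l x) else x"])
      show "(\<lambda>\<pi>. restrict (l0 \<circ> \<pi>) {1..k}) \<in> {\<pi>. \<pi> permutes {1..k}} \<rightarrow> {l \<in> extensional {1..k}. bij_betw l {1..k} R}"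
      proof safe
        fix \<pi> assume "\<pi> permutes {1..k}"
        then have "bij_betw (l0 \<circ> \<pi>) {1..k} R" by (intro bij_betw_trans[OF permutes_imp_bij bij0])
        then show "bij_betw (restrict (l0 \<circ> \<pi>) {1..k}) {1..k} R"
          by (subst bij_betw_cong[of _ _ "l0 \<circ> \<pi>"]) auto
      qed auto
      show "(\<lambda>l x. if x \<in> {1..k} then inv_into {1..k} l0 (l x) else x) \<in> {l \<in> extensional {1..k}. bij_betw l {1..k} R} \<rightarrow> {\<pi>. \<pi> permutes {1..k}}"
      proof (rule Pi_I, rule CollectI)
        fix l assume "l \<in> {l \<in> extensional {1..k}. bij_betw l {1..k} R}"
        then have "bij_betw (inv_into {1..k} l0 \<circ> l) {1..k} {1..k}"
          by (intro bij_betw_trans[OF _ bij_betw_inv_into[OF bij0]]) auto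
        then have "bij_betw (\<lambda>x. if x \<in> {1..k} then inv_into {1..k} l0 (l x) else x) {1..k} {1..k}"
          by (subst bij_betw_cong[of _ _ "inv_into {1..k} l0 \<circ> l"]) auto
        then show "(\<lambda>x. if x \<in> {1..k} then inv_into {1..k} l0 (l x) else x) permutes {1..k}"
          by (rule bij_imp_permutes) auto
      qed
      show "(\<lambda>x. if x \<in> {1..k} then inv_into {1..k} l0 (restrict (l0 \<circ> \<pi>) {1..k} x) else x) = \<pi>"
        if "\<pi> \<in> {\<pi>. \<pi> permutes {1..k}}" for \<pi>
      proof
        fix x
        from that have \<pi>: "\<pi> permutes {1..k}" by simp
        show "(if x \<in> {1..k} then inv_into {1..k} l0 (restrict (l0 \<circ> \<pi>) {1..k} x) else x) = \<pi> x"
        proof (cases "x \<in> {1..k}")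
          case True
          then have "\<pi> x \<in> {1..k}" using permutes_in_image[OF \<pi>] by blast
          then show ?thesis using True inv_into_f_f[OF inj0, of "\<pi> x"] by (simp del: One_nat_def)
        next
          case False
          then show ?thesis using permutes_not_in[OF \<pi> False] by (simp only: if_False)
        qed
      qed
      show "restrict (l0 \<circ> (\<lambda>x. if x \<in> {1..k} then inv_into {1..k} l0 (l x) else x)) {1..k} = l"
        if "l \<in> {l \<in> extensional {1..k}. bij_betw l {1..k} R}" for l
      proof
        fix x
        from that have l: "l \<in> extensional {1..k}" "bij_betw l {1..k} R" by auto
        show "restrict (l0 \<circ> (\<lambda>x. if x \<in> {1..k} then inv_into {1..k} l0 (l x) else x)) {1..k} x = l x"
        proof (cases "x \<in> {1..k}")
          case True
          then have "l x \<in> l0 ` {1..k}" using l(2) im0 by (auto simp: bij_betw_def)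
          then show ?thesis using True f_inv_into_f[of "l x" l0 "{1..k}"] by (simp del: One_nat_def)
        next
          case False
          then show ?thesis using extensional_arb[OF l(1) False] by (simp only: restrict_apply if_False)
        qed
      qed
    qed
    then have "card {l \<in> extensional {1..k}. bij_betw l {1..k} R} = card {\<pi>. \<pi> permutes {1..k}}"
      by (rule bij_betw_same_card[symmetric])
    then have c: "card {l \<in> extensional {1..k}. bij_betw l {1..k} R} = fact k"
      by (simp add: card_permutations)
    have "(\<Sum>l\<in>{l \<in> injf k p. l ` {1..k} = R}. tm l) = (\<Sum>l\<in>{l \<in> extensional {1..k}. bij_betw l {1..k} R}. tm l0)"
      unfolding SR by (rule sum.cong[OF refl tl])
    also have "\<dots> = fact k * tm l0" by (simp only: sum_constant c of_nat_fact)
    also have "tm l0 = detp p (exR al be R) * detp p (exL al be R)"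
    proof -
      have "exa k al be l0 = exR al be R"
      proof
        fix r show "exa k al be l0 r = exR al be R r"
        proof (cases "r \<in> R")
          case True
          then obtain j where j: "j \<in> {1..k}" "r = l0 j" using im0 by blast
          then have "card {r' \<in> R. r' \<le> r} = j"
            using nth_sorted_card[OF fR, of "j - 1"] cR by (auto simp: l0v)
          then show ?thesis using j inv_into_f_f[OF inj0 j(1)] im0 True
            by (simp add: exa_def exR_def del: One_nat_def)
        next
          case False then show ?thesis using im0 by (simp add: exa_def exR_def del: One_nat_def)
        qed
      qed
      moreover have "exb k al be l0 = exL al be R"
        using cR by (auto simp: exb_def exL_def l0v fun_eq_iff)
      ultimately show ?thesis by (simp add: tm_def)
    qed
    finally show ?thesis .
  qed
  have "fact k * (detp p al * detp p be) = (\<Sum>l\<in>injf k p. tm l)"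
    unfolding tm_def by (rule detp_exchange_inj[OF kp, symmetric])
  also have "\<dots> = (\<Sum>R\<in>TT. \<Sum>l\<in>{l \<in> injf k p. l ` {1..k} = R}. tm l)"
  proof (rule sum.group[symmetric])
    show "(\<lambda>l. l ` {1..k}) ` injf k p \<subseteq> TT"
      by (auto simp: TT_def injf_def card_image)
  qed (auto simp: finite_injf finT)
  also have "\<dots> = (\<Sum>R\<in>TT. fact k * (detp p (exR al be R) * detp p (exL al be R)))"
    by (rule sum.cong[OF refl inR])
  also have "\<dots> = fact k * (\<Sum>R\<in>TT. detp p (exR al be R) * detp p (exL al be R))"
    by (simp add: sum_distrib_left)
  finally show ?thesis by (simp add: TT_def)
qed

definition pad :: "nat \<Rightarrow> (nat \<Rightarrow> nat \<Rightarrow> complex) \<Rightarrow> nat \<Rightarrow> nat \<Rightarrow> complex" where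
  "pad q w = (\<lambda>i. if i \<le> q then w i else (\<lambda>c. if c = i then 1 else 0))"

text \<open>The unit rows force every contributing permutation to fix the positions above
  \<open>q\<close>.\<close>

lemma detp_pad:
  assumes "q \<le> p"
  shows "detp p (pad q w) = detp q w"
proof -
  have sub: "{\<sigma>. \<sigma> permutes {1..q}} \<subseteq> {\<sigma>. \<sigma> permutes {1..p}}"
    using assms permutes_subset by (metis atLeastatMost_subset_iff mem_Collect_eq order_refl subsetI)
  have S: "{1..p} = {1..q} \<union> {q<..p}" using assms by auto
  have pr: "(\<Prod>i=1..p. pad q w i (\<sigma> i)) = (\<Prod>i=1..q. w i (\<sigma> i)) * (\<Prod>i\<in>{q<..p}. if \<sigma> i = i then 1 else 0)" for \<sigma>
    unfolding S by (subst prod.union_disjoint) (auto simp: pad_def intro!: arg_cong2[where f = "(*)"] prod.cong)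
  have "detp p (pad q w) = (\<Sum>\<sigma>\<in>{\<sigma>. \<sigma> permutes {1..q}}. of_int (sign \<sigma>) * (\<Prod>i=1..p. pad q w i (\<sigma> i)))"
    unfolding detp_def
  proof (rule sum.mono_neutral_right[OF _ sub])
    show "finite {\<sigma>. \<sigma> permutes {1..p}}" by (simp add: finite_permutations)
    show "\<forall>\<sigma>\<in>{\<sigma>. \<sigma> permutes {1..p}} - {\<sigma>. \<sigma> permutes {1..q}}. of_int (sign \<sigma>) * (\<Prod>i=1..p. pad q w i (\<sigma> i)) = 0"
    proof
      fix \<sigma> assume s: "\<sigma> \<in> {\<sigma>. \<sigma> permutes {1..p}} - {\<sigma>. \<sigma> permutes {1..q}}"
      then have "\<not> (\<forall>x. x \<notin> {1..q} \<longrightarrow> \<sigma> x = x)" by (auto simp: permutes_def)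
      then obtain x where x: "x \<notin> {1..q}" "\<sigma> x \<noteq> x" by auto
      then have "x \<in> {1..p}" using s by (auto simp: permutes_def)
      then have "x \<in> {q<..p}" using x by auto
      then have "(\<Prod>i\<in>{q<..p}. if \<sigma> i = i then 1 else (0::complex)) = 0" using x by (intro prod_zero) auto
      then show "of_int (sign \<sigma>) * (\<Prod>i=1..p. pad q w i (\<sigma> i)) = 0" unfolding pr by simp
    qed
  qed
  also have "\<dots> = detp q w"
    unfolding detp_def
  proof (rule sum.cong[OF refl])
    fix \<sigma> assume "\<sigma> \<in> {\<sigma>. \<sigma> permutes {1..q}}"
    then have "\<sigma> i = i" if "i \<in> {q<..p}" for i using that by (auto simp: permutes_def)
    then have "(\<Prod>i\<in>{q<..p}. if \<sigma> i = i then 1 else (0::complex)) = 1" by (intro prod.neutral) auto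
    then show "of_int (sign \<sigma>) * (\<Prod>i=1..p. pad q w i (\<sigma> i)) = of_int (sign \<sigma>) * (\<Prod>i=1..q. w i (\<sigma> i))"
      unfolding pr by simp
  qed
  finally show ?thesis .
qed

text \<open>The shorter column is completed by unit vectors to a square block of the size of the longer one.\<close>
lemma detp_exchange:
  assumes kq: "k \<le> q" and qp: "q \<le> p"
  shows "(\<Sum>R\<in>{R. R \<subseteq> {1..p} \<and> card R = k}. detp p (exR al be R) * detp q (exL al be R)) = detp p al * detp q be"
proof -
  have "(\<Sum>R\<in>{R. R \<subseteq> {1..p} \<and> card R = k}. detp p (exR al be R) * detp q (exL al be R))
      = (\<Sum>R\<in>{R. R \<subseteq> {1..p} \<and> card R = k}. detp p (exR al (pad q be) R) * detp p (exL al (pad q be) R))"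
  proof (rule sum.cong[OF refl])
    fix R assume "R \<in> {R. R \<subseteq> {1..p} \<and> card R = k}"
    then have R: "R \<subseteq> {1..p}" "card R = k" "finite R" using finite_subset by auto
    have "exR al be R = exR al (pad q be) R"
      using card_le_bounds(2)[OF R(3)] R(2) kq by (fastforce simp: exR_def pad_def fun_eq_iff)
    moreover have "exL al (pad q be) R = pad q (exL al be R)"
      using R(2) kq by (auto simp: exL_def pad_def fun_eq_iff)
    ultimately show "detp p (exR al be R) * detp q (exL al be R) = detp p (exR al (pad q be) R) * detp p (exL al (pad q be) R)"
      by (simp add: detp_pad[OF qp])
  qed
  also have "\<dots> = detp p al * detp p (pad q be)" using kq qp by (intro detp_exchange_sets) auto
  finally show ?thesis by (simp add: detp_pad[OF qp])
qed

subsection \<open>Evaluation of tableaux on isotropic frames\<close>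

text \<open>The value of the polynomial \<open>xtab lam T\<close> at \<open>M\<close>, as
  \<open>evalp_xtab\<close> confirms later; \<open>ev\<close> extends it linearly to the tensor
  space.\<close>

definition Phi :: "nat list \<Rightarrow> (nat \<times> nat \<Rightarrow> ix) \<Rightarrow> (ix \<Rightarrow> nat \<Rightarrow> complex) \<Rightarrow> complex" where
  "Phi lam T M = (\<Prod>j=1..ncols lam. plueck (column lam T j) M)"

definition ev :: "nat \<Rightarrow> nat list \<Rightarrow> (ix \<Rightarrow> nat \<Rightarrow> complex) \<Rightarrow> ((nat \<times> nat \<Rightarrow> ix) \<Rightarrow> complex) \<Rightarrow> complex" where
  "ev n lam M \<phi> = (\<Sum>T\<in>fillings n lam. \<phi> T * Phi lam T M)"

lemma length_column[simp]: "length (column lam T j) = collen lam j"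
  by (simp add: column_def)

lemma nth_column: "i \<in> {1..collen lam j} \<Longrightarrow> column lam T j ! (i - 1) = T (i, j)"
  by (auto simp: column_def nth_append simp del: upt_Suc)

lemma plueck_column: "plueck (column lam T j) M = detp (collen lam j) (\<lambda>i. M (T (i, j)))"
  unfolding plueck_eq_detp length_column by (rule detp_cong) (simp only: nth_column)

lemma ev_delta: "is_partition n lam \<Longrightarrow> T \<in> fillings n lam \<Longrightarrow> ev n lam M (delta T) = Phi lam T M"
  using finite_fillings[of n lam] by (simp add: ev_def delta_def if_distrib[of "\<lambda>x. x * _"] cong: if_cong)

lemma ev_add: "ev n lam M (\<lambda>x. u x + v x) = ev n lam M u + ev n lam M v"
  by (simp only: ev_def sum.distrib distrib_right)

lemma ev_scale: "ev n lam M (\<lambda>x. c * u x) = c * ev n lam M u"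
  by (simp only: ev_def sum_distrib_left mult.assoc)

lemma ev_diff: "ev n lam M (\<lambda>x. u x - v x) = ev n lam M u - ev n lam M v"
  by (simp only: ev_def sum_subtractf left_diff_distrib)

lemma ev_sum: "ev n lam M (\<lambda>x. \<Sum>i\<in>I. f i x) = (\<Sum>i\<in>I. ev n lam M (f i))"
  unfolding ev_def sum_distrib_right by (rule sum.swap)

lemma csubspace_ker_ev: "csubspace {\<phi>. ev n lam M \<phi> = 0}"
proof -
  have "ev n lam M (\<lambda>x. 0) = 0" by (simp only: ev_def mult_zero_left sum.neutral_const)
  then show ?thesis unfolding csubspace_def mem_Collect_eq ev_add ev_scale by simp
qed

text \<open>Multiplying out all minors at once gives terms with one matrix entry per box. Changes at
  single boxes can then be followed even if they affect different columns.\<close>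

lemma Phi_expand:
  assumes lam: "is_partition n lam"
  shows "Phi lam T M = (\<Sum>\<sigma>\<in>(\<Pi>\<^sub>E j\<in>{1..ncols lam}. {\<sigma>. \<sigma> permutes {1..collen lam j}}).
      (\<Prod>j=1..ncols lam. of_int (sign (\<sigma> j))) * (\<Prod>b\<in>boxes lam. M (T b) (\<sigma> (snd b) (fst b))))"
proof -
  have "Phi lam T M = (\<Prod>j=1..ncols lam. \<Sum>\<sigma>\<in>{\<sigma>. \<sigma> permutes {1..collen lam j}}.
      of_int (sign \<sigma>) * (\<Prod>i=1..collen lam j. M (T (i, j)) (\<sigma> i)))"
    by (simp only: Phi_def plueck_column detp_def)
  also have "\<dots> = (\<Sum>\<sigma>\<in>(\<Pi>\<^sub>E j\<in>{1..ncols lam}. {\<sigma>. \<sigma> permutes {1..collen lam j}}).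
      \<Prod>j=1..ncols lam. of_int (sign (\<sigma> j)) * (\<Prod>i=1..collen lam j. M (T (i, j)) (\<sigma> j i)))"
    by (rule prod_sum_PiE) (simp_all add: finite_permutations)
  finally show ?thesis by (simp only: prod.distrib prod_boxes[OF lam] fst_conv snd_conv)
qed

lemma Phi_alt:
  assumes lam: "is_partition n lam" and b: "b \<in> boxes lam" "b' \<in> boxes lam" "b \<noteq> b'" "snd b = snd b'"
  shows "Phi lam (T(b := T b', b' := T b)) M = - Phi lam T M"
proof -
  obtain i i' j where bb: "b = (i, j)" "b' = (i', j)" using b(4) by (cases b; cases b') auto
  have ii: "i \<in> {1..collen lam j}" "i' \<in> {1..collen lam j}" "i \<noteq> i'" and j: "j \<in> {1..ncols lam}"
    using b bb by (auto simp: mem_boxes_iff[OF lam])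
  define T' where "T' = T(b := T b', b' := T b)"
  have eq: "(\<lambda>i. M (T' (i, j))) = (\<lambda>i. M (T (i, j)))(i := M (T (i', j)), i' := M (T (i, j)))"
    using ii by (auto simp: T'_def bb fun_eq_iff)
  have "detp (collen lam j) (\<lambda>i. M (T' (i, j))) = - detp (collen lam j) (\<lambda>i. M (T (i, j)))"
    unfolding eq using detp_swap[OF ii, of "\<lambda>i. M (T (i, j))"] by simp
  moreover have "(\<Prod>j'\<in>{1..ncols lam} - {j}. detp (collen lam j') (\<lambda>i. M (T' (i, j')))) = (\<Prod>j'\<in>{1..ncols lam} - {j}. detp (collen lam j') (\<lambda>i. M (T (i, j'))))"
    by (rule prod.cong) (auto simp: T'_def bb)
  ultimately show ?thesis unfolding Phi_def plueck_column T'_def[symmetric] prod.remove[OF finite_atLeastAtMost j]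
    by simp
qed

lemma exch_tab_left: "j1 \<noteq> j2 \<Longrightarrow> (\<lambda>i. exch_tab T j1 j2 R (i, j1)) = exR (\<lambda>i. T (i, j1)) (\<lambda>i. T (i, j2)) R"
  by (auto simp: exch_tab_def exR_def fun_eq_iff)

lemma exch_tab_right: "j1 \<noteq> j2 \<Longrightarrow> (\<lambda>i. exch_tab T j1 j2 R (i, j2)) = exL (\<lambda>i. T (i, j1)) (\<lambda>i. T (i, j2)) R"
  by (auto simp: exch_tab_def exL_def fun_eq_iff)

lemma exch_tab_other: "j \<noteq> j1 \<Longrightarrow> j \<noteq> j2 \<Longrightarrow> exch_tab T j1 j2 R (i, j) = T (i, j)"
  by (auto simp: exch_tab_def)

lemma exR_comp: "(\<lambda>i. f (exR a b R i)) = exR (\<lambda>i. f (a i)) (\<lambda>i. f (b i)) R"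
  and exL_comp: "(\<lambda>i. f (exL a b R i)) = exL (\<lambda>i. f (a i)) (\<lambda>i. f (b i)) R"
  by (auto simp: exR_def exL_def fun_eq_iff)

lemma Phi_exch:
  assumes lam: "is_partition n lam" and j: "1 \<le> j1" "j1 < j2" "j2 \<le> ncols lam" and k: "k \<le> collen lam j2"
  shows "(\<Sum>R\<in>{R. R \<subseteq> {1..collen lam j1} \<and> card R = k}. Phi lam (exch_tab T j1 j2 R) M) = Phi lam T M"
proof -
  define X where "X = (\<Prod>j\<in>{1..ncols lam} - {j1} - {j2}. detp (collen lam j) (\<lambda>i. M (T (i, j))))"
  define D where "D S j = detp (collen lam j) (\<lambda>i. M (S (i, j)))" for S :: "nat \<times> nat \<Rightarrow> ix" and j
  have j1: "j1 \<in> {1..ncols lam}" and j2: "j2 \<in> {1..ncols lam} - {j1}" using j by auto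
  have split: "Phi lam S M = D S j1 * (D S j2 * (\<Prod>j\<in>{1..ncols lam} - {j1} - {j2}. D S j))" for S
    unfolding Phi_def plueck_column prod.remove[OF finite_atLeastAtMost j1] prod.remove[OF finite_Diff[OF finite_atLeastAtMost] j2] D_def ..
  have "Phi lam (exch_tab T j1 j2 R) M = (detp (collen lam j1) (exR (\<lambda>i. M (T (i, j1))) (\<lambda>i. M (T (i, j2))) R)
      * detp (collen lam j2) (exL (\<lambda>i. M (T (i, j1))) (\<lambda>i. M (T (i, j2))) R)) * X" for R
  proof -
    have 1: "(\<lambda>i. M (exch_tab T j1 j2 R (i, j1))) = exR (\<lambda>i. M (T (i, j1))) (\<lambda>i. M (T (i, j2))) R"
      by (simp only: fun_cong[OF exch_tab_left[OF less_imp_neq[OF j(2)]]] exR_comp)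
    have 2: "(\<lambda>i. M (exch_tab T j1 j2 R (i, j2))) = exL (\<lambda>i. M (T (i, j1))) (\<lambda>i. M (T (i, j2))) R"
      by (simp only: fun_cong[OF exch_tab_right[OF less_imp_neq[OF j(2)]]] exL_comp)
    have 3: "(\<Prod>j\<in>{1..ncols lam} - {j1} - {j2}. D (exch_tab T j1 j2 R) j) = X"
      unfolding X_def D_def by (rule prod.cong) (auto simp: exch_tab_other)
    show ?thesis unfolding split 3 by (simp only: D_def 1 2 mult.assoc)
  qed
  then have "(\<Sum>R\<in>{R. R \<subseteq> {1..collen lam j1} \<and> card R = k}. Phi lam (exch_tab T j1 j2 R) M)
      = (\<Sum>R\<in>{R. R \<subseteq> {1..collen lam j1} \<and> card R = k}. detp (collen lam j1) (exR (\<lambda>i. M (T (i, j1))) (\<lambda>i. M (T (i, j2))) R)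
      * detp (collen lam j2) (exL (\<lambda>i. M (T (i, j1))) (\<lambda>i. M (T (i, j2))) R)) * X"
    by (simp only: sum_distrib_right)
  also have "\<dots> = (detp (collen lam j1) (\<lambda>i. M (T (i, j1))) * detp (collen lam j2) (\<lambda>i. M (T (i, j2)))) * X"
    using k collen_antimono[OF lam, of j1 j2] j by (subst detp_exchange) auto
  also have "\<dots> = Phi lam T M"
    unfolding split D_def X_def by (simp only: mult.assoc)
  finally show ?thesis .
qed

text \<open>In each term of the expansion the two boxes, summed over \<open>i\<close>, contribute
  the form evaluated on two columns of \<open>M\<close>. Isotropy makes it zero, and it is zero also
  if both boxes pick the same column of \<open>M\<close>.\<close>

lemma Phi_symp:
  assumes lam: "is_partition n lam" and M: "good_matrix n M"
    and B: "B \<in> boxes lam" "B' \<in> boxes lam" "B \<noteq> B'"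
  shows "(\<Sum>i=1..n. Phi lam (T(B := P i, B' := Q i)) M - Phi lam (T(B := Q i, B' := P i)) M) = 0"
proof -
  define SS where "SS = (\<Pi>\<^sub>E j\<in>{1..ncols lam}. {\<sigma>. \<sigma> permutes {1..collen lam j}})"
  define sg :: "(nat \<Rightarrow> nat \<Rightarrow> nat) \<Rightarrow> complex" where "sg \<sigma> = (\<Prod>j=1..ncols lam. of_int (sign (\<sigma> j)))" for \<sigma> :: "nat \<Rightarrow> nat \<Rightarrow> nat"
  define X where "X \<sigma> = (\<Prod>b\<in>boxes lam - {B} - {B'}. M (T b) (\<sigma> (snd b) (fst b)))" for \<sigma> :: "nat \<Rightarrow> nat \<Rightarrow> nat"
  define r where "r \<sigma> b = \<sigma> (snd b) (fst b)" for \<sigma> :: "nat \<Rightarrow> nat \<Rightarrow> nat" and b :: "nat \<times> nat"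
  have B': "B' \<in> boxes lam - {B}" using B by auto
  have ph: "Phi lam (T(B := a, B' := a')) M = (\<Sum>\<sigma>\<in>SS. sg \<sigma> * (M a (r \<sigma> B) * (M a' (r \<sigma> B') * X \<sigma>)))" for a a'
  proof -
    have "(\<Prod>b\<in>boxes lam. M ((T(B := a, B' := a')) b) (\<sigma> (snd b) (fst b))) = M a (r \<sigma> B) * (M a' (r \<sigma> B') * X \<sigma>)" for \<sigma>
      unfolding prod.remove[OF finite_boxes[OF lam] B(1)] prod.remove[OF finite_Diff[OF finite_boxes[OF lam]] B'] r_def X_def
      using B(3) by (intro arg_cong2[where f = "(*)"] prod.cong) auto
    then show ?thesis unfolding Phi_expand[OF lam] SS_def sg_def by simp
  qed
  have "(\<Sum>i=1..n. Phi lam (T(B := P i, B' := Q i)) M - Phi lam (T(B := Q i, B' := P i)) M)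
     = (\<Sum>i=1..n. \<Sum>\<sigma>\<in>SS. sg \<sigma> * X \<sigma> * (M (P i) (r \<sigma> B) * M (Q i) (r \<sigma> B') - M (Q i) (r \<sigma> B) * M (P i) (r \<sigma> B')))"
    unfolding ph sum_subtractf[symmetric] by (intro sum.cong refl) (simp add: algebra_simps)
  also have "\<dots> = (\<Sum>\<sigma>\<in>SS. sg \<sigma> * X \<sigma> * fform n (\<lambda>a. M a (r \<sigma> B)) (\<lambda>a. M a (r \<sigma> B')))"
    unfolding fform_def sum_distrib_left by (rule sum.swap)
  also have "\<dots> = 0"
  proof (rule sum.neutral, rule ballI)
    fix \<sigma> assume s: "\<sigma> \<in> SS"
    have "r \<sigma> b \<in> {1..n}" if "b \<in> boxes lam" for b
    proof -
      obtain i j where b: "b = (i, j)" by (cases b)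
      have "\<sigma> j permutes {1..collen lam j}" "i \<in> {1..collen lam j}"
        using that s by (auto simp: b mem_boxes_iff[OF lam] SS_def)
      then have "\<sigma> j i \<in> {1..collen lam j}" using permutes_in_image by metis
      then show ?thesis using collen_le[OF lam, of j] by (auto simp: r_def b)
    qed
    then have "fform n (\<lambda>a. M a (r \<sigma> B)) (\<lambda>a. M a (r \<sigma> B')) = 0"
      using M B unfolding good_matrix_def by blast
    then show "sg \<sigma> * X \<sigma> * fform n (\<lambda>a. M a (r \<sigma> B)) (\<lambda>a. M a (r \<sigma> B')) = 0" by simp
  qed
  finally show ?thesis .
qed

lemma ev_rels_zero:
  assumes lam: "is_partition n lam" and M: "good_matrix n M"
    and \<rho>: "\<rho> \<in> alt_rels n lam \<union> exch_rels n lam \<union> symp_rels n lam"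
  shows "ev n lam M \<rho> = 0"
  using \<rho>
proof (elim UnE)
  assume "\<rho> \<in> alt_rels n lam"
  then obtain T b b' where r: "\<rho> = (\<lambda>S. delta T S + delta (T(b := T b', b' := T b)) S)"
    "T \<in> fillings n lam" "b \<in> boxes lam" "b' \<in> boxes lam" "b \<noteq> b'" "snd b = snd b'"
    unfolding alt_rels_def by blast
  show ?thesis unfolding r(1) ev_add
    using r(2-) by (simp add: ev_delta[OF lam] filling_swap Phi_alt[OF lam])
next
  assume "\<rho> \<in> exch_rels n lam"
  then obtain T j1 j2 k where r: "\<rho> = (\<lambda>S. delta T S - (\<Sum>R\<in>{R. R \<subseteq> {1..collen lam j1} \<and> card R = k}. delta (exch_tab T j1 j2 R) S))"
    "T \<in> fillings n lam" "1 \<le> j1" "j1 < j2" "j2 \<le> ncols lam" "k \<le> collen lam j2"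
    unfolding exch_rels_def by blast
  have "(\<Sum>R\<in>{R. R \<subseteq> {1..collen lam j1} \<and> card R = k}. ev n lam M (delta (exch_tab T j1 j2 R)))
     = (\<Sum>R\<in>{R. R \<subseteq> {1..collen lam j1} \<and> card R = k}. Phi lam (exch_tab T j1 j2 R) M)"
    by (rule sum.cong[OF refl], rule ev_delta[OF lam], rule filling_exch[OF lam r(2-5)]) (use r(6) in auto)
  also have "\<dots> = Phi lam T M" by (rule Phi_exch[OF lam r(3-6)])
  finally show ?thesis unfolding r(1) ev_diff ev_sum by (simp only: ev_delta[OF lam r(2)] diff_self)
next
  assume "\<rho> \<in> symp_rels n lam"
  then obtain T B B' where r: "\<rho> = (\<lambda>S. \<Sum>i=1..n. delta (T(B := P i, B' := Q i)) S - delta (T(B := Q i, B' := P i)) S)"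
    "T \<in> fillings n lam" "B \<in> boxes lam" "B' \<in> boxes lam" "B \<noteq> B'"
    unfolding symp_rels_def by blast
  have "ev n lam M \<rho> = (\<Sum>i=1..n. Phi lam (T(B := P i, B' := Q i)) M - Phi lam (T(B := Q i, B' := P i)) M)"
    unfolding r(1) ev_sum ev_diff using r(2-4)
    by (intro sum.cong refl arg_cong2[where f = "(-)"] ev_delta[OF lam] filling_upd) auto
  then show ?thesis using Phi_symp[OF lam M r(3-5)] by simp
qed

lemma ev_Wrel_zero:
  assumes "is_partition n lam" "good_matrix n M" "\<rho> \<in> Wrel n lam"
  shows "ev n lam M \<rho> = 0"
  using cspan_minimal[OF csubspace_ker_ev, of "alt_rels n lam \<union> exch_rels n lam \<union> symp_rels n lam" n lam M]
    ev_rels_zero[OF assms(1,2)] assms(3) unfolding Wrel_def by blast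

subsection \<open>Spanning by symplectic tableaux\<close>

text \<open>This is the surjectivity, in degree \<open>m > card L / 2\<close>, of multiplication by
  \<open>\<Sum>j\<in>L. w j\<close> on the algebra generated by commuting \<open>w j\<close> with \<open>(w j)\<^sup>2 = 0\<close>.
  The weights \<open>x\<close> are the coefficients of \<open>(s ^ m - (- u) ^ m) / (s + u)\<close> with \<open>s = \<Sum>j\<in>J. w j\<close>
  and \<open>u = \<Sum>j\<in>L - J. w j\<close>, where \<open>u ^ m = 0\<close>.\<close>
lemma upper_layer_vanishing:
  fixes G :: "nat set \<Rightarrow> complex"
  assumes L: "finite L" and J: "J \<subseteq> L" "card J = m" "card L < 2 * m"
    and rel: "\<And>S. S \<subseteq> L \<Longrightarrow> Suc (card S) = m \<Longrightarrow> (\<Sum>y\<in>L - S. G (insert y S)) = 0"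
  shows "G J = 0"
proof -
  define x :: "nat set \<Rightarrow> complex" where "x S = (-1) ^ card (S - J) * fact (card (S \<inter> J)) * fact (card (S - J))" for S
  define A where "A = {S. S \<subseteq> L \<and> Suc (card S) = m}"
  define U where "U = {V. V \<subseteq> L \<and> card V = m}"
  have finA: "finite A" and finU: "finite U" unfolding A_def U_def
    using L by (auto intro: finite_subset[of _ "Pow L"])
  have fin: "finite S" if "S \<subseteq> L" for S using that L finite_subset by blast
  have "0 = (\<Sum>S\<in>A. x S * (\<Sum>y\<in>L - S. G (insert y S)))" by (simp add: A_def rel)
  also have "\<dots> = (\<Sum>S\<in>A. \<Sum>y\<in>L - S. x S * G (insert y S))" by (simp add: sum_distrib_left)
  also have "\<dots> = (\<Sum>p\<in>Sigma A (\<lambda>S. L - S). x (fst p) * G (insert (snd p) (fst p)))"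
    using L finA by (subst sum.Sigma) (auto simp: case_prod_unfold)
  also have "\<dots> = (\<Sum>p\<in>Sigma U (\<lambda>V. V). x (fst p - {snd p}) * G (fst p))"
  proof (rule sum.reindex_bij_witness[of _ "\<lambda>p. (fst p - {snd p}, snd p)" "\<lambda>p. (insert (snd p) (fst p), snd p)"])
    fix p assume "p \<in> Sigma A (\<lambda>S. L - S)"
    then obtain S y where p: "p = (S, y)" "S \<subseteq> L" "Suc (card S) = m" "y \<in> L" "y \<notin> S" by (auto simp: A_def)
    show "(fst (insert (snd p) (fst p), snd p) - {snd (insert (snd p) (fst p), snd p)}, snd (insert (snd p) (fst p), snd p)) = p"
      using p by auto
    show "(insert (snd p) (fst p), snd p) \<in> Sigma U (\<lambda>V. V)" using p fin[of S] by (auto simp: U_def)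
    show "x (fst (insert (snd p) (fst p), snd p) - {snd (insert (snd p) (fst p), snd p)}) * G (fst (insert (snd p) (fst p), snd p))
        = x (fst p) * G (insert (snd p) (fst p))" using p by simp
  next
    fix p assume "p \<in> Sigma U (\<lambda>V. V)"
    then obtain V y where p: "p = (V, y)" "V \<subseteq> L" "card V = m" "y \<in> V" by (auto simp: U_def)
    show "(insert (snd (fst p - {snd p}, snd p)) (fst (fst p - {snd p}, snd p)), snd (fst p - {snd p}, snd p)) = p"
      using p by auto
    have "Suc (card (V - {y})) = m" using card_Suc_Diff1[OF fin[OF p(2)] p(4)] p by simp
    then show "(fst p - {snd p}, snd p) \<in> Sigma A (\<lambda>S. L - S)" using p by (auto simp: A_def)
  qed
  also have "\<dots> = (\<Sum>V\<in>U. \<Sum>y\<in>V. x (V - {y}) * G V)"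
    using finU fin by (subst sum.Sigma) (auto simp: case_prod_unfold U_def)
  also have "\<dots> = (\<Sum>V\<in>U. if V = J then fact m * G J else 0)"
  proof (rule sum.cong[OF refl])
    fix V assume "V \<in> U"
    then have V: "V \<subseteq> L" "card V = m" "finite V" using fin by (auto simp: U_def)
    define a b where "a = card (V \<inter> J)" and "b = card (V - J)"
    have ab: "a + b = m" unfolding a_def b_def using V card_Int_Diff[of V J] by simp
    have "b \<le> card (L - J)" unfolding b_def using V L by (intro card_mono) auto
    also have "\<dots> < m" using card_Diff_subset[OF fin[OF J(1)] J(1)] J by simp
    \<comment> \<open>This is where \<open>card L < 2 * m\<close> enters: fewer than
      \<open>m\<close> elements lie outside \<open>J\<close>, so \<open>V\<close> meets
      \<open>J\<close>.\<close>
    finally have a0: "0 < a" using ab by simp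
    have x1: "x (V - {y}) = (-1) ^ b * fact (a - 1) * fact b" if "y \<in> V \<inter> J" for y
    proof -
      have "(V - {y}) - J = V - J" "(V - {y}) \<inter> J = (V \<inter> J) - {y}" using that by auto
      then show ?thesis using that V unfolding x_def a_def b_def by (simp add: card_Diff_singleton)
    qed
    have x2: "x (V - {y}) = (-1) ^ (b - 1) * fact a * fact (b - 1)" if "y \<in> V - J" for y
    proof -
      have "(V - {y}) - J = (V - J) - {y}" "(V - {y}) \<inter> J = V \<inter> J" using that by auto
      then show ?thesis using that V unfolding x_def a_def b_def by (simp add: card_Diff_singleton)
    qed
    have "(\<Sum>y\<in>V. x (V - {y})) = (\<Sum>y\<in>V \<inter> J. x (V - {y})) + (\<Sum>y\<in>V - J. x (V - {y}))"
      using sum.Int_Diff[OF V(3), of "\<lambda>y. x (V - {y})" J] by simp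
    also have "(\<Sum>y\<in>V \<inter> J. x (V - {y})) = of_nat a * ((-1) ^ b * fact (a - 1) * fact b)"
      by (simp add: x1 a_def)
    also have "(\<Sum>y\<in>V - J. x (V - {y})) = of_nat b * ((-1) ^ (b - 1) * fact a * fact (b - 1))"
      by (simp add: x2 b_def)
    also have "of_nat a * ((-1) ^ b * fact (a - 1) * fact b) = (-1) ^ b * fact a * (fact b :: complex)"
      using a0 fact_reduce[of a, where 'a = complex] by simp
    finally have s: "(\<Sum>y\<in>V. x (V - {y})) = (-1) ^ b * fact a * fact b + of_nat b * ((-1) ^ (b - 1) * fact a * fact (b - 1))" .
    have VJ: "V = J \<longleftrightarrow> b = 0"
    proof
      assume "b = 0"
      then have "V \<subseteq> J" using V by (auto simp: b_def)
      then show "V = J" using card_subset_eq[OF fin[OF J(1)]] V J by simp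
    qed (simp add: b_def)
    have "(\<Sum>y\<in>V. x (V - {y})) = (if V = J then fact m else 0)"
    proof (cases "b = 0")
      case True then show ?thesis using s ab VJ by simp
    next
      case False
      then obtain b' where b': "b = Suc b'" by (cases b) auto
      \<comment> \<open>Removing an element of \<open>J\<close> or one outside \<open>J\<close>
        gives the same total up to opposite signs.\<close>
      have "(\<Sum>y\<in>V. x (V - {y})) = 0" unfolding s b' by (simp add: algebra_simps)
      then show ?thesis using VJ False by simp
    qed
    then show "(\<Sum>y\<in>V. x (V - {y}) * G V) = (if V = J then fact m * G J else 0)"
      unfolding sum_distrib_right[symmetric] by simp
  qed
  also have "\<dots> = fact m * G J" using finU J by (simp add: U_def)
  finally show ?thesis by simp
qed

section \<open>Functionals killing all relations and maximal tableaux\<close>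

lemma obtain_lex_max:
  fixes f g :: "'a \<Rightarrow> nat"
  assumes "finite X" "X \<noteq> {}"
  obtains x where "x \<in> X" "\<And>y. y \<in> X \<Longrightarrow> f y \<le> f x" "\<And>y. y \<in> X \<Longrightarrow> f y = f x \<Longrightarrow> g y \<le> g x"
proof -
  define Y where "Y = {x \<in> X. f x = Max (f ` X)}"
  have "Max (f ` X) \<in> f ` X" using assms by (intro Max_in) auto
  then obtain x0 where "x0 \<in> X" "f x0 = Max (f ` X)" by (metis imageE)
  then have Y: "finite Y" "Y \<noteq> {}" using assms by (auto simp: Y_def)
  then have "Max (g ` Y) \<in> g ` Y" by (intro Max_in) auto
  then obtain x where x: "x \<in> Y" "g x = Max (g ` Y)" by auto
  show thesis
  proof
    show "x \<in> X" using x by (simp add: Y_def)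
    show "f y \<le> f x" if "y \<in> X" for y using x that assms by (simp add: Y_def)
    show "g y \<le> g x" if "y \<in> X" "f y = f x" for y
    proof -
      have "y \<in> Y" using that x by (simp add: Y_def)
      then show ?thesis using x(2) Y by simp
    qed
  qed
qed

lemma sum_two:
  assumes "finite A" "b \<in> A" "b' \<in> A" "b \<noteq> b'"
  shows "sum g A = g b + (g b' + sum g (A - {b} - {b'}))"
  using assms by (simp add: sum.remove[of A b] sum.remove[of "A - {b}" b'])

text \<open>Fewer than \<open>N\<close> powers of \<open>N\<close> do not add up to the next power,
  so one larger exponent outweighs all of them together.\<close>

lemma key_weight_bound:
  assumes "finite S" "card S < N" "\<And>s. s \<in> S \<Longrightarrow> e s \<le> (\<kappa>::nat)"
  shows "(\<Sum>s\<in>S. N ^ e s) < (N::nat) ^ Suc \<kappa>"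
proof -
  have "(\<Sum>s\<in>S. N ^ e s) \<le> (\<Sum>s\<in>S. N ^ \<kappa>)"
    using assms by (intro sum_mono power_increasing) auto
  also have "\<dots> = card S * N ^ \<kappa>" by simp
  also have "\<dots> < N * N ^ \<kappa>" using assms by (intro mult_strict_right_mono) auto
  finally show ?thesis by simp
qed

text \<open>\<open>l T\<close> is the value at \<open>T\<close> of a linear functional on the tensor
  space that kills the relations and the symplectic tableaux. Spanning amounts to the vanishing of
  every such functional.\<close>

locale relation_functional =
  fixes n :: nat and lam :: "nat list" and l :: "(nat \<times> nat \<Rightarrow> ix) \<Rightarrow> complex"
  assumes lam: "is_partition n lam"
    and alt: "\<And>T b b'. T \<in> fillings n lam \<Longrightarrow> b \<in> boxes lam \<Longrightarrow> b' \<in> boxes lam \<Longrightarrow> b \<noteq> b' \<Longrightarrow> snd b = snd b'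
        \<Longrightarrow> l (T(b := T b', b' := T b)) = - l T"
    and exch: "\<And>T j1 j2 k. T \<in> fillings n lam \<Longrightarrow> 1 \<le> j1 \<Longrightarrow> j1 < j2 \<Longrightarrow> j2 \<le> ncols lam \<Longrightarrow> k \<le> collen lam j2
        \<Longrightarrow> l T = (\<Sum>R\<in>{R. R \<subseteq> {1..collen lam j1} \<and> card R = k}. l (exch_tab T j1 j2 R))"
    and symp: "\<And>T B B'. T \<in> fillings n lam \<Longrightarrow> B \<in> boxes lam \<Longrightarrow> B' \<in> boxes lam \<Longrightarrow> B \<noteq> B'
        \<Longrightarrow> (\<Sum>i=1..n. l (T(B := P i, B' := Q i)) - l (T(B := Q i, B' := P i))) = 0"
    and vanish: "\<And>T. symplectic_tab n lam T \<Longrightarrow> l T = 0"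
begin

lemma repeated:
  assumes "T \<in> fillings n lam" "b \<in> boxes lam" "b' \<in> boxes lam" "b \<noteq> b'" "snd b = snd b'" "T b = T b'"
  shows "l T = 0"
proof -
  have "T(b := T b', b' := T b) = T" using assms(6) by auto
  then show ?thesis using alt[OF assms(1-5)] by simp
qed

text \<open>Larger than each set of boxes to which \<open>key_weight_bound\<close> is applied: at
  most \<open>n\<close> boxes of one column, or two boxes for each relabelled pair.\<close>

definition base :: nat where "base = 2 * n + 2"

text \<open>The factor \<open>snd b\<close> rewards large entries far to the right, and the
  exponential in the key lets a single large entry outweigh the smaller ones it is compared with.
  The row-weighted \<open>nu\<close> sees the order inside a column, which \<open>mu\<close> does
  not.\<close>

definition mu :: "(nat \<times> nat \<Rightarrow> ix) \<Rightarrow> nat" where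
  "mu T = (\<Sum>b\<in>boxes lam. snd b * base ^ ixkey (T b))"

definition nu :: "(nat \<times> nat \<Rightarrow> ix) \<Rightarrow> nat" where
  "nu T = (\<Sum>b\<in>boxes lam. fst b * ixkey (T b))"

end

text \<open>The straightening algorithm in dual form. Transferring larger entries to a column further right,
  or replacing a pair of entries by a larger one, increases \<open>mu\<close>; sorting a column fixes \<open>mu\<close> and
  increases \<open>nu\<close>. So at a tableau outside the kernel of \<open>l\<close> that is maximal for \<open>mu\<close> and then \<open>nu\<close>, no
  relation can be applied, and it is symplectic.\<close>
locale maximal_tableau = relation_functional +
  fixes T :: "nat \<times> nat \<Rightarrow> ix"
  assumes T: "T \<in> fillings n lam" and nz: "l T \<noteq> 0"
    and mu_max: "\<And>S. S \<in> fillings n lam \<Longrightarrow> mu T < mu S \<Longrightarrow> l S = 0"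
    and nu_max: "\<And>S. S \<in> fillings n lam \<Longrightarrow> mu S = mu T \<Longrightarrow> nu T < nu S \<Longrightarrow> l S = 0"
begin

lemma col_step:
  assumes b: "(i, j) \<in> boxes lam" "(Suc i, j) \<in> boxes lam"
  shows "ixkey (T (i, j)) < ixkey (T (Suc i, j))"
proof (rule ccontr)
  assume "\<not> ixkey (T (i, j)) < ixkey (T (Suc i, j))"
  moreover have "T (i, j) \<noteq> T (Suc i, j)" using repeated[OF T b] nz by auto
  then have "ixkey (T (i, j)) \<noteq> ixkey (T (Suc i, j))" by (simp add: ixkey_inj)
  ultimately have lt: "ixkey (T (Suc i, j)) < ixkey (T (i, j))" by simp
  define S where "S = T((i, j) := T (Suc i, j), (Suc i, j) := T (i, j))"
  have S: "S \<in> fillings n lam" unfolding S_def by (rule filling_swap[OF T b])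
  have lS: "l S = - l T" unfolding S_def using b by (intro alt[OF T]) auto
  have fin: "finite (boxes lam)" by (rule finite_boxes[OF lam])
  have Sv: "S (i, j) = T (Suc i, j)" "S (Suc i, j) = T (i, j)" by (auto simp: S_def)
  have rest: "(\<Sum>b\<in>boxes lam - {(i, j)} - {(Suc i, j)}. h b (S b)) = (\<Sum>b\<in>boxes lam - {(i, j)} - {(Suc i, j)}. h b (T b))" for h :: "nat \<times> nat \<Rightarrow> ix \<Rightarrow> nat"
    by (rule sum.cong) (auto simp: S_def)
  have "mu S = mu T" unfolding mu_def
    by (subst (1 2) sum_two[OF fin b]) (simp_all add: rest[of "\<lambda>b t. snd b * base ^ ixkey t"] Sv)
  moreover have "nu T < nu S" unfolding nu_def
    by (subst (1 2) sum_two[OF fin b]) (use lt in \<open>simp_all add: rest[of "\<lambda>b t. fst b * ixkey t"] Sv\<close>)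
  ultimately show False using nu_max[OF S] lS nz by simp
qed

lemma col_mono:
  assumes "(i, j) \<in> boxes lam" "(i', j) \<in> boxes lam" "i < i'"
  shows "ixkey (T (i, j)) < ixkey (T (i', j))"
  using assms(3,2)
proof (induction i')
  case (Suc k)
  have k: "(k, j) \<in> boxes lam" if "i < k"
    using that Suc.prems(2) assms(1) by (auto simp: mem_boxes_iff[OF lam])
  show ?case
  proof (cases "i = k")
    case True then show ?thesis using col_step[OF assms(1)] Suc.prems(2) by simp
  next
    case False
    then have ik: "i < k" using Suc.prems by simp
    show ?thesis using Suc.IH[OF ik k[OF ik]] col_step[OF k[OF ik] Suc.prems(2)] by simp
  qed
qed simp

lemma col_mono_le:
  assumes "(i, j) \<in> boxes lam" "(i', j) \<in> boxes lam" "i \<le> i'"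
  shows "ixkey (T (i, j)) \<le> ixkey (T (i', j))"
  using col_mono[OF assms(1,2)] assms(3) by (cases "i = i'") auto

text \<open>At a descent in row \<open>k\<close>, exchange the top \<open>k\<close> entries of the
  right column. Any \<open>k\<close> rows of the left column include one at or below row
  \<open>k\<close>, and its entry exceeds all the entries that come from the right. Hence every term
  of the exchange has larger \<open>mu\<close> and is killed by \<open>l\<close>.\<close>

lemma row_step:
  assumes b: "(k, j) \<in> boxes lam" "(k, Suc j) \<in> boxes lam"
  shows "ixkey (T (k, j)) \<le> ixkey (T (k, Suc j))"
proof (rule ccontr)
  assume "\<not> ixkey (T (k, j)) \<le> ixkey (T (k, Suc j))"
  then have lt: "ixkey (T (k, Suc j)) < ixkey (T (k, j))" by simp
  have kj: "1 \<le> j" "Suc j \<le> ncols lam" "1 \<le> k" "k \<le> collen lam j" "k \<le> collen lam (Suc j)"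
    using b by (auto simp: mem_boxes_iff[OF lam])
  have kn: "k \<le> n" using kj(4) collen_le[OF lam, of j] by simp
  define w where "w a = base ^ ixkey a" for a
  have "l (exch_tab T j (Suc j) R) = 0" if R: "R \<subseteq> {1..collen lam j}" "card R = k" for R
  proof -
    define S where "S = exch_tab T j (Suc j) R"
    have fR: "finite R" using R(1) finite_subset by blast
    have S: "S \<in> fillings n lam" unfolding S_def using R kj by (intro filling_exch[OF lam T]) auto
    define p q where "p = collen lam j" and "q = collen lam (Suc j)"
    define A where "A = (\<Sum>r\<in>R. w (T (r, j)))"
    define A' where "A' = (\<Sum>r\<in>{1..p} - R. w (T (r, j)))"
    define B where "B = (\<Sum>r=1..k. w (T (r, Suc j)))"
    define B' where "B' = (\<Sum>r\<in>{1..q} - {1..k}. w (T (r, Suc j)))"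
    define X where "X = (\<Sum>j'\<in>{1..ncols lam} - {j} - {Suc j}. j' * (\<Sum>i=1..collen lam j'. w (T (i, j'))))"
    have jj: "j \<in> {1..ncols lam}" "Suc j \<in> {1..ncols lam}" "j \<noteq> Suc j" using kj by auto
    have split: "mu V = j * (\<Sum>i=1..p. w (V (i, j))) + (Suc j * (\<Sum>i=1..q. w (V (i, Suc j)))
        + (\<Sum>j'\<in>{1..ncols lam} - {j} - {Suc j}. j' * (\<Sum>i=1..collen lam j'. w (V (i, j')))))" for V
      unfolding mu_def sum_boxes[OF lam] w_def[symmetric] fst_conv snd_conv p_def q_def sum_distrib_left[symmetric]
      by (rule sum_two[OF finite_atLeastAtMost jj])
    have sp: "(\<Sum>i=1..p. h i) = (\<Sum>i\<in>R. h i) + (\<Sum>i\<in>{1..p} - R. h i)" for h :: "nat \<Rightarrow> nat"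
      using R(1) by (subst sum.subset_diff[of R]) (auto simp: p_def)
    have sq: "(\<Sum>i=1..q. h i) = (\<Sum>i=1..k. h i) + (\<Sum>i\<in>{1..q} - {1..k}. h i)" for h :: "nat \<Rightarrow> nat"
      using kj by (subst sum.subset_diff[of "{1..k}"]) (auto simp: q_def)
    have muT: "mu T = j * (A + A') + (Suc j * (B + B') + X)"
      unfolding split sp sq A_def A'_def B_def B'_def X_def ..
    have 1: "(\<Sum>r\<in>R. w (S (r, j))) = B"
    proof -
      have "(\<Sum>r\<in>R. w (S (r, j))) = (\<Sum>r\<in>R. w (T (card {r' \<in> R. r' \<le> r}, Suc j)))"
        by (rule sum.cong) (auto simp: S_def exch_tab_def)
      also have "\<dots> = B" unfolding B_def
        using sum.reindex_bij_betw[OF bij_betw_sorted_nth(2)[OF fR], of "\<lambda>r. w (T (r, Suc j))"] R(2) by simp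
      finally show ?thesis .
    qed
    have 2: "(\<Sum>r=1..k. w (S (r, Suc j))) = A"
    proof -
      have "(\<Sum>r=1..k. w (S (r, Suc j))) = (\<Sum>r=1..k. w (T (sorted_list_of_set R ! (r - 1), j)))"
        using R(2) by (intro sum.cong) (auto simp: S_def exch_tab_def)
      also have "\<dots> = A" unfolding A_def
        using sum.reindex_bij_betw[OF bij_betw_sorted_nth(1)[OF fR], of "\<lambda>r. w (T (r, j))"] R(2) by simp
      finally show ?thesis .
    qed
    have 3: "(\<Sum>r\<in>{1..p} - R. w (S (r, j))) = A'"
      unfolding A'_def by (rule sum.cong) (auto simp: S_def exch_tab_def)
    have 4: "(\<Sum>r\<in>{1..q} - {1..k}. w (S (r, Suc j))) = B'"
      unfolding B'_def using R(2) by (intro sum.cong) (auto simp: S_def exch_tab_def)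
    have 5: "(\<Sum>j'\<in>{1..ncols lam} - {j} - {Suc j}. j' * (\<Sum>i=1..collen lam j'. w (S (i, j')))) = X"
      unfolding X_def by (intro sum.cong refl) (auto simp: S_def exch_tab_def)
    have muS: "mu S = j * (B + A') + (Suc j * (A + B') + X)"
      unfolding split 5 sp sq 1 2 3 4 ..
    have "\<not> R \<subseteq> {1..<k}"
    proof
      assume "R \<subseteq> {1..<k}"
      then have "card R \<le> card {1..<k}" by (intro card_mono) auto
      then show False using R(2) kj by simp
    qed
    then obtain r where r: "r \<in> R" "k \<le> r" using R(1) by (auto simp: subset_iff not_less)
    have rb: "(r, j) \<in> boxes lam" using r R kj by (auto simp: mem_boxes_iff[OF lam])
    have "B < base ^ Suc (ixkey (T (k, Suc j)))"
      unfolding B_def w_def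
    proof (rule key_weight_bound)
      show "card {1..k} < base" using kn by (simp add: base_def)
      show "ixkey (T (s, Suc j)) \<le> ixkey (T (k, Suc j))" if "s \<in> {1..k}" for s
        using that kj by (intro col_mono_le) (auto simp: mem_boxes_iff[OF lam])
    qed simp
    also have "\<dots> \<le> w (T (r, j))" unfolding w_def
      using lt col_mono_le[OF b(1) rb r(2)] by (intro power_increasing) (auto simp: base_def)
    also have "\<dots> \<le> A" unfolding A_def using r fR by (intro member_le_sum) auto
    finally have "B < A" .
    \<comment> \<open>The exchange raises the factor of \<open>A\<close> from \<open>j\<close> to
      \<open>Suc j\<close> and lowers that of \<open>B\<close>, so \<open>mu\<close> grows by
      \<open>A - B\<close>.\<close>
    then have "mu T < mu S" unfolding muT muS by (simp add: algebra_simps)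
    then show ?thesis using mu_max[OF S] by (simp add: S_def)
  qed
  then have "(\<Sum>R\<in>{R. R \<subseteq> {1..collen lam j} \<and> card R = k}. l (exch_tab T j (Suc j) R)) = 0"
    by (intro sum.neutral) auto
  then show False using exch[OF T kj(1) lessI kj(2) kj(5)] nz by simp
qed

lemma row_mono_first:
  assumes "(i, j) \<in> boxes lam"
  shows "ixkey (T (i, 1)) \<le> ixkey (T (i, j))"
proof -
  have "1 \<le> j" using assms by (auto simp: mem_boxes_iff[OF lam])
  then show ?thesis using assms
  proof (induction j rule: nat_induct_at_least)
    case (Suc j)
    have "collen lam (Suc j) \<le> collen lam j" by (rule collen_antimono[OF lam]) simp
    then have b: "(i, j) \<in> boxes lam" using Suc by (auto simp: mem_boxes_iff[OF lam])
    show ?case using Suc.IH[OF b] row_step[OF b Suc.prems] by simp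
  qed simp
qed

lemma semistandard_T: "semistandard lam T"
  using row_step col_step by (auto simp: semistandard_def)

end

text \<open>\<open>A\<close> and \<open>B\<close> will be the indices of the unbarred and of the
  barred entries. If \<open>p\<close> indices occur in both and \<open>s\<close> in exactly one,
  then \<open>2 * p + s = card X + 1\<close>, which leaves \<open>2 * p - 1\<close> indices beside
  the single ones.\<close>

lemma complement_of_singles_small:
  fixes A B X :: "'a set"
  assumes X: "finite X" "A \<subseteq> X" "B \<subseteq> X" and c: "card A + card B = Suc (card X)"
  shows "card (X - (A \<union> B - A \<inter> B)) < 2 * card (A \<inter> B)"
proof -
  have fin: "finite A" "finite B" using X finite_subset by blast+
  have "A \<inter> B \<subseteq> A \<union> B" by blast
  then have "card (A \<union> B - A \<inter> B) + card (A \<inter> B) = card (A \<union> B)"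
    using fin card_mono[of "A \<union> B" "A \<inter> B"] by (subst card_Diff_subset) auto
  moreover have "card (A \<union> B) + card (A \<inter> B) = Suc (card X)" using card_Un_Int[OF fin] c by simp
  moreover have "A \<union> B - A \<inter> B \<subseteq> X" using X by blast
  then have "card (X - (A \<union> B - A \<inter> B)) + card (A \<union> B - A \<inter> B) = card X"
    using X(1) fin card_mono[of X "A \<union> B - A \<inter> B"] by (subst card_Diff_subset) auto
  moreover have "card (A \<union> B) \<le> card X" using X by (intro card_mono) auto
  ultimately show ?thesis by linarith
qed

context maximal_tableau
begin

text \<open>If entry \<open>(i0, j0)\<close> is too small, so is entry \<open>(i0, 1)\<close>, and the first \<open>i0\<close> entries of column 1 are the
  pairs \<open>P j\<close>, \<open>Q j\<close> for \<open>j \<in> J\<close> and single entries with indices in \<open>K\<close>, all indices being below \<open>i0\<close>. Relabelling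
  the pairs by \<open>f\<close> gives a value \<open>g f\<close> depending only on \<open>f ` J\<close>, zero as soon as \<open>f ` J\<close> meets \<open>K\<close> or contains
  an index \<open>\<ge> i0\<close>, by maximality. The symplectic relations then are the hypotheses of \<open>upper_layer_vanishing\<close>.\<close>
lemma key_ge_row:
  assumes box: "(i0, j0) \<in> boxes lam"
  shows "2 * i0 \<le> ixkey (T (i0, j0))"
proof (rule ccontr)
  assume "\<not> 2 * i0 \<le> ixkey (T (i0, j0))"
  define i where "i = i0"
  have i1: "1 \<le> i" "i \<le> collen lam j0" "1 \<le> j0" "j0 \<le> ncols lam" using box by (auto simp: mem_boxes_iff[OF lam] i_def)
  have ic: "i \<le> collen lam 1" using collen_antimono[OF lam i1(3)] i1(2) by simp
  have inn: "i \<le> n" using ic collen_le[OF lam, of 1] by simp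
  have nc: "1 \<le> ncols lam" using i1 by simp
  have bx: "(r, 1) \<in> boxes lam" if "1 \<le> r" "r \<le> collen lam 1" for r using that nc by (auto simp: mem_boxes_iff[OF lam])
  have bx': "(r, 1) \<in> boxes lam" if "r \<in> {1..i}" for r using that ic by (intro bx) auto
  have small: "ixkey (T (r, 1)) < 2 * i" if "r \<in> {1..i}" for r
  proof -
    have "ixkey (T (r, 1)) \<le> ixkey (T (i, 1))" using that i1 by (intro col_mono_le bx') auto
    also have "\<dots> \<le> ixkey (T (i0, j0))" unfolding i_def by (rule row_mono_first[OF box])
    finally show ?thesis using \<open>\<not> 2 * i0 \<le> _\<close> by (simp add: i_def)
  qed
  have inj1: "r = r'" if "T (r, 1) = T (r', 1)" "(r, 1) \<in> boxes lam" "(r', 1) \<in> boxes lam" for r r'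
    using col_mono[OF that(2,3)] col_mono[OF that(3,2)] that(1) by (cases r r' rule: linorder_cases) auto
  define E where "E = (\<lambda>r. T (r, 1)) ` {1..i}"
  have injT: "inj_on (\<lambda>r. T (r, 1)) {1..i}" using inj1 bx' by (auto simp: inj_on_def)
  have cE: "card E = i" unfolding E_def using card_image[OF injT] by simp
  have Eidx: "a \<in> idxs n" "ixkey a < 2 * i" if "a \<in> E" for a
    using that fillings_entry[OF T bx'] small by (auto simp: E_def)
  define PA where "PA = {j. P j \<in> E}"
  define QA where "QA = {j. Q j \<in> E}"
  have PAs: "PA \<subseteq> {1..i - 1}" and QAs: "QA \<subseteq> {1..i - 1}"
    using Eidx by (force simp: PA_def QA_def)+
  have fin: "finite PA" "finite QA" using PAs QAs finite_subset by blast+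
  have EPQ: "E = P ` PA \<union> Q ` QA"
  proof
    show "E \<subseteq> P ` PA \<union> Q ` QA"
    proof
      fix a assume "a \<in> E" then show "a \<in> P ` PA \<union> Q ` QA" by (cases a) (auto simp: PA_def QA_def)
    qed
  qed (auto simp: PA_def QA_def)
  have cPQ: "card PA + card QA = i"
  proof -
    have "card E = card (P ` PA) + card (Q ` QA)" unfolding EPQ using fin by (intro card_Un_disjoint) auto
    then show ?thesis using cE by (simp add: card_image inj_on_def)
  qed
  define J where "J = PA \<inter> QA"
  define K where "K = (PA \<union> QA) - J"
  \<comment> \<open>The indices below \<open>i\<close> not taken by single entries: the ground set
    for \<open>upper_layer_vanishing\<close>, in which pairs may be relabelled.\<close>
  define L where "L = {1..i - 1} - K"
  define m where "m = card J"
  have Js: "J \<subseteq> {1..i - 1}" "finite J" using PAs fin by (auto simp: J_def)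
  have JL: "J \<subseteq> L" using Js by (auto simp: L_def K_def)
  have Lm: "card L < 2 * m"
    unfolding L_def K_def m_def J_def using i1(1) PAs QAs cPQ by (intro complement_of_singles_small) auto
  have "\<exists>r\<in>{1..i}. T (r, 1) = a" if "a \<in> E" for a using that by (auto simp: E_def)
  then obtain row where row: "\<And>a. a \<in> E \<Longrightarrow> row a \<in> {1..i}" "\<And>a. a \<in> E \<Longrightarrow> T (row a, 1) = a" by metis
  define bP where "bP j = (row (P j), 1::nat)" for j
  define bQ where "bQ j = (row (Q j), 1::nat)" for j
  have JE: "P j \<in> E" "Q j \<in> E" if "j \<in> J" for j using that by (auto simp: J_def PA_def QA_def)
  have bPbox: "bP j \<in> boxes lam" "bQ j \<in> boxes lam" if "j \<in> J" for j
    unfolding bP_def bQ_def using row(1)[OF JE(1)[OF that]] row(1)[OF JE(2)[OF that]] by (intro bx'; simp)+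
  have TbP: "T (bP j) = P j" "T (bQ j) = Q j" if "j \<in> J" for j
    unfolding bP_def bQ_def using row(2) JE[OF that] by auto
  have snd1: "snd (bP j) = 1" "snd (bQ j) = 1" for j by (auto simp: bP_def bQ_def)
  have inbox: "b \<in> boxes lam" if "T b \<noteq> P 0" for b using that T unfolding fillings_def by blast
  have J0: "0 \<notin> J" using Js by auto
  have uniq: "b = b'" if h: "snd b = 1" "snd b' = 1" "T b = T b'" "T b \<noteq> P 0" for b b'
  proof -
    obtain r r' where "b = (r, 1)" "b' = (r', 1)" using h(1,2) by (cases b; cases b') auto
    then show ?thesis using inj1[of r r'] h inbox[of b] inbox[of b'] by auto
  qed
  define relab where "relab f b = (if snd b = 1 then (case T b of P j \<Rightarrow> if j \<in> J then P (f j) else P j | Q j \<Rightarrow> if j \<in> J then Q (f j) else Q j) else T b)"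
    for f :: "nat \<Rightarrow> nat" and b
  have rP: "relab f (bP j) = P (f j)" "relab f (bQ j) = Q (f j)" if "j \<in> J" for f j
    using that by (auto simp: relab_def TbP snd1)
  have roth: "relab f b = T b" if off: "\<And>j. j \<in> J \<Longrightarrow> b \<noteq> bP j \<and> b \<noteq> bQ j" for f b
  proof (cases "snd b = 1")
    case True
    have "T b \<noteq> P j" if j: "j \<in> J" for j
      using uniq[OF True snd1(1)[of j]] TbP[OF j] J0 j off[OF j] by auto
    moreover have "T b \<noteq> Q j" if j: "j \<in> J" for j
      using uniq[OF True snd1(2)[of j]] TbP[OF j] off[OF j] by auto
    ultimately show ?thesis by (auto simp: relab_def split: ix.split)
  qed (simp add: relab_def)
  have bPne: "bP j \<noteq> bP j'" "bQ j \<noteq> bQ j'" if "j \<in> J" "j' \<in> J" "j \<noteq> j'" for j j'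
    using TbP[OF that(1)] TbP[OF that(2)] that(3) by auto
  have bPQne: "bP j \<noteq> bQ j'" if "j \<in> J" "j' \<in> J" for j j'
    using TbP[OF that(1)] TbP[OF that(2)] by auto
  have fill: "relab f \<in> fillings n lam" if f: "f ` J \<subseteq> {1..n}" for f
  proof -
    have "relab f b \<in> idxs n" if "b \<in> boxes lam" for b
    proof -
      have "f j \<in> {1..n}" if "j \<in> J" for j using f that by auto
      then show ?thesis using fillings_entry[OF T that] by (auto simp: relab_def split: ix.split)
    qed
    moreover have "relab f b = P 0" if "b \<notin> boxes lam" for b
    proof -
      have "T b = P 0" using inbox[of b] that by blast
      then show ?thesis using J0 by (simp add: relab_def)
    qed
    ultimately show ?thesis unfolding fillings_def by blast
  qed
  define g where "g f = l (relab f)" for f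
  have gB: "g f = 0" if f: "f ` J \<subseteq> {1..n}" "a \<in> J" "b \<in> J" "a \<noteq> b" "f a = f b" for f a b
    unfolding g_def by (rule repeated[OF fill[OF f(1)] bPbox(1)[OF f(2)] bPbox(1)[OF f(3)] bPne(1)[OF f(2-4)]])
      (simp_all add: snd1 rP f)
  \<comment> \<open>The relabelled pair then repeats a single entry of the first column.\<close>
  have gC: "g f = 0" if f: "f ` J \<subseteq> {1..n}" "a \<in> J" "f a \<in> K" for f a
  proof -
    from f(3) consider "P (f a) \<in> E" "f a \<notin> J" | "Q (f a) \<in> E" "f a \<notin> J" by (auto simp: K_def PA_def QA_def)
    then show ?thesis
    proof cases
      case 1
      define b where "b = (row (P (f a)), 1::nat)"
      have b: "b \<in> boxes lam" "T b = P (f a)" unfolding b_def using row[OF 1(1)] by (auto intro: bx'[simplified])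
      have bo: "b \<noteq> bP j \<and> b \<noteq> bQ j" if "j \<in> J" for j using TbP[OF that] b(2) 1(2) that by auto
      have "b \<noteq> bP a" using bo f(2) by blast
      then show ?thesis unfolding g_def
        by (intro repeated[OF fill[OF f(1)] b(1) bPbox(1)[OF f(2)]])
           (use roth[OF bo, of f] b(2) rP(1)[OF f(2)] in \<open>auto simp: snd1 b_def\<close>)
    next
      case 2
      define b where "b = (row (Q (f a)), 1::nat)"
      have b: "b \<in> boxes lam" "T b = Q (f a)" unfolding b_def using row[OF 2(1)] by (auto intro: bx'[simplified])
      have bo: "b \<noteq> bP j \<and> b \<noteq> bQ j" if "j \<in> J" for j using TbP[OF that] b(2) 2(2) that by auto
      have "b \<noteq> bQ a" using bo f(2) by blast
      then show ?thesis unfolding g_def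
        by (intro repeated[OF fill[OF f(1)] b(1) bPbox(2)[OF f(2)]])
           (use roth[OF bo, of f] b(2) rP(2)[OF f(2)] in \<open>auto simp: snd1 b_def\<close>)
    qed
  qed
  have gD: "g f = 0" if f: "f ` J \<subseteq> {1..n}" "a \<in> J" "i \<le> f a" for f a
  proof -
    define C where "C = bP ` J \<union> bQ ` J"
    have Cb: "C \<subseteq> boxes lam" using bPbox by (auto simp: C_def)
    have fC: "finite C" using Js by (simp add: C_def)
    have cC: "card C < base"
    proof -
      have "card C \<le> card (bP ` J) + card (bQ ` J)" unfolding C_def by (rule card_Un_le)
      also have "\<dots> \<le> card J + card J" using Js by (intro add_mono card_image_le) auto
      also have "card J \<le> card {1..i - 1}" using Js by (intro card_mono) auto
      finally show ?thesis using inn by (simp add: base_def)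
    qed
    have C1: "snd b = 1" if "b \<in> C" for b using that by (auto simp: C_def snd1)
    have muv: "mu V = (\<Sum>b\<in>boxes lam - C. snd b * base ^ ixkey (V b)) + (\<Sum>b\<in>C. base ^ ixkey (V b))" for V
      unfolding mu_def using sum.subset_diff[OF Cb finite_boxes[OF lam], of "\<lambda>b. snd b * base ^ ixkey (V b)"] C1 by simp
    \<comment> \<open>Before relabelling all keys on \<open>C\<close> are below
      \<open>2 * i\<close>; afterwards the box \<open>bP a\<close> alone has a key of at least
      \<open>2 * i\<close> and outweighs them.\<close>
    have "(\<Sum>b\<in>C. base ^ ixkey (T b)) < base ^ Suc (2 * i - 1)"
    proof (rule key_weight_bound[OF fC cC])
      fix b assume "b \<in> C"
      then have "T b \<in> E" using TbP JE by (auto simp: C_def)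
      then show "ixkey (T b) \<le> 2 * i - 1" using Eidx(2) by fastforce
    qed
    also have "\<dots> \<le> base ^ ixkey (relab f (bP a))"
      unfolding rP(1)[OF f(2)] using f(3) i1 by (intro power_increasing) (auto simp: base_def)
    also have "\<dots> \<le> (\<Sum>b\<in>C. base ^ ixkey (relab f b))"
      using fC f(2) by (intro member_le_sum) (auto simp: C_def)
    finally have "(\<Sum>b\<in>C. base ^ ixkey (T b)) < (\<Sum>b\<in>C. base ^ ixkey (relab f b))" .
    moreover have "(\<Sum>b\<in>boxes lam - C. snd b * base ^ ixkey (relab f b)) = (\<Sum>b\<in>boxes lam - C. snd b * base ^ ixkey (T b))"
    proof (rule sum.cong[OF refl])
      fix b assume "b \<in> boxes lam - C"
      then have "\<And>j. j \<in> J \<Longrightarrow> b \<noteq> bP j \<and> b \<noteq> bQ j" unfolding C_def by blast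
      then have "relab f b = T b" by (rule roth)
      then show "snd b * base ^ ixkey (relab f b) = snd b * base ^ ixkey (T b)" by simp
    qed
    ultimately have "mu T < mu (relab f)" unfolding muv by simp
    then show ?thesis unfolding g_def by (rule mu_max[OF fill[OF f(1)]])
  qed
  have gE: "(\<Sum>y=1..n. g (f(a := y))) = 0" if f: "f ` J \<subseteq> {1..n}" "a \<in> J" for f a
  proof -
    have upd: "relab (f(a := y)) = (relab f)(bP a := P y, bQ a := Q y)" for y
    proof
      fix b
      consider "b = bP a" | "b = bQ a" | j where "j \<in> J" "j \<noteq> a" "b = bP j \<or> b = bQ j" | "\<And>j. j \<in> J \<Longrightarrow> b \<noteq> bP j \<and> b \<noteq> bQ j"
        by blast
      then show "relab (f(a := y)) b = ((relab f)(bP a := P y, bQ a := Q y)) b"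
      proof cases
        case 1 then show ?thesis using bPQne f(2) rP(1)[OF f(2)] by simp
      next
        case 2 then show ?thesis using rP(2)[OF f(2)] by simp
      next
        case 3
        then have "b \<noteq> bP a" "b \<noteq> bQ a" using bPne[OF 3(1) f(2) 3(2)] bPQne[OF 3(1) f(2)] bPQne[OF f(2) 3(1)] by auto
        then show ?thesis using 3 rP[OF 3(1)] by auto
      next
        case 4
        then have "b \<noteq> bP a" "b \<noteq> bQ a" using f(2) by blast+
        then show ?thesis using roth[of b, OF 4] by simp
      qed
    qed
    \<comment> \<open>By alternation the second half of the symplectic relation repeats the first,
      which gives the factor 2 below.\<close>
    have sw: "l ((relab f)(bP a := Q y, bQ a := P y)) = - g (f(a := y))" if y: "y \<in> {1..n}" for y
    proof -
      define S where "S = relab (f(a := y))"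
      have S: "S \<in> fillings n lam" unfolding S_def using f y by (intro fill) auto
      have "S(bP a := S (bQ a), bQ a := S (bP a)) = (relab f)(bP a := Q y, bQ a := P y)"
        unfolding S_def upd using bPQne[OF f(2) f(2)] by (auto simp: fun_eq_iff)
      then show ?thesis using alt[OF S bPbox[OF f(2)] bPQne[OF f(2) f(2)]] by (simp add: S_def g_def snd1)
    qed
    have "0 = (\<Sum>y=1..n. l ((relab f)(bP a := P y, bQ a := Q y)) - l ((relab f)(bP a := Q y, bQ a := P y)))"
      using symp[OF fill[OF f(1)] bPbox[OF f(2)] bPQne[OF f(2) f(2)]] by simp
    also have "\<dots> = (\<Sum>y=1..n. 2 * g (f(a := y)))"
    proof (rule sum.cong[OF refl])
      fix y assume y: "y \<in> {1..n}"
      show "l ((relab f)(bP a := P y, bQ a := Q y)) - l ((relab f)(bP a := Q y, bQ a := P y)) = 2 * g (f(a := y))"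
        unfolding sw[OF y] upd[symmetric] g_def by simp
    qed
    finally show ?thesis by (simp add: sum_distrib_left[symmetric])
  qed
  \<comment> \<open>Interchanging two pairs is a double swap inside the column, so the signs cancel.
    This is the commutativity of the \<open>w j\<close> in
    \<open>upper_layer_vanishing\<close>.\<close>
  have gA: "g (f \<circ> transpose a b) = g f" if f: "f ` J \<subseteq> {1..n}" "a \<in> J" "b \<in> J" "a \<noteq> b" for f a b
  proof -
    define S where "S = relab f"
    define S1 where "S1 = S(bP a := S (bP b), bP b := S (bP a))"
    have S: "S \<in> fillings n lam" unfolding S_def by (rule fill[OF f(1)])
    have S1: "S1 \<in> fillings n lam" unfolding S1_def by (rule filling_swap[OF S bPbox(1)[OF f(2)] bPbox(1)[OF f(3)]])
    have "l S1 = - l S" unfolding S1_def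
      by (rule alt[OF S bPbox(1)[OF f(2)] bPbox(1)[OF f(3)] bPne(1)[OF f(2-4)]]) (simp add: snd1)
    moreover have "l (S1(bQ a := S1 (bQ b), bQ b := S1 (bQ a))) = - l S1"
      by (rule alt[OF S1 bPbox(2)[OF f(2)] bPbox(2)[OF f(3)] bPne(2)[OF f(2-4)]]) (simp add: snd1)
    moreover have "S1(bQ a := S1 (bQ b), bQ b := S1 (bQ a)) = relab (f \<circ> transpose a b)"
    proof
      fix c
      note ne = bPne[OF f(2-4)] bPQne[OF f(2) f(2)] bPQne[OF f(2) f(3)] bPQne[OF f(3) f(2)] bPQne[OF f(3) f(3)]
      consider "c = bP a" | "c = bP b" | "c = bQ a" | "c = bQ b" | j where "j \<in> J" "j \<noteq> a" "j \<noteq> b" "c = bP j \<or> c = bQ j"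
        | "\<And>j. j \<in> J \<Longrightarrow> c \<noteq> bP j \<and> c \<noteq> bQ j" by blast
      then show "(S1(bQ a := S1 (bQ b), bQ b := S1 (bQ a))) c = relab (f \<circ> transpose a b) c"
      proof cases
        case 5
        note ne5 = bPne[OF 5(1) f(2) 5(2)] bPQne[OF 5(1) f(2)] bPQne[OF f(2) 5(1)]
           bPne[OF 5(1) f(3) 5(3)] bPQne[OF 5(1) f(3)] bPQne[OF f(3) 5(1)]
        have "c \<noteq> bP a" "c \<noteq> bQ a" "c \<noteq> bP b" "c \<noteq> bQ b" using ne5 5(4) by metis+
        then show ?thesis using 5 rP[OF 5(1)] by (auto simp: S1_def S_def)
      next
        case 6
        then have "c \<noteq> bP a" "c \<noteq> bQ a" "c \<noteq> bP b" "c \<noteq> bQ b" using f(2,3) by blast+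
        then show ?thesis using roth[of c, OF 6] by (simp add: S1_def S_def)
      qed (use ne ne[symmetric] rP[OF f(2)] rP[OF f(3)] f(4) in \<open>simp_all add: S1_def S_def\<close>)
    qed
    ultimately show ?thesis by (simp add: g_def S_def)
  qed
  \<comment> \<open>The value 0 outside \<open>J\<close> is a normalization: two labellings with the
    same image then differ by a permutation of \<open>J\<close>, as
    \<open>bij_betw_invariant\<close> requires.\<close>
  define Z :: "nat set \<Rightarrow> (nat \<Rightarrow> nat) set" where "Z A = {f. bij_betw f J A \<and> (\<forall>x. x \<notin> J \<longrightarrow> f x = 0)}" for A
  define G where "G A = g (SOME f. f \<in> Z A)" for A
  have Ln: "L \<subseteq> {1..n}" using inn by (auto simp: L_def)
  have GZ: "G A = g f" if A: "A \<subseteq> {1..n}" and f: "f \<in> Z A" for A f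
  proof -
    define f' where "f' = (SOME f. f \<in> Z A)"
    have f': "f' \<in> Z A" unfolding f'_def using someI[of "\<lambda>f. f \<in> Z A", OF f] .
    have "g f' = g f"
    proof (rule bij_betw_invariant[OF Js(2), of f' A f g])
      show "bij_betw f' J A" "bij_betw f J A" using f f' by (auto simp: Z_def)
      show "f' x = f x" if "x \<notin> J" for x using f f' that by (auto simp: Z_def)
      show "g (h \<circ> transpose a b) = g h" if "bij_betw h J A" "a \<in> J" "b \<in> J" "a \<noteq> b" for h a b
        using that A by (intro gA) (auto simp: bij_betw_def)
    qed
    then show ?thesis by (simp add: G_def f'_def)
  qed
  have "G J = 0"
  proof (rule upper_layer_vanishing[of L J m])
    show "finite L" by (simp add: L_def)
    show "J \<subseteq> L" by (rule JL)
    show "card J = m" by (simp add: m_def)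
    show "card L < 2 * m" by (rule Lm)
    fix S assume S: "S \<subseteq> L" "Suc (card S) = m"
    have fS: "finite S" using S(1) by (rule finite_subset) (simp add: L_def)
    \<comment> \<open>\<open>S\<close> has one element fewer than \<open>J\<close>: the other pairs
      receive the labels in \<open>S\<close>, and the pair \<open>x0\<close> carries the summation
      index \<open>y\<close>.\<close>
    obtain x0 where x0: "x0 \<in> J" using S(2) unfolding m_def by fastforce
    have "card (J - {x0}) = card S" using S(2) x0 Js by (simp add: m_def)
    then obtain h where h: "bij_betw h (J - {x0}) S"
      using finite_same_card_bij[of "J - {x0}" S] Js fS by auto
    define f where "f x = (if x \<in> J - {x0} then h x else 0)" for x
    have fbij: "bij_betw f (J - {x0}) S" using h by (subst bij_betw_cong[of _ _ h]) (auto simp: f_def)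
    have Sn: "S \<subseteq> {1..n}" using S(1) Ln by blast
    have fJ: "(f(x0 := y)) ` J \<subseteq> {1..n}" if "y \<in> {1..n}" for y
      using that fbij Sn by (auto simp: bij_betw_def)
    have z: "g (f(x0 := y)) = 0" if y: "y \<in> {1..n} - (L - S)" for y
    proof -
      have y1: "y \<in> {1..n}" using y by simp
      consider "y \<in> S" | "y \<in> K" | "i \<le> y" using y by (auto simp: L_def)
      then show ?thesis
      proof cases
        case 1
        then obtain x where "x \<in> J - {x0}" "f x = y" using fbij by (auto simp: bij_betw_def)
        then show ?thesis using x0 by (intro gB[OF fJ[OF y1] x0, of x]) auto
      next
        case 2 then show ?thesis by (intro gC[OF fJ[OF y1] x0]) simp
      next
        case 3 then show ?thesis by (intro gD[OF fJ[OF y1] x0]) simp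
      qed
    qed
    have i1n: "1 \<in> {1..n}" using i1 inn by simp
    \<comment> \<open>\<open>f x0 = 0\<close> is not an admissible label, so 1 is put there as a
      placeholder before \<open>y\<close> overwrites it.\<close>
    have "0 = (\<Sum>y=1..n. g ((f(x0 := 1))(x0 := y)))"
      by (rule gE[OF fJ[OF i1n] x0, symmetric])
    also have "\<dots> = (\<Sum>y\<in>L - S. g (f(x0 := y)))"
      using Ln z by (intro sum.mono_neutral_cong_right) auto
    also have "\<dots> = (\<Sum>y\<in>L - S. G (insert y S))"
    proof (rule sum.cong[OF refl])
      fix y assume y: "y \<in> L - S"
      have "bij_betw (f(x0 := y)) J (insert y S)"
      proof -
        have "bij_betw (f(x0 := y)) (J - {x0}) S" using fbij by (subst bij_betw_cong[of _ _ f]) auto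
        moreover have "bij_betw (f(x0 := y)) {x0} {y}" by (simp add: bij_betw_def)
        moreover have "S \<inter> {y} = {}" using y by blast
        ultimately have "bij_betw (f(x0 := y)) ((J - {x0}) \<union> {x0}) (S \<union> {y})" by (rule bij_betw_combine)
        moreover have "(J - {x0}) \<union> {x0} = J" "S \<union> {y} = insert y S" using x0 by blast+
        ultimately show ?thesis by simp
      qed
      then have "f(x0 := y) \<in> Z (insert y S)" using x0 by (auto simp: Z_def f_def)
      then show "g (f(x0 := y)) = G (insert y S)" using y Ln Sn by (intro GZ[symmetric]) auto
    qed
    finally show "(\<Sum>y\<in>L - S. G (insert y S)) = 0" by simp
  qed
  moreover have "G J = l T"
  proof -
    define f where "f x = (if x \<in> J then x else 0)" for x :: nat
    have "bij_betw f J J" by (subst bij_betw_cong[of _ _ id]) (auto simp: f_def)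
    then have "f \<in> Z J" by (auto simp: Z_def f_def)
    moreover have "relab f = T" by (auto simp: relab_def f_def fun_eq_iff split: ix.split)
    ultimately show ?thesis using GZ[of J f] JL Ln by (auto simp: g_def)
  qed
  ultimately show False using nz by simp
qed

end

context relation_functional
begin

lemma functional_zero:
  assumes "T0 \<in> fillings n lam"
  shows "l T0 = 0"
proof (rule ccontr)
  assume "l T0 \<noteq> 0"
  define X where "X = {T \<in> fillings n lam. l T \<noteq> 0}"
  have "finite X" "X \<noteq> {}" using finite_fillings[OF lam] assms \<open>l T0 \<noteq> 0\<close> by (auto simp: X_def)
  then obtain T where T: "T \<in> X" "\<And>S. S \<in> X \<Longrightarrow> mu S \<le> mu T" "\<And>S. S \<in> X \<Longrightarrow> mu S = mu T \<Longrightarrow> nu S \<le> nu T"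
    using obtain_lex_max[of X mu nu] by metis
  interpret maximal_tableau n lam l T
    by unfold_locales (use T in \<open>fastforce simp: X_def not_le[symmetric]\<close>)+
  have "symplectic_tab n lam T"
    using T(1) semistandard_T key_ge_row by (auto simp: symplectic_tab_def X_def)
  then show False using vanish nz by blast
qed

end

text \<open>If the span were proper, a separating functional would satisfy the assumptions of
  \<open>relation_functional\<close> and hence vanish on all tableaux, although it takes the value 1
  at some vector.\<close>

lemma symplectic_spanning:
  assumes lam: "is_partition n lam"
  shows "cspan ({delta T | T. symplectic_tab n lam T} \<union> Wrel n lam) = tens n lam"
proof (rule ccontr)
  define U where "U = cspan ({delta T | T. symplectic_tab n lam T} \<union> Wrel n lam)"
  assume "cspan ({delta T | T. symplectic_tab n lam T} \<union> Wrel n lam) \<noteq> tens n lam"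
  moreover have Ut: "U \<subseteq> tens n lam" unfolding U_def
    using Wrel_subset_tens[OF lam] by (intro cspan_minimal[OF csubspace_tens]) (auto simp: delta_in_tens symplectic_tab_def)
  ultimately obtain x where x: "x \<in> tens n lam" "x \<notin> U" by (auto simp: U_def)
  have Us: "csubspace U" unfolding U_def by (rule csubspace_cspan)
  obtain h where h: "\<And>u. u \<in> U \<Longrightarrow> (\<Sum>T\<in>fillings n lam. u T * h T) = 0" "(\<Sum>T\<in>fillings n lam. x T * h T) = 1"
    using separating_functional[OF Us x(2) finite_fillings[OF lam]] Ut x(1) by (auto simp: tens_def)
  define e where "e u = (\<Sum>T\<in>fillings n lam. u T * h T)" for u
  have e_delta: "e (delta T) = h T" if "T \<in> fillings n lam" for T
    using that finite_fillings[OF lam] by (simp add: e_def delta_def if_distrib[of "\<lambda>x. x * _"] cong: if_cong)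
  have e_add: "e (\<lambda>x. u x + v x) = e u + e v" for u v by (simp add: e_def sum.distrib distrib_right)
  have e_diff: "e (\<lambda>x. u x - v x) = e u - e v" for u v by (simp add: e_def sum_subtractf left_diff_distrib)
  have e_sum: "e (\<lambda>x. \<Sum>i\<in>I. f i x) = (\<Sum>i\<in>I. e (f i))" for I :: "'i set" and f
    unfolding e_def sum_distrib_right by (rule sum.swap)
  have e0: "e u = 0" if "u \<in> alt_rels n lam \<union> exch_rels n lam \<union> symp_rels n lam" for u
    unfolding e_def by (rule h(1)) (use that in \<open>auto simp: U_def Wrel_def intro!: cspan_base\<close>)
  interpret relation_functional n lam h
  proof
    show "is_partition n lam" by (rule lam)
  next
    fix T b b' assume a: "T \<in> fillings n lam" "b \<in> boxes lam" "b' \<in> boxes lam" "b \<noteq> b'" "snd b = snd b'"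
    have "e (\<lambda>S. delta T S + delta (T(b := T b', b' := T b)) S) = 0"
      by (rule e0) (use a in \<open>unfold alt_rels_def, blast\<close>)
    then have "h T + h (T(b := T b', b' := T b)) = 0"
      using a by (simp only: e_add e_delta filling_swap)
    then show "h (T(b := T b', b' := T b)) = - h T" by (simp add: add_eq_0_iff)
  next
    fix T j1 j2 k assume a: "T \<in> fillings n lam" "1 \<le> j1" "j1 < j2" "j2 \<le> ncols lam" "k \<le> collen lam j2"
    have "e (\<lambda>S. delta T S - (\<Sum>R\<in>{R. R \<subseteq> {1..collen lam j1} \<and> card R = k}. delta (exch_tab T j1 j2 R) S)) = 0"
      by (rule e0) (use a in \<open>unfold exch_rels_def, blast\<close>)
    moreover have "(\<Sum>R\<in>{R. R \<subseteq> {1..collen lam j1} \<and> card R = k}. e (delta (exch_tab T j1 j2 R)))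
        = (\<Sum>R\<in>{R. R \<subseteq> {1..collen lam j1} \<and> card R = k}. h (exch_tab T j1 j2 R))"
      by (rule sum.cong[OF refl], rule e_delta, rule filling_exch[OF lam a(1-4)]) (use a(5) in auto)
    ultimately show "h T = (\<Sum>R\<in>{R. R \<subseteq> {1..collen lam j1} \<and> card R = k}. h (exch_tab T j1 j2 R))"
      unfolding e_diff e_sum using e_delta[OF a(1)] by simp
  next
    fix T B B' assume a: "T \<in> fillings n lam" "B \<in> boxes lam" "B' \<in> boxes lam" "B \<noteq> B'"
    have "e (\<lambda>S. \<Sum>i=1..n. delta (T(B := P i, B' := Q i)) S - delta (T(B := Q i, B' := P i)) S) = 0"
      by (rule e0) (use a in \<open>unfold symp_rels_def, blast\<close>)
    moreover have "(\<Sum>i=1..n. e (delta (T(B := P i, B' := Q i))) - e (delta (T(B := Q i, B' := P i))))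
       = (\<Sum>i=1..n. h (T(B := P i, B' := Q i)) - h (T(B := Q i, B' := P i)))"
      using a by (intro sum.cong refl arg_cong2[where f = "(-)"] e_delta filling_upd) auto
    ultimately show "(\<Sum>i=1..n. h (T(B := P i, B' := Q i)) - h (T(B := Q i, B' := P i))) = 0"
      unfolding e_sum e_diff by simp
  next
    fix T assume s: "symplectic_tab n lam T"
    then have "delta T \<in> U" by (auto simp: U_def intro!: cspan_base)
    then have "e (delta T) = 0" unfolding e_def by (rule h(1))
    then show "h T = 0" using s e_delta by (simp add: symplectic_tab_def)
  qed
  have "(\<Sum>T\<in>fillings n lam. x T * h T) = 0" using functional_zero by simp
  then show False using h(2) by simp
qed

subsection \<open>A degenerating family of isotropic frames\<close>

lemma digits_unique:
  fixes c d :: "nat \<Rightarrow> nat"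
  assumes "\<And>k. c k < N" "\<And>k. d k < N" "(\<Sum>k<K. c k * N ^ k) = (\<Sum>k<K. d k * N ^ k)" "k < K"
  shows "c k = d k"
  using assms
proof (induction K arbitrary: c d k)
  case (Suc K)
  have sh: "(\<Sum>k<Suc K. f k * N ^ k) = f 0 + N * (\<Sum>k<K. f (Suc k) * N ^ k)" for f :: "nat \<Rightarrow> nat"
    unfolding sum.lessThan_Suc_shift by (simp add: sum_distrib_left mult_ac)
  have eq: "c 0 + N * (\<Sum>k<K. c (Suc k) * N ^ k) = d 0 + N * (\<Sum>k<K. d (Suc k) * N ^ k)"
    using Suc.prems(3) unfolding sh .
  then have "(c 0 + N * (\<Sum>k<K. c (Suc k) * N ^ k)) mod N = (d 0 + N * (\<Sum>k<K. d (Suc k) * N ^ k)) mod N" by simp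
  then have 0: "c 0 = d 0" using Suc.prems(1)[of 0] Suc.prems(2)[of 0] by simp
  have "(\<Sum>k<K. c (Suc k) * N ^ k) = (\<Sum>k<K. d (Suc k) * N ^ k)"
    using eq 0 Suc.prems(1)[of 0] by simp
  then have "k' < K \<Longrightarrow> c (Suc k') = d (Suc k')" for k'
    using Suc.IH[of "\<lambda>k. c (Suc k)" "\<lambda>k. d (Suc k)" k'] Suc.prems(1,2) by blast
  then show ?case using 0 Suc.prems(4) by (cases k) auto
qed simp

text \<open>No multiplicity reaches \<open>N\<close>, so the multiplicities of the exponents are the
  base \<open>N\<close> digits of the sum.\<close>

lemma sum_powers_eq_counts:
  fixes f :: "'a \<Rightarrow> nat" and g :: "'b \<Rightarrow> nat"
  assumes A: "finite A" "card A < N" and B: "finite B" "card B < N"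
    and eq: "(\<Sum>a\<in>A. N ^ f a) = (\<Sum>b\<in>B. N ^ g b)"
  shows "card {a \<in> A. f a = k} = card {b \<in> B. g b = k}"
proof -
  define K where "K = Suc (Max (insert k (f ` A \<union> g ` B)))"
  have K: "x < K" if "x \<in> insert k (f ` A \<union> g ` B)" for x
    unfolding K_def using Max_ge[OF _ that] A(1) B(1) by (simp add: less_Suc_eq_le)
  have A': "(\<Sum>a\<in>A. N ^ f a) = (\<Sum>k<K. card {a \<in> A. f a = k} * N ^ k)"
  proof -
    have "(\<Sum>a\<in>A. N ^ f a) = (\<Sum>k<K. \<Sum>a\<in>{a \<in> A. f a = k}. N ^ f a)"
      using A(1) K by (intro sum.group[symmetric]) auto
    then show ?thesis by simp
  qed
  have B': "(\<Sum>b\<in>B. N ^ g b) = (\<Sum>k<K. card {b \<in> B. g b = k} * N ^ k)"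
  proof -
    have "(\<Sum>b\<in>B. N ^ g b) = (\<Sum>k<K. \<Sum>b\<in>{b \<in> B. g b = k}. N ^ g b)"
      using B(1) K by (intro sum.group[symmetric]) auto
    then show ?thesis by simp
  qed
  show ?thesis
  proof (rule digits_unique[of "\<lambda>k. card {a \<in> A. f a = k}" N "\<lambda>k. card {b \<in> B. g b = k}" K k])
    show "card {a \<in> A. f a = k} < N" for k using card_mono[OF A(1), of "{a \<in> A. f a = k}"] A(2) by fastforce
    show "card {b \<in> B. g b = k} < N" for k using card_mono[OF B(1), of "{b \<in> B. g b = k}"] B(2) by fastforce
    show "(\<Sum>k<K. card {a \<in> A. f a = k} * N ^ k) = (\<Sum>k<K. card {b \<in> B. g b = k} * N ^ k)" using eq A' B' by simp
    show "k < K" by (rule K) simp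
  qed
qed

text \<open>The sublevel sets of a weakly increasing sequence are initial segments, and their
  lengths are sums of the counts.\<close>

lemma mono_eq_of_counts:
  fixes f g :: "nat \<Rightarrow> nat"
  assumes f: "\<And>i j. 1 \<le> i \<Longrightarrow> i \<le> j \<Longrightarrow> j \<le> m \<Longrightarrow> f i \<le> f j"
    and g: "\<And>i j. 1 \<le> i \<Longrightarrow> i \<le> j \<Longrightarrow> j \<le> m \<Longrightarrow> g i \<le> g j"
    and c: "\<And>a. card {j \<in> {1..m}. f j = a} = card {j \<in> {1..m}. g j = a}"
    and j: "j \<in> {1..m}"
  shows "f j = g j"
proof -
  have cnt: "card {j \<in> {1..m}. h j \<le> a} = (\<Sum>x\<le>a. card {j \<in> {1..m}. h j = x})" for h :: "nat \<Rightarrow> nat" and a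
  proof -
    have "{j \<in> {1..m}. h j \<le> a} = (\<Union>x\<in>{..a}. {j \<in> {1..m}. h j = x})" by auto
    then show ?thesis by (simp only:) (subst card_UN_disjoint; auto)
  qed
  have init: "{j \<in> {1..m}. h j \<le> a} = {1..card {j \<in> {1..m}. h j \<le> a}}"
    if h: "\<And>i j. 1 \<le> i \<Longrightarrow> i \<le> j \<Longrightarrow> j \<le> m \<Longrightarrow> h i \<le> h j" for h :: "nat \<Rightarrow> nat" and a
  proof (rule downward_closed_eq_interval)
    fix i j assume "i \<in> {j \<in> {1..m}. h j \<le> a}" "1 \<le> j" "j \<le> i"
    then show "j \<in> {j \<in> {1..m}. h j \<le> a}" using h[of j i] by auto
  qed auto
  have "{j \<in> {1..m}. f j \<le> a} = {j \<in> {1..m}. g j \<le> a}" for a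
    using init[of f, OF f] init[of g, OF g] cnt[of f] cnt[of g] c by simp
  then have "f j \<le> a \<longleftrightarrow> g j \<le> a" for a using j by blast
  then show ?thesis by (metis order_antisym order_refl)
qed

text \<open>Entry \<open>a\<close> of column \<open>q\<close> of the frame will have order \<open>e ^ (N ^ ee n a q)\<close>. As exponents are powers of a large
  base, the order of a product of diagonal terms determines its factors, digit by digit.\<close>
definition ee :: "nat \<Rightarrow> ix \<Rightarrow> nat \<Rightarrow> nat" where
  "ee n a q = ixkey a * (n + 1) + (n - q)"

lemma ee_inject:
  assumes "ee n a q = ee n b q'" "1 \<le> q" "q \<le> n" "1 \<le> q'" "q' \<le> n"
  shows "a = b \<and> q = q'"
proof -
  have "ee n a q div (n + 1) = ixkey a" "ee n b q' div (n + 1) = ixkey b"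
    unfolding ee_def by (subst div_mult_self3; simp)+
  moreover have "ee n a q mod (n + 1) = n - q" "ee n b q' mod (n + 1) = n - q'"
    unfolding ee_def by (subst mod_mult_self3; simp)+
  ultimately have "ixkey a = ixkey b" "n - q = n - q'" using assms(1) by simp_all
  then show ?thesis using assms by (auto simp: ixkey_inj)
qed

text \<open>For a symplectic tableau this is the order at \<open>e = 0\<close> of
  \<open>Phi lam T\<close> on the frames below: on the diagonal of a minor the entry in row
  \<open>i\<close> meets column \<open>i\<close> of the frame.\<close>

definition twt :: "nat \<Rightarrow> nat \<Rightarrow> nat list \<Rightarrow> (nat \<times> nat \<Rightarrow> ix) \<Rightarrow> nat" where
  "twt n N lam T = (\<Sum>b\<in>boxes lam. N ^ ee n (T b) (fst b))"

lemma semistandard_row_mono: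
  assumes lam: "is_partition n lam" and s: "semistandard lam T"
    and "1 \<le> j" "j \<le> j'" "(i, j') \<in> boxes lam"
  shows "ixkey (T (i, j)) \<le> ixkey (T (i, j'))"
  using assms(4,5)
proof (induction j' rule: dec_induct)
  case (step k)
  have "(i, k) \<in> boxes lam" using step assms(3) by (auto simp: boxes_eq_Sigma_rows[OF lam])
  then show ?case using step s by (fastforce simp: semistandard_def)
qed simp

lemma semistandard_col_mono:
  assumes lam: "is_partition n lam" and s: "semistandard lam T"
    and "(i, j) \<in> boxes lam" "(i', j) \<in> boxes lam" "i < i'"
  shows "ixkey (T (i, j)) < ixkey (T (i', j))"
proof -
  have one: "ixkey (T (k, j)) < ixkey (T (Suc k, j))" if "(Suc k, j) \<in> boxes lam" "1 \<le> k" for k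
    using that s mem_boxes_iff[OF lam] by (auto simp: semistandard_def)
  have "i \<le> k \<Longrightarrow> (Suc k, j) \<in> boxes lam \<Longrightarrow> ixkey (T (i, j)) < ixkey (T (Suc k, j))" for k
  proof (induction k rule: dec_induct)
    case base then show ?case using one[of i] assms(3) mem_boxes_iff[OF lam] by auto
  next
    case (step k)
    have "(Suc k, j) \<in> boxes lam" using step.prems mem_boxes_iff[OF lam] by auto
    then show ?case using step.IH one[OF step.prems] by simp
  qed
  from this[of "i' - 1"] show ?thesis using assms(4,5) by simp
qed

text \<open>The digit of the weight at \<open>ee n a i\<close> counts the occurrences of
  \<open>a\<close> in row \<open>i\<close>. Totals over \<open>a\<close> give the row lengths, and
  since semistandard rows are sorted, the counts give the rows themselves.\<close>

lemma twt_inject: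
  assumes lam: "is_partition n lam" "is_partition n lam'"
    and T: "symplectic_tab n lam T" "symplectic_tab n lam' T'"
    and N: "card (boxes lam) < N" "card (boxes lam') < N"
    and eq: "twt n N lam T = twt n N lam' T'"
  shows "lam = lam' \<and> T = T'"
proof -
  have cnt: "card {b \<in> boxes lam. ee n (T b) (fst b) = k} = card {b \<in> boxes lam'. ee n (T' b) (fst b) = k}" for k
    using sum_powers_eq_counts[OF finite_boxes[OF lam(1)] N(1) finite_boxes[OF lam(2)] N(2), of "\<lambda>b. ee n (T b) (fst b)" "\<lambda>b. ee n (T' b) (fst b)"] eq
    by (simp add: twt_def)
  have row: "card {j \<in> {1..mu ! (i - 1)}. S (i, j) = a} = card {b \<in> boxes mu. ee n (S b) (fst b) = ee n a i}"
    if mu: "is_partition n mu" and i: "1 \<le> i" "i \<le> n" for mu S a i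
  proof -
    have inj: "S b = a \<and> fst b = i" if "b \<in> boxes mu" "ee n (S b) (fst b) = ee n a i" for b
      using ee_inject[OF that(2) _ _ i] that(1) by (auto simp: boxes_eq_Sigma_rows[OF mu])
    have "bij_betw (\<lambda>j. (i, j)) {j \<in> {1..mu ! (i - 1)}. S (i, j) = a} {b \<in> boxes mu. ee n (S b) (fst b) = ee n a i}"
    proof (rule bij_betw_byWitness[where f' = snd])
      show "snd ` {b \<in> boxes mu. ee n (S b) (fst b) = ee n a i} \<subseteq> {j \<in> {1..mu ! (i - 1)}. S (i, j) = a}"
        using inj by (force simp: boxes_eq_Sigma_rows[OF mu])
      show "\<forall>b\<in>{b \<in> boxes mu. ee n (S b) (fst b) = ee n a i}. (i, snd b) = b"
        using inj by force
    qed (use i in \<open>auto simp: boxes_eq_Sigma_rows[OF mu]\<close>)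
    then show ?thesis by (rule bij_betw_same_card)
  qed
  have rows: "card {j \<in> {1..lam ! (i - 1)}. T (i, j) = a} = card {j \<in> {1..lam' ! (i - 1)}. T' (i, j) = a}"
    if "1 \<le> i" "i \<le> n" for i a
    using row[OF lam(1) that, of T a] row[OF lam(2) that, of T' a] cnt by simp
  have tot: "mu ! (i - 1) = (\<Sum>a\<in>idxs n. card {j \<in> {1..mu ! (i - 1)}. S (i, j) = a})"
    if mu: "is_partition n mu" and S: "S \<in> fillings n mu" and i: "1 \<le> i" "i \<le> n" for mu S i
  proof -
    have "{1..mu ! (i - 1)} = (\<Union>a\<in>idxs n. {j \<in> {1..mu ! (i - 1)}. S (i, j) = a})"
      using i fillings_entry[OF S, of "(i, _)"] by (auto simp: boxes_eq_Sigma_rows[OF mu])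
    then have "card {1..mu ! (i - 1)} = card (\<Union>a\<in>idxs n. {j \<in> {1..mu ! (i - 1)}. S (i, j) = a})" by (rule arg_cong)
    also have "\<dots> = (\<Sum>a\<in>idxs n. card {j \<in> {1..mu ! (i - 1)}. S (i, j) = a})"
      using finite_idxs by (intro card_UN_disjoint) auto
    finally show ?thesis by simp
  qed
  have TF: "T \<in> fillings n lam" "T' \<in> fillings n lam'" "semistandard lam T" "semistandard lam' T'"
    using T by (auto simp: symplectic_tab_def)
  have len: "lam ! (i - 1) = lam' ! (i - 1)" if "1 \<le> i" "i \<le> n" for i
    using tot[OF lam(1) TF(1) that] tot[OF lam(2) TF(2) that] rows[OF that] by simp
  have ll: "lam = lam'"
  proof (rule nth_equalityI)
    show "length lam = length lam'" using lam by (simp add: is_partition_def)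
    show "lam ! i = lam' ! i" if "i < length lam" for i
      using len[of "Suc i"] that lam by (simp add: is_partition_def)
  qed
  have "T (i, j) = T' (i, j)" for i j
  proof (cases "(i, j) \<in> boxes lam")
    case True
    then have i: "1 \<le> i" "i \<le> n" "j \<in> {1..lam ! (i - 1)}" by (auto simp: boxes_eq_Sigma_rows[OF lam(1)])
    have "ixkey (T (i, j)) = ixkey (T' (i, j))"
    proof (rule mono_eq_of_counts[of "lam ! (i - 1)" "\<lambda>j. ixkey (T (i, j))" "\<lambda>j. ixkey (T' (i, j))"])
      show "ixkey (T (i, k)) \<le> ixkey (T (i, k'))" if "1 \<le> k" "k \<le> k'" "k' \<le> lam ! (i - 1)" for k k'
        using that i by (intro semistandard_row_mono[OF lam(1) TF(3)]) (auto simp: boxes_eq_Sigma_rows[OF lam(1)])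
      show "ixkey (T' (i, k)) \<le> ixkey (T' (i, k'))" if "1 \<le> k" "k \<le> k'" "k' \<le> lam ! (i - 1)" for k k'
        using that i ll by (intro semistandard_row_mono[OF lam(2) TF(4)]) (auto simp: boxes_eq_Sigma_rows[OF lam(2)])
      show "card {k \<in> {1..lam ! (i - 1)}. ixkey (T (i, k)) = a} = card {k \<in> {1..lam ! (i - 1)}. ixkey (T' (i, k)) = a}" for a
      proof (cases "\<exists>x. ixkey x = a")
        case True
        then obtain x where "ixkey x = a" by auto
        then have "ixkey y = a \<longleftrightarrow> y = x" for y using ixkey_inj by auto
        then show ?thesis using rows[OF i(1,2), of x] ll by simp
      next
        case False then show ?thesis by auto
      qed
      show "j \<in> {1..lam ! (i - 1)}" by (rule i(3))
    qed
    then show ?thesis by (simp add: ixkey_inj)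
  next
    case False
    then show ?thesis using TF(1,2) ll by (simp add: fillings_def)
  qed
  then show ?thesis using ll by auto
qed

text \<open>Divide by the lowest power of \<open>e\<close> that has a nonzero coefficient and let
  \<open>e\<close> tend to 0; since the exponents are distinct, only that coefficient
  survives.\<close>

lemma leading_independent:
  fixes c :: "'i \<Rightarrow> complex" and w :: "'i \<Rightarrow> nat"
  assumes I: "finite I" and w: "inj_on w I"
    and R: "\<And>i. i \<in> I \<Longrightarrow> (R i \<longlongrightarrow> 1) (at 0)"
    and zero: "\<And>e. e \<noteq> 0 \<Longrightarrow> (\<Sum>i\<in>I. c i * (e ^ w i * R i e)) = 0"
    and i: "i \<in> I"
  shows "c i = 0"
proof (rule ccontr)
  assume "c i \<noteq> 0"
  define I' where "I' = {i \<in> I. c i \<noteq> 0}"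
  have I': "finite I'" "I' \<noteq> {}" using I i \<open>c i \<noteq> 0\<close> by (auto simp: I'_def)
  then obtain i0 where i0: "i0 \<in> I'" "\<And>i. i \<in> I' \<Longrightarrow> w i0 \<le> w i"
    using arg_min_if_finite[of I' w] by (metis not_le)
  define S where "S e = (\<Sum>i\<in>I'. c i * (e ^ (w i - w i0) * R i e))" for e
  have S0: "S e = 0" if "e \<noteq> 0" for e
  proof -
    have "e ^ w i0 * S e = (\<Sum>i\<in>I'. c i * (e ^ w i * R i e))"
      unfolding S_def sum_distrib_left
    proof (rule sum.cong[OF refl])
      fix i assume "i \<in> I'"
      then have "e ^ w i = e ^ w i0 * e ^ (w i - w i0)" using i0(2)[of i] by (simp add: power_add[symmetric])
      then show "e ^ w i0 * (c i * (e ^ (w i - w i0) * R i e)) = c i * (e ^ w i * R i e)" by (simp add: mult_ac)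
    qed
    also have "\<dots> = (\<Sum>i\<in>I. c i * (e ^ w i * R i e))"
      using I by (intro sum.mono_neutral_left) (auto simp: I'_def)
    finally show ?thesis using zero[OF that] that by simp
  qed
  have "(S \<longlongrightarrow> (\<Sum>i\<in>I'. c i * (0 ^ (w i - w i0) * 1))) (at 0)"
    unfolding S_def by (intro tendsto_intros R) (auto simp: I'_def)
  also have "(\<Sum>i\<in>I'. c i * (0 ^ (w i - w i0) * 1)) = (\<Sum>i\<in>I'. if i = i0 then c i0 else 0)"
  proof (rule sum.cong[OF refl])
    fix i assume i: "i \<in> I'"
    have "w i \<noteq> w i0" if "i \<noteq> i0" using w that i i0(1) by (auto simp: I'_def inj_on_def)
    then show "c i * (0 ^ (w i - w i0) * 1) = (if i = i0 then c i0 else 0)"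
      using i0(2)[OF i] by (auto simp: power_0_left)
  qed
  also have "\<dots> = c i0" using I' i0(1) by simp
  finally have "(S \<longlongrightarrow> c i0) (at 0)" .
  moreover have "(S \<longlongrightarrow> 0) (at 0)"
    by (rule tendsto_eventually) (auto simp: eventually_at_filter S0)
  ultimately have "c i0 = 0" by (rule tendsto_unique[rotated]) simp
  then show False using i0(1) by (simp add: I'_def)
qed

text \<open>\<open>n < N\<close> lets one raised exponent outweigh the diagonal of a minor, and
  \<open>2 \<le> N\<close> makes the powers strictly increasing. \<open>N\<close> stays a parameter
  because it must later exceed the number of boxes of the shapes considered.\<close>

locale degeneration =
  fixes n N :: nat
  assumes nN: "n < N" and N2: "2 \<le> N"
begin

definition E :: "ix \<Rightarrow> nat \<Rightarrow> nat" where "E a q = N ^ ee n a q"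

lemma E_mono: "ixkey a < ixkey b \<Longrightarrow> E a q < E b q"
  using N2 mult_less_mono1[of "ixkey a" "ixkey b" "n + 1"] unfolding E_def ee_def
  by (intro power_strict_increasing) auto

text \<open>The frame is \<open>e ^ E a q * mz a q e\<close>. Column operations make the unbarred block lower
  triangular; isotropy then determines the entries \<open>Q i\<close> of column \<open>q\<close> for \<open>i < q\<close>.\<close>
function mzQ :: "nat \<Rightarrow> complex \<Rightarrow> nat \<Rightarrow> complex" where
  "mzQ q e i = (if q \<le> i then 1 else
     - (\<Sum>k\<in>{i<..n}. e ^ (E (P k) i - E (P i) i + (E (Q k) q - E (Q i) q)) * mzQ q e k
         - e ^ (E (Q k) i - E (P i) i + (E (P k) q - E (Q i) q)) * (if k < q then 0 else 1)))"
  by pat_completeness auto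
termination by (relation "measure (\<lambda>(q, e, i). n - i)") auto

declare mzQ.simps[simp del]

fun mz :: "ix \<Rightarrow> nat \<Rightarrow> complex \<Rightarrow> complex" where
  "mz (P i) q e = (if i < q then 0 else 1)"
| "mz (Q i) q e = mzQ q e i"

definition frame :: "complex \<Rightarrow> ix \<Rightarrow> nat \<Rightarrow> complex" where
  "frame e a q = e ^ E a q * mz a q e"

section \<open>Limits, isotropy and minors of the frames\<close>

lemma tendsto_power_zero:
  "0 < k \<Longrightarrow> ((\<lambda>e::complex. e ^ k) \<longlongrightarrow> 0) (at 0)"
  by (rule tendsto_eq_intros) (auto intro!: tendsto_eq_intros)

lemma mzQ_tendsto: "((\<lambda>e. mzQ q e i) \<longlongrightarrow> (if q \<le> i then 1 else 0)) (at 0)"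
proof (induction "n - i" arbitrary: i rule: less_induct)
  case less
  show ?case
  proof (cases "q \<le> i")
    case True then show ?thesis by (simp add: mzQ.simps[of q _ i])
  next
    case False
    define f where "f k e = e ^ (E (P k) i - E (P i) i + (E (Q k) q - E (Q i) q)) * mzQ q e k
         - e ^ (E (Q k) i - E (P i) i + (E (P k) q - E (Q i) q)) * (if k < q then 0 else 1)" for k e
    have "(f k \<longlongrightarrow> 0 * (if q \<le> k then 1 else 0) - 0 * (if k < q then 0 else 1)) (at 0)" if k: "k \<in> {i<..n}" for k
      unfolding f_def
    proof (intro tendsto_diff tendsto_mult tendsto_const tendsto_power_zero)
      show "((\<lambda>e. mzQ q e k) \<longlongrightarrow> (if q \<le> k then 1 else 0)) (at 0)" using k by (intro less) auto
      show "0 < E (P k) i - E (P i) i + (E (Q k) q - E (Q i) q)" using E_mono[of "P i" "P k" i] k by simp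
      show "0 < E (Q k) i - E (P i) i + (E (P k) q - E (Q i) q)" using E_mono[of "P i" "Q k" i] k by simp
    qed
    then have "((\<lambda>e. - (\<Sum>k\<in>{i<..n}. f k e)) \<longlongrightarrow> - (\<Sum>k\<in>{i<..n}. 0)) (at 0)"
      by (intro tendsto_minus tendsto_sum) simp
    moreover have "(\<lambda>e. mzQ q e i) = (\<lambda>e. - (\<Sum>k\<in>{i<..n}. f k e))"
      using False by (simp add: mzQ.simps[of q _ i] f_def)
    ultimately show ?thesis using False by simp
  qed
qed

text \<open>The entries that survive are those which the symplectic condition admits in row
  \<open>q\<close>, so all factors on the diagonal of a symplectic column tend to 1.\<close>

lemma mz_tendsto: "((\<lambda>e. mz a q e) \<longlongrightarrow> (if 2 * q \<le> ixkey a then 1 else 0)) (at 0)"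
proof (cases a)
  case (Q i)
  have "2 * q \<le> Suc (2 * i) \<longleftrightarrow> q \<le> i" by presburger
  then show ?thesis using mzQ_tendsto[of q i] Q by simp
qed auto

text \<open>The recursion for \<open>mzQ\<close> is this equation solved for the entry
  \<open>Q p\<close> of column \<open>q\<close>, after division by
  \<open>e ^ E (P p) p * e ^ E (Q p) q\<close>. The natural number differences in its exponents are
  exact because larger keys have larger exponents. Summands with \<open>k < p\<close> vanish, as the
  unbarred block is lower triangular.\<close>

lemma frame_isotropic_less:
  assumes pq: "1 \<le> p" "p < q" "q \<le> n"
  shows "fform n (\<lambda>a. frame e a p) (\<lambda>a. frame e a q) = 0"
proof -
  define t where "t k = frame e (P k) p * frame e (Q k) q - frame e (Q k) p * frame e (P k) q" for k
  have S: "{1..n} = {1..<p} \<union> insert p {p<..n}" using pq by auto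
  have "(\<Sum>k=1..n. t k) = (\<Sum>k=1..<p. t k) + (t p + (\<Sum>k\<in>{p<..n}. t k))"
    unfolding S by (subst sum.union_disjoint) auto
  also have "(\<Sum>k=1..<p. t k) = 0"
    using pq by (intro sum.neutral) (auto simp: t_def frame_def)
  also have "t p = e ^ E (P p) p * e ^ E (Q p) q * mzQ q e p"
    using pq by (simp add: t_def frame_def)
  also have "\<dots> = - (\<Sum>k\<in>{p<..n}. t k)"
  proof -
    have "mzQ q e p = - (\<Sum>k\<in>{p<..n}. e ^ (E (P k) p - E (P p) p + (E (Q k) q - E (Q p) q)) * mzQ q e k
         - e ^ (E (Q k) p - E (P p) p + (E (P k) q - E (Q p) q)) * (if k < q then 0 else 1))"
      using pq by (subst mzQ.simps) simp
    moreover have key: "e ^ E (P p) p * e ^ E (Q p) q * (e ^ (E (P k) p - E (P p) p + (E (Q k) q - E (Q p) q)) * mzQ q e k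
         - e ^ (E (Q k) p - E (P p) p + (E (P k) q - E (Q p) q)) * (if k < q then 0 else 1)) = t k"
      if k: "k \<in> {p<..n}" for k
    proof -
      have ord: "E (P p) p < E (P k) p" "E (Q p) q < E (Q k) q" "E (P p) p < E (Q k) p" "E (Q p) q < E (P k) q"
        using k by (auto intro!: E_mono)
      have 1: "e ^ E (P p) p * e ^ E (Q p) q * e ^ (E (P k) p - E (P p) p + (E (Q k) q - E (Q p) q)) = e ^ E (P k) p * e ^ E (Q k) q"
        using ord by (simp add: power_add[symmetric])
      have 2: "e ^ E (P p) p * e ^ E (Q p) q * e ^ (E (Q k) p - E (P p) p + (E (P k) q - E (Q p) q)) = e ^ E (Q k) p * e ^ E (P k) q"
        using ord by (simp add: power_add[symmetric])
      have "mz (P k) p e = 1" "mz (Q k) p e = 1" using k by (simp_all add: mzQ.simps)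
      then show ?thesis unfolding t_def frame_def right_diff_distrib mult.assoc[symmetric] 1 2 by simp
    qed
    ultimately show ?thesis
      by (simp only: mult_minus_right sum_distrib_left) (rule arg_cong[where f = uminus], rule sum.cong[OF refl key])
  qed
  finally show ?thesis by (simp add: fform_def t_def)
qed

lemma fform_skew: "fform n v u = - fform n u v"
  unfolding fform_def sum_negf[symmetric] by (rule sum.cong) (auto simp: mult.commute)

lemma frame_isotropic:
  assumes "p \<in> {1..n}" "q \<in> {1..n}"
  shows "fform n (\<lambda>a. frame e a p) (\<lambda>a. frame e a q) = 0"
proof (cases p q rule: linorder_cases)
  case less then show ?thesis using assms frame_isotropic_less by simp
next
  case equal then show ?thesis by (simp add: fform_def mult.commute)
next
  case greater
  then show ?thesis using assms frame_isotropic_less[of q p e] fform_skew[of "\<lambda>a. frame e a p" "\<lambda>a. frame e a q"] by simp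
qed

text \<open>Let \<open>p\<close> be the last row that \<sigma> moves. Injectivity forces
  \<open>\<sigma> p < p\<close>, and \<open>ee\<close> decreases in the column number, so the
  exponent in row \<open>p\<close> rises by at least one level. This outweighs the whole diagonal up
  to row \<open>p\<close>, and the later rows are unchanged.\<close>

lemma diagonal_dominates:
  assumes k: "k \<le> n" and a: "\<And>i j. i \<in> {1..k} \<Longrightarrow> j \<in> {1..k} \<Longrightarrow> i < j \<Longrightarrow> ixkey (a i) < ixkey (a j)"
    and \<sigma>: "\<sigma> permutes {1..k}" "\<sigma> \<noteq> id"
  shows "(\<Sum>i=1..k. E (a i) i) < (\<Sum>i=1..k. E (a i) (\<sigma> i))"
proof -
  define X where "X = {i \<in> {1..k}. \<sigma> i \<noteq> i}"
  have "X \<noteq> {}"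
  proof
    assume "X = {}"
    then have "\<sigma> i = i" for i using permutes_not_in[OF \<sigma>(1), of i] by (cases "i \<in> {1..k}") (auto simp: X_def)
    then show False using \<sigma>(2) by (auto simp: fun_eq_iff)
  qed
  define p where "p = Max X"
  have pX: "p \<in> X" unfolding p_def using \<open>X \<noteq> {}\<close> by (intro Max_in) (auto simp: X_def)
  then have p: "p \<in> {1..k}" "\<sigma> p \<noteq> p" by (auto simp: X_def)
  have above: "\<sigma> i = i" if "p < i" for i
  proof (cases "i \<in> {1..k}")
    case True
    then show ?thesis using Max_ge[of X i] that by (fastforce simp: X_def p_def)
  next
    case False then show ?thesis by (rule permutes_not_in[OF \<sigma>(1)])
  qed
  have lt: "\<sigma> p < p"
  proof (rule ccontr)
    assume "\<not> \<sigma> p < p"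
    then have "p < \<sigma> p" using p(2) by simp
    then have "\<sigma> (\<sigma> p) = \<sigma> p" by (rule above)
    then show False using p(2) permutes_inj[OF \<sigma>(1)] by (auto dest: injD)
  qed
  have S: "{1..k} = {1..p} \<union> {p<..k}" using p by auto
  have spl: "(\<Sum>i=1..k. h i) = (\<Sum>i=1..p. h i) + (\<Sum>i\<in>{p<..k}. h i)" for h :: "nat \<Rightarrow> nat"
    unfolding S by (rule sum.union_disjoint) auto
  have "(\<Sum>i=1..p. E (a i) i) < N ^ Suc (ee n (a p) p)"
    unfolding E_def
  proof (rule key_weight_bound)
    show "card {1..p} < N" using p k nN by simp
    fix i assume i: "i \<in> {1..p}"
    show "ee n (a i) i \<le> ee n (a p) p"
    proof (cases "i = p")
      case False
      then have "Suc (ixkey (a i)) \<le> ixkey (a p)" using a[of i p] i p by (simp add: Suc_le_eq)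
      then have "Suc (ixkey (a i)) * (n + 1) \<le> ixkey (a p) * (n + 1)" by (rule mult_le_mono1)
      then show ?thesis by (simp add: ee_def)
    qed simp
  qed simp
  also have "\<dots> \<le> E (a p) (\<sigma> p)"
    unfolding E_def using lt p k N2 by (intro power_increasing) (auto simp: ee_def)
  also have "\<dots> \<le> (\<Sum>i=1..p. E (a i) (\<sigma> i))" using p by (intro member_le_sum) auto
  finally show ?thesis unfolding spl using above by simp
qed

lemma detp_frame_asymptotics:
  assumes k: "k \<le> n" and a: "\<And>i j. i \<in> {1..k} \<Longrightarrow> j \<in> {1..k} \<Longrightarrow> i < j \<Longrightarrow> ixkey (a i) < ixkey (a j)"
    and dom: "\<And>i. i \<in> {1..k} \<Longrightarrow> 2 * i \<le> ixkey (a i)"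
  shows "\<exists>R. (\<forall>e. detp k (\<lambda>i. frame e (a i)) = e ^ (\<Sum>i=1..k. E (a i) i) * R e) \<and> (R \<longlongrightarrow> 1) (at 0)"
proof -
  define D where "D \<sigma> = (\<Sum>i=1..k. E (a i) (\<sigma> i))" for \<sigma> :: "nat \<Rightarrow> nat"
  define R where "R e = (\<Sum>\<sigma>\<in>{\<sigma>. \<sigma> permutes {1..k}}. of_int (sign \<sigma>) * (e ^ (D \<sigma> - D id) * (\<Prod>i=1..k. mz (a i) (\<sigma> i) e)))" for e
  have le: "D id \<le> D \<sigma>" if "\<sigma> permutes {1..k}" for \<sigma>
    using diagonal_dominates[of k a \<sigma>, OF k a that] by (cases "\<sigma> = id") (auto simp: D_def)
  have "detp k (\<lambda>i. frame e (a i)) = e ^ D id * R e" for e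
    unfolding detp_def R_def sum_distrib_left
  proof (rule sum.cong[OF refl])
    fix \<sigma> assume "\<sigma> \<in> {\<sigma>. \<sigma> permutes {1..k}}"
    then have "D id + (D \<sigma> - D id) = D \<sigma>" using le by simp
    then have "e ^ D \<sigma> = e ^ D id * e ^ (D \<sigma> - D id)" by (simp add: power_add[symmetric])
    moreover have "(\<Prod>i=1..k. frame e (a i) (\<sigma> i)) = e ^ D \<sigma> * (\<Prod>i=1..k. mz (a i) (\<sigma> i) e)"
      by (simp add: frame_def prod.distrib D_def power_sum)
    ultimately show "of_int (sign \<sigma>) * (\<Prod>i=1..k. frame e (a i) (\<sigma> i))
        = e ^ D id * (of_int (sign \<sigma>) * (e ^ (D \<sigma> - D id) * (\<Prod>i=1..k. mz (a i) (\<sigma> i) e)))" by (simp add: mult_ac)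
  qed
  moreover have "(R \<longlongrightarrow> 1) (at 0)"
  proof -
    define \<mu> where "\<mu> \<sigma> = (\<Prod>i=1..k. if 2 * \<sigma> i \<le> ixkey (a i) then 1 else (0::complex))" for \<sigma> :: "nat \<Rightarrow> nat"
    have "(R \<longlongrightarrow> (\<Sum>\<sigma>\<in>{\<sigma>. \<sigma> permutes {1..k}}. of_int (sign \<sigma>) * (0 ^ (D \<sigma> - D id) * \<mu> \<sigma>))) (at 0)"
      unfolding R_def \<mu>_def by (intro tendsto_sum tendsto_mult tendsto_const tendsto_prod mz_tendsto tendsto_power tendsto_ident_at)
    also have "(\<Sum>\<sigma>\<in>{\<sigma>. \<sigma> permutes {1..k}}. of_int (sign \<sigma>) * (0 ^ (D \<sigma> - D id) * \<mu> \<sigma>))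
       = (\<Sum>\<sigma>\<in>{\<sigma>. \<sigma> permutes {1..k}}. if \<sigma> = id then 1 else 0)"
    proof (rule sum.cong[OF refl])
      fix \<sigma> assume s: "\<sigma> \<in> {\<sigma>. \<sigma> permutes {1..k}}"
      show "of_int (sign \<sigma>) * (0 ^ (D \<sigma> - D id) * \<mu> \<sigma>) = (if \<sigma> = id then 1 else 0)"
      proof (cases "\<sigma> = id")
        case True
        then have "\<mu> \<sigma> = 1" unfolding \<mu>_def using dom by (intro prod.neutral) auto
        then show ?thesis using True by (simp add: sign_id)
      next
        case False
        then have "D id < D \<sigma>" using diagonal_dominates[of k a \<sigma>, OF k a] s False by (simp add: D_def)
        then show ?thesis using False by (simp add: power_0_left)
      qed
    qed
    also have "\<dots> = 1" using permutes_id[of "{1..k}"] finite_permutations[of "{1..k}"] by simp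
    finally show ?thesis .
  qed
  ultimately show ?thesis by (auto simp: D_def)
qed

lemma Phi_frame_asymptotics:
  assumes lam: "is_partition n lam" and T: "symplectic_tab n lam T"
  shows "\<exists>R. (\<forall>e. Phi lam T (frame e) = e ^ twt n N lam T * R e) \<and> (R \<longlongrightarrow> 1) (at 0)"
proof -
  define w where "w j = (\<Sum>i=1..collen lam j. E (T (i, j)) i)" for j
  have "\<exists>R. (\<forall>e. detp (collen lam j) (\<lambda>i. frame e (T (i, j))) = e ^ w j * R e) \<and> (R \<longlongrightarrow> 1) (at 0)"
    if j: "j \<in> {1..ncols lam}" for j
    unfolding w_def
  proof (rule detp_frame_asymptotics[OF collen_le[OF lam]])
    have bx: "(i, j) \<in> boxes lam" if "i \<in> {1..collen lam j}" for i using that j by (auto simp: mem_boxes_iff[OF lam])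
    show "2 * i \<le> ixkey (T (i, j))" if "i \<in> {1..collen lam j}" for i
      using T bx[OF that] by (auto simp: symplectic_tab_def)
    fix i i' assume i: "i \<in> {1..collen lam j}" "i' \<in> {1..collen lam j}" "i < i'"
    show "ixkey (T (i, j)) < ixkey (T (i', j))"
      using T bx[OF i(1)] bx[OF i(2)] i(3) by (intro semistandard_col_mono[OF lam]) (auto simp: symplectic_tab_def)
  qed
  then obtain R where R: "\<And>j. j \<in> {1..ncols lam} \<Longrightarrow> (\<forall>e. detp (collen lam j) (\<lambda>i. frame e (T (i, j))) = e ^ w j * R j e) \<and> (R j \<longlongrightarrow> 1) (at 0)"
    by metis
  have "Phi lam T (frame e) = e ^ twt n N lam T * (\<Prod>j=1..ncols lam. R j e)" for e
  proof -
    have "Phi lam T (frame e) = (\<Prod>j=1..ncols lam. e ^ w j * R j e)"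
      unfolding Phi_def plueck_column using R by (intro prod.cong) auto
    also have "\<dots> = e ^ (\<Sum>j=1..ncols lam. w j) * (\<Prod>j=1..ncols lam. R j e)"
      by (simp add: prod.distrib power_sum)
    also have "(\<Sum>j=1..ncols lam. w j) = twt n N lam T"
      by (simp add: twt_def sum_boxes[OF lam] w_def E_def)
    finally show ?thesis .
  qed
  moreover have "((\<lambda>e. \<Prod>j=1..ncols lam. R j e) \<longlongrightarrow> (\<Prod>j=1..ncols lam. 1)) (at 0)"
    using R by (intro tendsto_prod) auto
  ultimately show ?thesis by auto
qed

end

text \<open>Several shapes are treated at once, so that the ideal of relations need not be decomposed
  into multihomogeneous components.\<close>
lemma symplectic_Phi_independent:
  assumes I: "finite I" "\<And>lam T. (lam, T) \<in> I \<Longrightarrow> is_partition n lam \<and> symplectic_tab n lam T"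
  shows "\<exists>N. n < N \<and> 2 \<le> N \<and> (\<forall>c. (\<forall>e. e \<noteq> 0 \<longrightarrow> (\<Sum>(lam, T)\<in>I. c (lam, T) * Phi lam T (degeneration.frame n N e)) = 0) \<longrightarrow> (\<forall>x\<in>I. c x = 0))"
proof -
  \<comment> \<open>Adding up the box counts makes \<open>N\<close> exceed each of them, as
    \<open>twt_inject\<close> requires for every pair of shapes.\<close>
  define N where "N = n + 2 + (\<Sum>(lam, T)\<in>I. card (boxes lam))"
  interpret degeneration n N by unfold_locales (auto simp: N_def)
  have cN: "card (boxes lam) < N" if "(lam, T) \<in> I" for lam T
    using member_le_sum[OF that, of "\<lambda>(lam, T). card (boxes lam)"] I(1) by (simp add: N_def)
  have "\<forall>x\<in>I. \<exists>R. (\<forall>e. Phi (fst x) (snd x) (frame e) = e ^ twt n N (fst x) (snd x) * R e) \<and> (R \<longlongrightarrow> 1) (at 0)"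
    using Phi_frame_asymptotics I(2) by auto
  then obtain R where R: "\<And>x. x \<in> I \<Longrightarrow> (\<forall>e. Phi (fst x) (snd x) (frame e) = e ^ twt n N (fst x) (snd x) * R x e) \<and> (R x \<longlongrightarrow> 1) (at 0)"
    by metis
  have "c x = 0" if z: "\<forall>e. e \<noteq> 0 \<longrightarrow> (\<Sum>(lam, T)\<in>I. c (lam, T) * Phi lam T (frame e)) = 0" and x: "x \<in> I" for c x
  proof (rule leading_independent[OF I(1), where w = "\<lambda>x. twt n N (fst x) (snd x)" and R = R])
    show "inj_on (\<lambda>x. twt n N (fst x) (snd x)) I"
    proof (rule inj_onI)
      fix x y assume xy: "x \<in> I" "y \<in> I" "twt n N (fst x) (snd x) = twt n N (fst y) (snd y)"
      have "fst x = fst y \<and> snd x = snd y"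
        using xy I(2)[of "fst x" "snd x"] I(2)[of "fst y" "snd y"] cN[of "fst x" "snd x"] cN[of "fst y" "snd y"]
        by (intro twt_inject) auto
      then show "x = y" by (simp add: prod_eq_iff)
    qed
    show "(R i \<longlongrightarrow> 1) (at 0)" if "i \<in> I" for i using R that by auto
    show "(\<Sum>i\<in>I. c i * (e ^ twt n N (fst i) (snd i) * R i e)) = 0" if "e \<noteq> 0" for e
    proof -
      have "(\<Sum>i\<in>I. c i * (e ^ twt n N (fst i) (snd i) * R i e)) = (\<Sum>(lam, T)\<in>I. c (lam, T) * Phi lam T (frame e))"
        by (rule sum.cong) (use R in auto)
      then show ?thesis using z that by simp
    qed
  qed (rule x)
  then show ?thesis using nN N2 by blast
qed

subsection \<open>The symplectic group\<close>

fun bar :: "ix \<Rightarrow> ix" where "bar (P i) = Q i" | "bar (Q i) = P i"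

fun sg :: "ix \<Rightarrow> complex" where "sg (P i) = 1" | "sg (Q i) = -1"

lemma bar_bar[simp]: "bar (bar a) = a" by (cases a) auto
lemma sg_bar[simp]: "sg (bar a) = - sg a" by (cases a) auto
lemma sg_sq[simp]: "sg a * sg a = 1" by (cases a) auto
lemma bar_in_idxs[simp]: "bar a \<in> idxs n \<longleftrightarrow> a \<in> idxs n" by (cases a) auto
lemma bar_eq_iff: "bar a = b \<longleftrightarrow> a = bar b" by auto

lemma fform_eq_sum: "fform n u v = (\<Sum>a\<in>idxs n. sg a * u a * v (bar a))"
  unfolding sum_idxs fform_def by (rule sum.cong) auto

lemma fform_eq_sum': "fform n u v = - (\<Sum>a\<in>idxs n. sg a * u (bar a) * v a)"
  unfolding sum_idxs fform_def sum_negf[symmetric] by (rule sum.cong) auto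

lemma fform_cong: "(\<And>a. a \<in> idxs n \<Longrightarrow> u a = u' a) \<Longrightarrow> (\<And>a. a \<in> idxs n \<Longrightarrow> v a = v' a) \<Longrightarrow> fform n u v = fform n u' v'"
  unfolding fform_eq_sum by (intro sum.cong) auto

lemma fform_sum_left: "fform n (\<lambda>a. \<Sum>i\<in>I. c i * u i a) v = (\<Sum>i\<in>I. c i * fform n (u i) v)"
proof -
  have "fform n (\<lambda>a. \<Sum>i\<in>I. c i * u i a) v = (\<Sum>a\<in>idxs n. \<Sum>i\<in>I. c i * (sg a * u i a * v (bar a)))"
    unfolding fform_eq_sum by (intro sum.cong refl) (simp add: sum_distrib_left sum_distrib_right mult_ac)
  also have "\<dots> = (\<Sum>i\<in>I. \<Sum>a\<in>idxs n. c i * (sg a * u i a * v (bar a)))" by (rule sum.swap)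
  finally show ?thesis by (simp add: fform_eq_sum sum_distrib_left)
qed

lemma fform_sum_right: "fform n u (\<lambda>a. \<Sum>i\<in>I. c i * v i a) = (\<Sum>i\<in>I. c i * fform n u (v i))"
proof -
  have "fform n u (\<lambda>a. \<Sum>i\<in>I. c i * v i a) = (\<Sum>a\<in>idxs n. \<Sum>i\<in>I. c i * (sg a * u a * v i (bar a)))"
    unfolding fform_eq_sum by (intro sum.cong refl) (simp add: sum_distrib_left mult_ac)
  also have "\<dots> = (\<Sum>i\<in>I. \<Sum>a\<in>idxs n. c i * (sg a * u a * v i (bar a)))" by (rule sum.swap)
  finally show ?thesis by (simp add: fform_eq_sum sum_distrib_left)
qed

text \<open>The Gram matrix of \<open>fform n\<close> in the standard basis.\<close>

definition JJ :: "ix \<Rightarrow> ix \<Rightarrow> complex" where "JJ b c = (if c = bar b then sg b else 0)"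

lemma fform_mvec:
  "fform n (mvec n g u) (mvec n g v) = (\<Sum>b\<in>idxs n. \<Sum>c\<in>idxs n. u b * (v c * fform n (\<lambda>a. g a b) (\<lambda>a. g a c)))"
proof -
  have "fform n (mvec n g u) (mvec n g v) = fform n (\<lambda>a. \<Sum>b\<in>idxs n. u b * g a b) (\<lambda>a. \<Sum>c\<in>idxs n. v c * g a c)"
    by (simp add: mvec_def mult.commute)
  then show ?thesis unfolding fform_sum_left fform_sum_right sum_distrib_left .
qed

lemma fform_eq_JJ: "fform n u v = (\<Sum>b\<in>idxs n. \<Sum>c\<in>idxs n. u b * (v c * JJ b c))"
  unfolding fform_eq_sum
proof (rule sum.cong[OF refl])
  fix b assume b: "b \<in> idxs n"
  have "(\<Sum>c\<in>idxs n. u b * (v c * JJ b c)) = (\<Sum>c\<in>idxs n. if c = bar b then u b * (v c * sg b) else 0)"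
    by (rule sum.cong) (auto simp: JJ_def)
  also have "\<dots> = u b * (v (bar b) * sg b)" using finite_idxs b by simp
  finally show "sg b * u b * v (bar b) = (\<Sum>c\<in>idxs n. u b * (v c * JJ b c))" by (simp add: mult_ac)
qed

lemma Sp_iff:
  "g \<in> Sp n \<longleftrightarrow> (\<forall>a b. a \<notin> idxs n \<or> b \<notin> idxs n \<longrightarrow> g a b = 0)
     \<and> (\<forall>b\<in>idxs n. \<forall>c\<in>idxs n. fform n (\<lambda>a. g a b) (\<lambda>a. g a c) = JJ b c)"
proof -
  have "fform n (\<lambda>a. g a b) (\<lambda>a. g a c) = JJ b c"
    if h: "\<forall>u v. fform n (mvec n g u) (mvec n g v) = fform n u v" and bc: "b \<in> idxs n" "c \<in> idxs n" for b c
  proof -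
    define un :: "ix \<Rightarrow> ix \<Rightarrow> complex" where "un b = (\<lambda>a. if a = b then 1 else 0)" for b
    have un: "(\<Sum>x\<in>idxs n. \<Sum>y\<in>idxs n. un b x * (un c y * F x y)) = F b c" for F
    proof -
      have "(\<Sum>y\<in>idxs n. un b x * (un c y * F x y)) = (if x = b then F x c else 0)" for x
        using finite_idxs bc(2) by (simp add: un_def if_distrib[of "\<lambda>z. z * _"] cong: if_cong)
      then show ?thesis using finite_idxs bc(1) by simp
    qed
    have "fform n (mvec n g (un b)) (mvec n g (un c)) = fform n (un b) (un c)" using h by blast
    then show ?thesis unfolding fform_mvec fform_eq_JJ[of n "un b"] un .
  qed
  moreover have "fform n (mvec n g u) (mvec n g v) = fform n u v"
    if "\<forall>b\<in>idxs n. \<forall>c\<in>idxs n. fform n (\<lambda>a. g a b) (\<lambda>a. g a c) = JJ b c" for u v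
    unfolding fform_mvec fform_eq_JJ[of n u] using that by (intro sum.cong refl) simp
  ultimately show ?thesis unfolding Sp_def by blast
qed

text \<open>The conditions on the columns of \<open>g\<close> say that the signed, barred transpose
  \<open>A\<close> is a left inverse of \<open>g\<close>. It is then also a right inverse, and this
  gives the same conditions on the rows. Transposes matter because evaluation turns the action of
  \<open>g\<close> into multiplication of frames by the transpose, see
  \<open>ev_act\<close>.\<close>

lemma Sp_transpose:
  assumes g: "g \<in> Sp n"
  shows "(\<lambda>a b. g b a) \<in> Sp n"
proof -
  have col: "fform n (\<lambda>a. g a b) (\<lambda>a. g a c) = JJ b c" if "b \<in> idxs n" "c \<in> idxs n" for b c
    using g that by (simp add: Sp_iff)
  define A where "A b a = sg b * sg a * g (bar a) (bar b)" for a b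
  have left: "(\<Sum>a\<in>idxs n. A b a * g a c) = (if b = c then 1 else 0)" if "b \<in> idxs n" "c \<in> idxs n" for b c
  proof -
    have "(\<Sum>a\<in>idxs n. A b a * g a c) = sg b * (\<Sum>a\<in>idxs n. sg a * g (bar a) (bar b) * g a c)"
      by (simp add: A_def sum_distrib_left mult_ac)
    also have "\<dots> = - sg b * fform n (\<lambda>a. g a (bar b)) (\<lambda>a. g a c)"
      by (simp add: fform_eq_sum')
    also have "\<dots> = (if b = c then 1 else 0)" using that by (simp add: col JJ_def)
    finally show ?thesis .
  qed
  have right: "(\<Sum>b\<in>idxs n. g a b * A b c) = (if a = c then 1 else 0)" if "a \<in> idxs n" "c \<in> idxs n" for a c
    by (rule matrix_left_right_inverse_on[OF finite_idxs left that])
  have "fform n (\<lambda>b. g a b) (\<lambda>b. g d b) = JJ a d" if ad: "a \<in> idxs n" "d \<in> idxs n" for a d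
  proof -
    have "(\<Sum>b\<in>idxs n. g a b * A b (bar d)) = sg (bar d) * fform n (\<lambda>b. g a b) (\<lambda>b. g d b)"
      unfolding fform_eq_sum by (simp add: A_def sum_distrib_left mult_ac)
    then have "sg (bar d) * fform n (\<lambda>b. g a b) (\<lambda>b. g d b) = (if a = bar d then 1 else 0)"
      using right[of a "bar d"] ad by simp
    then have "sg (bar d) * (sg (bar d) * fform n (\<lambda>b. g a b) (\<lambda>b. g d b)) = sg (bar d) * (if a = bar d then 1 else 0)"
      by (rule arg_cong)
    then show ?thesis unfolding mult.assoc[symmetric] sg_sq by (auto simp: JJ_def)
  qed
  then show ?thesis using g by (auto simp: Sp_iff)
qed

lemma Sp_conj:
  assumes g: "g \<in> Sp n"
  shows "(\<lambda>a b. cnj (g a b)) \<in> Sp n"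
proof -
  have "fform n (\<lambda>a. cnj (u a)) (\<lambda>a. cnj (v a)) = cnj (fform n u v)" for u v by (simp add: fform_def)
  moreover have "cnj (JJ b c) = JJ b c" for b c by (cases b) (auto simp: JJ_def)
  ultimately show ?thesis using g by (simp add: Sp_iff)
qed

section \<open>The group acting on isotropic frames\<close>

lemma fform_nondegenerate:
  assumes "\<And>v. fform n x v = 0" "a \<in> idxs n"
  shows "x a = 0"
proof -
  have "0 = fform n x (\<lambda>b. if b = bar a then 1 else 0)" using assms(1) by simp
  also have "\<dots> = (\<Sum>b\<in>idxs n. if b = a then sg b * x b else 0)"
    unfolding fform_eq_sum by (rule sum.cong) (auto simp: bar_eq_iff)
  also have "\<dots> = sg a * x a" using finite_idxs assms(2) by simp
  finally show ?thesis by (cases a) auto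
qed

lemma good_matrix_Sp_mult:
  assumes g: "g \<in> Sp n" and M: "good_matrix n M"
  shows "good_matrix n (\<lambda>a q. \<Sum>c\<in>idxs n. g a c * M c q)"
  unfolding good_matrix_def
proof (intro conjI allI impI ballI)
  have pres: "fform n (mvec n g u) (mvec n g v) = fform n u v" for u v using g by (simp add: Sp_def)
  show "fform n (\<lambda>a. \<Sum>c\<in>idxs n. g a c * M c p) (\<lambda>a. \<Sum>c\<in>idxs n. g a c * M c q) = 0"
    if "p \<in> {1..n}" "q \<in> {1..n}" for p q
    using pres[of "\<lambda>a. M a p" "\<lambda>a. M a q"] M that by (simp add: mvec_def good_matrix_def)
  fix c q assume c: "\<forall>a\<in>idxs n. (\<Sum>q=1..n. c q * (\<Sum>b\<in>idxs n. g a b * M b q)) = 0" and q: "q \<in> {1..n}"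
  define x where "x b = (\<Sum>q=1..n. c q * M b q)" for b
  have gx: "mvec n g x a = 0" if "a \<in> idxs n" for a
  proof -
    have "mvec n g x a = (\<Sum>b\<in>idxs n. \<Sum>q=1..n. c q * (g a b * M b q))"
      unfolding mvec_def x_def sum_distrib_left by (simp add: mult_ac)
    also have "\<dots> = (\<Sum>q=1..n. \<Sum>b\<in>idxs n. c q * (g a b * M b q))" by (rule sum.swap)
    finally show ?thesis using c that by (simp add: sum_distrib_left)
  qed
  have "fform n x v = 0" for v
  proof -
    have "fform n x v = fform n (mvec n g x) (mvec n g v)" by (rule pres[symmetric])
    also have "\<dots> = 0" unfolding fform_eq_sum using gx by (intro sum.neutral) simp
    finally show ?thesis .
  qed
  then have "x a = 0" if "a \<in> idxs n" for a using fform_nondegenerate that by blast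
  then show "c q = 0" using M q unfolding good_matrix_def x_def by blast
qed

text \<open>Back substitution, adding one equation at a time from the bottom.\<close>

lemma upper_triangular_solve:
  fixes A :: "nat \<Rightarrow> nat \<Rightarrow> complex"
  assumes "\<And>p. p \<in> {1..n} \<Longrightarrow> A p p \<noteq> 0"
  shows "\<exists>w. \<forall>p\<in>{1..n}. (\<Sum>k\<in>{p..n}. A p k * w k) = rhs p"
proof -
  have "m \<le> n \<Longrightarrow> \<exists>w. \<forall>p\<in>{Suc (n - m)..n}. (\<Sum>k\<in>{p..n}. A p k * w k) = rhs p" for m
  proof (induction m)
    case 0 then show ?case by simp
  next
    case (Suc m)
    then obtain w where w: "\<And>p. p \<in> {Suc (n - m)..n} \<Longrightarrow> (\<Sum>k\<in>{p..n}. A p k * w k) = rhs p"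
      using Suc_leD by blast
    define r where "r = n - m"
    have r: "r \<in> {1..n}" "Suc (n - Suc m) = r" using Suc.prems by (auto simp: r_def)
    define w' where "w' = w(r := (rhs r - (\<Sum>k\<in>{Suc r..n}. A r k * w k)) / A r r)"
    have "(\<Sum>k\<in>{p..n}. A p k * w' k) = rhs p" if p: "p \<in> {r..n}" for p
    proof (cases "p = r")
      case True
      have S: "{r..n} = insert r {Suc r..n}" using r by auto
      have "(\<Sum>k\<in>{r..n}. A r k * w' k) = A r r * w' r + (\<Sum>k\<in>{Suc r..n}. A r k * w' k)"
        unfolding S by simp
      also have "(\<Sum>k\<in>{Suc r..n}. A r k * w' k) = (\<Sum>k\<in>{Suc r..n}. A r k * w k)"
        by (rule sum.cong) (auto simp: w'_def)
      finally show ?thesis using True assms[OF r(1)] by (simp add: w'_def)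
    next
      case False
      then have "(\<Sum>k\<in>{p..n}. A p k * w' k) = (\<Sum>k\<in>{p..n}. A p k * w k)"
        using p by (intro sum.cong) (auto simp: w'_def)
      then show ?thesis using w[of p] False p by (simp add: r_def)
    qed
    then show ?case unfolding r(2) by blast
  qed
  from this[of n] show ?thesis by simp
qed

text \<open>Complete the frame to a symplectic basis. The dual columns are sought in the span of the
  barred basis vectors, where they are isotropic among themselves. Their pairings with the frame
  form a triangular system, because the unbarred block is triangular with nonzero diagonal for
  \<open>e \<noteq> 0\<close>.\<close>

lemma (in degeneration) frame_in_Sp:
  assumes e: "e \<noteq> 0"
  shows "\<exists>g\<in>Sp n. \<forall>a\<in>idxs n. \<forall>q\<in>{1..n}. g a (P q) = frame e a q"
proof -
  have lower: "frame e (P k) p = 0" if "k < p" for k p using that by (simp add: frame_def)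
  have diag: "frame e (P p) p \<noteq> 0" for p using e by (simp add: frame_def)
  have "\<forall>j. \<exists>w. \<forall>p\<in>{1..n}. (\<Sum>k\<in>{p..n}. frame e (P k) p * w k) = (if p = j then 1 else 0)"
    using upper_triangular_solve[of n "\<lambda>p k. frame e (P k) p", OF diag] by (intro allI)
  then obtain w where w: "\<And>j p. p \<in> {1..n} \<Longrightarrow> (\<Sum>k\<in>{p..n}. frame e (P k) p * w j k) = (if p = j then 1 else 0)"
    by metis
  define g where "g a b = (if a \<in> idxs n \<and> b \<in> idxs n then (case b of P q \<Rightarrow> frame e a q
     | Q j \<Rightarrow> (case a of P k \<Rightarrow> 0 | Q k \<Rightarrow> w j k)) else 0)" for a b
  have gP: "fform n (\<lambda>a. g a (P q)) v = fform n (\<lambda>a. frame e a q) v" "fform n v (\<lambda>a. g a (P q)) = fform n v (\<lambda>a. frame e a q)"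
    if "q \<in> {1..n}" for q v using that by (auto intro!: fform_cong simp: g_def)
  have gQ: "fform n (\<lambda>a. frame e a p) (\<lambda>a. g a (Q j)) = (if p = j then 1 else 0)" if "p \<in> {1..n}" "j \<in> {1..n}" for p j
  proof -
    have "fform n (\<lambda>a. frame e a p) (\<lambda>a. g a (Q j)) = (\<Sum>k=1..n. frame e (P k) p * w j k)"
      unfolding fform_def using that by (intro sum.cong) (auto simp: g_def)
    also have "\<dots> = (\<Sum>k\<in>{p..n}. frame e (P k) p * w j k)"
      using lower that by (intro sum.mono_neutral_right) auto
    finally show ?thesis using w that by simp
  qed
  have QQ: "fform n (\<lambda>a. g a (Q i)) (\<lambda>a. g a (Q j)) = 0" for i j
    unfolding fform_def by (rule sum.neutral) (auto simp: g_def)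
  have "fform n (\<lambda>a. g a b) (\<lambda>a. g a c) = JJ b c" if bc: "b \<in> idxs n" "c \<in> idxs n" for b c
  proof (cases b)
    case b: (P p)
    show ?thesis
    proof (cases c)
      case (P q) then show ?thesis using b bc gP frame_isotropic[of p q e] by (simp add: JJ_def)
    next
      case (Q q) then show ?thesis using b bc gP gQ by (auto simp: JJ_def)
    qed
  next
    case b: (Q p)
    show ?thesis
    proof (cases c)
      case (P q)
      then show ?thesis using b bc gP gQ[of q p] fform_skew[of "\<lambda>a. g a (Q p)" "\<lambda>a. frame e a q"] by (auto simp: JJ_def)
    next
      case (Q q) then show ?thesis using b bc QQ by (simp add: JJ_def)
    qed
  qed
  then have "g \<in> Sp n" unfolding Sp_iff by (auto simp: g_def)
  moreover have "g a (P q) = frame e a q" if "a \<in> idxs n" "q \<in> {1..n}" for a q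
    using that by (simp add: g_def)
  ultimately show ?thesis by blast
qed

lemma good_matrix_cong:
  assumes "\<And>a q. a \<in> idxs n \<Longrightarrow> q \<in> {1..n} \<Longrightarrow> M a q = M' a q" "good_matrix n M"
  shows "good_matrix n M'"
proof -
  have "(\<Sum>q=1..n. c q * M' a q) = (\<Sum>q=1..n. c q * M a q)" if "a \<in> idxs n" for a c
    using assms(1) that by (intro sum.cong) auto
  moreover have "fform n (\<lambda>a. M' a p) (\<lambda>a. M' a q) = fform n (\<lambda>a. M a p) (\<lambda>a. M a q)" if "p \<in> {1..n}" "q \<in> {1..n}" for p q
    using assms(1) that by (intro fform_cong) auto
  ultimately show ?thesis using assms(2) by (simp add: good_matrix_def)
qed

definition std_frame :: "ix \<Rightarrow> nat \<Rightarrow> complex" where "std_frame a q = (if a = P q then 1 else 0)"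

lemma good_std_frame: "good_matrix n std_frame"
  unfolding good_matrix_def
proof (intro conjI allI impI ballI)
  fix c q assume "\<forall>a\<in>idxs n. (\<Sum>q=1..n. c q * std_frame a q) = 0" and q: "q \<in> {1..n}"
  then have "(\<Sum>r=1..n. c r * std_frame (P q) r) = 0" by simp
  also have "(\<Sum>r=1..n. c r * std_frame (P q) r) = (\<Sum>r=1..n. if r = q then c r else 0)"
    by (rule sum.cong) (auto simp: std_frame_def)
  finally show "c q = 0" using q by simp
qed (auto simp: fform_def std_frame_def)

lemma std_frame_mult: "q \<in> {1..n} \<Longrightarrow> (\<Sum>c\<in>idxs n. g a c * std_frame c q) = g a (P q)"
proof -
  assume "q \<in> {1..n}"
  have "(\<Sum>c\<in>idxs n. g a c * std_frame c q) = (\<Sum>c\<in>idxs n. if c = P q then g a c else 0)"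
    by (rule sum.cong) (auto simp: std_frame_def)
  then show ?thesis using \<open>q \<in> {1..n}\<close> finite_idxs by simp
qed

text \<open>Linear independence is inherited from the standard frame, of which this one is a
  translate under the group.\<close>

lemma (in degeneration) good_frame:
  assumes "e \<noteq> 0"
  shows "good_matrix n (frame e)"
proof -
  obtain g where g: "g \<in> Sp n" "\<And>a q. a \<in> idxs n \<Longrightarrow> q \<in> {1..n} \<Longrightarrow> g a (P q) = frame e a q"
    using frame_in_Sp[OF assms] by blast
  show ?thesis
    by (rule good_matrix_cong[OF _ good_matrix_Sp_mult[OF g(1) good_std_frame]]) (simp only: std_frame_mult g(2))
qed

subsection \<open>The kernel of evaluation\<close>

lemma Phi_cong:
  assumes lam: "is_partition n lam" and T: "T \<in> fillings n lam"
    and M: "\<And>a q. a \<in> idxs n \<Longrightarrow> q \<in> {1..n} \<Longrightarrow> M a q = M' a q"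
  shows "Phi lam T M = Phi lam T M'"
  unfolding Phi_def plueck_column
proof (rule prod.cong[OF refl], rule detp_cong)
  fix j i q assume j: "j \<in> {1..ncols lam}" "i \<in> {1..collen lam j}" "q \<in> {1..collen lam j}"
  then have "T (i, j) \<in> idxs n" by (intro fillings_entry[OF T]) (auto simp: mem_boxes_iff[OF lam])
  moreover have "q \<in> {1..n}" using j(3) collen_le[OF lam, of j] by simp
  ultimately show "M (T (i, j)) q = M' (T (i, j)) q" by (rule M)
qed

lemma ev_cong:
  assumes "is_partition n lam" "\<And>a q. a \<in> idxs n \<Longrightarrow> q \<in> {1..n} \<Longrightarrow> M a q = M' a q"
  shows "ev n lam M \<phi> = ev n lam M' \<phi>"
  unfolding ev_def by (rule sum.cong[OF refl]) (simp only: Phi_cong[OF assms(1) _ assms(2)])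

lemma finite_symplectic: "is_partition n lam \<Longrightarrow> finite {T. symplectic_tab n lam T}"
  using finite_fillings finite_subset[of "{T. symplectic_tab n lam T}" "fillings n lam"]
  by (auto simp: symplectic_tab_def)

lemma symplectic_decomposition:
  assumes lam: "is_partition n lam" and \<phi>: "\<phi> \<in> tens n lam"
  obtains c w where "w \<in> Wrel n lam" "\<phi> = (\<lambda>S. (\<Sum>T\<in>{T. symplectic_tab n lam T}. c T * delta T S) + w S)"
proof -
  let ?X = "{T. symplectic_tab n lam T}"
  define U where "U = {(\<lambda>S. (\<Sum>T\<in>?X. c T * delta T S) + w S) | c w. w \<in> Wrel n lam}"
  have Ws: "csubspace (Wrel n lam)" unfolding Wrel_def by (rule csubspace_cspan)
  have UI: "(\<lambda>S. (\<Sum>T\<in>?X. c T * delta T S) + w S) \<in> U" if "w \<in> Wrel n lam" for c w using that by (auto simp: U_def)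
  have U: "csubspace U"
    unfolding csubspace_def
  proof (intro conjI ballI allI)
    show "(\<lambda>x. 0) \<in> U" using UI[OF csubspace_zero[OF Ws], of "\<lambda>_. 0"] by simp
    fix u assume "u \<in> U"
    then obtain c w where u: "u = (\<lambda>S. (\<Sum>T\<in>?X. c T * delta T S) + w S)" "w \<in> Wrel n lam" by (auto simp: U_def)
    show "(\<lambda>x. a * u x) \<in> U" for a
      using UI[OF csubspace_scale[OF Ws u(2), of a], of "\<lambda>T. a * c T"]
      by (simp add: u(1) distrib_left sum_distrib_left mult.assoc)
    fix v assume "v \<in> U"
    then obtain d z where v: "v = (\<lambda>S. (\<Sum>T\<in>?X. d T * delta T S) + z S)" "z \<in> Wrel n lam" by (auto simp: U_def)
    show "(\<lambda>x. u x + v x) \<in> U"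
      using UI[OF csubspace_add[OF Ws u(2) v(2)], of "\<lambda>T. c T + d T"]
      by (simp add: u(1) v(1) distrib_right sum.distrib add_ac)
  qed
  have "{delta T | T. symplectic_tab n lam T} \<union> Wrel n lam \<subseteq> U"
  proof safe
    fix T assume "symplectic_tab n lam T"
    then have "delta T = (\<lambda>S. (\<Sum>T'\<in>?X. (if T' = T then 1 else 0) * delta T' S) + 0)"
      using finite_symplectic[OF lam] by (simp add: if_distrib[of "\<lambda>x. x * _"] cong: if_cong)
    then show "delta T \<in> U" using UI[OF csubspace_zero[OF Ws], of "\<lambda>T'. if T' = T then 1 else 0"] by simp
  next
    fix w assume "w \<in> Wrel n lam"
    then show "w \<in> U" using UI[of w "\<lambda>_. 0"] by simp
  qed
  then have "tens n lam \<subseteq> U" using cspan_minimal[OF U] symplectic_spanning[OF lam] by blast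
  then show thesis using \<phi> that by (auto simp: U_def)
qed

lemma ev_symplectic_sum:
  assumes lam: "is_partition n lam"
  shows "ev n lam M (\<lambda>S. \<Sum>T\<in>{T. symplectic_tab n lam T}. c T * delta T S) = (\<Sum>T\<in>{T. symplectic_tab n lam T}. c T * Phi lam T M)"
  unfolding ev_sum ev_scale by (rule sum.cong[OF refl]) (simp add: ev_delta[OF lam] symplectic_tab_def)

text \<open>The witness is kept in the form of a member of the family, since
  \<open>hw_in_submodule\<close> has to move it to the standard frame by a group element.\<close>

lemma frame_detects_symplectic_sum:
  assumes lam: "is_partition n lam" and T: "symplectic_tab n lam T" "c T \<noteq> 0"
  obtains N e where "n < N" "2 \<le> N" "e \<noteq> 0"
    "(\<Sum>T\<in>{T. symplectic_tab n lam T}. c T * Phi lam T (degeneration.frame n N e)) \<noteq> 0"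
proof -
  define I where "I = Pair lam ` {T. symplectic_tab n lam T}"
  have "finite I" unfolding I_def using finite_symplectic[OF lam] by simp
  moreover have "\<And>mu S. (mu, S) \<in> I \<Longrightarrow> is_partition n mu \<and> symplectic_tab n mu S" using lam by (auto simp: I_def)
  ultimately obtain N where N: "n < N" "2 \<le> N"
    "\<And>c. (\<And>e. e \<noteq> 0 \<Longrightarrow> (\<Sum>(lam, T)\<in>I. c (lam, T) * Phi lam T (degeneration.frame n N e)) = 0) \<Longrightarrow> \<forall>x\<in>I. c x = 0"
    using symplectic_Phi_independent[of I n] by blast
  have eq: "(\<Sum>(mu, S)\<in>I. c S * Phi mu S M) = (\<Sum>T\<in>{T. symplectic_tab n lam T}. c T * Phi lam T M)" for M
    unfolding I_def by (subst sum.reindex) (auto simp: inj_on_def)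
  have "\<not> (\<forall>x\<in>I. c (snd x) = 0)" using T by (auto simp: I_def)
  then obtain e where "e \<noteq> 0" "(\<Sum>(mu, S)\<in>I. c S * Phi mu S (degeneration.frame n N e)) \<noteq> 0"
    using N(3)[of "\<lambda>x. c (snd x)"] by auto
  then show thesis using that N(1,2) eq by auto
qed

lemma symplectic_coeffs_zero:
  assumes lam: "is_partition n lam"
    and z: "\<And>M. good_matrix n M \<Longrightarrow> (\<Sum>T\<in>{T. symplectic_tab n lam T}. c T * Phi lam T M) = 0"
    and T: "symplectic_tab n lam T"
  shows "c T = 0"
proof (rule ccontr)
  assume "c T \<noteq> 0"
  then obtain N e where N: "n < N" "2 \<le> N" and e: "e \<noteq> 0"
    "(\<Sum>T\<in>{T. symplectic_tab n lam T}. c T * Phi lam T (degeneration.frame n N e)) \<noteq> 0"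
    using frame_detects_symplectic_sum[OF lam T] by blast
  interpret degeneration n N using N by unfold_locales
  show False using z[OF good_frame[OF e(1)]] e(2) by simp
qed

lemma symplectic_independent:
  assumes lam: "is_partition n lam"
    and c: "(\<lambda>S. \<Sum>T\<in>{T. symplectic_tab n lam T}. c T * delta T S) \<in> Wrel n lam" and T: "symplectic_tab n lam T"
  shows "c T = 0"
proof (rule symplectic_coeffs_zero[OF lam _ T])
  show "(\<Sum>T\<in>{T. symplectic_tab n lam T}. c T * Phi lam T M) = 0" if "good_matrix n M" for M
    using ev_Wrel_zero[OF lam that c] unfolding ev_symplectic_sum[OF lam] .
qed

text \<open>Reduce to a combination of symplectic tableaux modulo relations: evaluation kills the
  relations, and independence on frames kills the combination. Membership in
  \<open>Wrel n lam\<close> can from here on be tested on minors.\<close>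

lemma Wrel_eq_ker:
  assumes lam: "is_partition n lam" and \<phi>: "\<phi> \<in> tens n lam" and z: "\<And>M. good_matrix n M \<Longrightarrow> ev n lam M \<phi> = 0"
  shows "\<phi> \<in> Wrel n lam"
proof -
  obtain c w where w: "w \<in> Wrel n lam" "\<phi> = (\<lambda>S. (\<Sum>T\<in>{T. symplectic_tab n lam T}. c T * delta T S) + w S)"
    by (rule symplectic_decomposition[OF lam \<phi>])
  have "(\<Sum>T\<in>{T. symplectic_tab n lam T}. c T * Phi lam T M) = 0" if "good_matrix n M" for M
    using z[OF that] ev_Wrel_zero[OF lam that w(1)] unfolding w(2) ev_add ev_symplectic_sum[OF lam] by simp
  then have "c T = 0" if "symplectic_tab n lam T" for T using symplectic_coeffs_zero[OF lam] that by blast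
  then have "\<phi> = w" unfolding w(2) by simp
  then show ?thesis using w(1) by simp
qed

subsection \<open>The group action and irreducibility\<close>

lemma act_in_tens: "act n lam g \<phi> \<in> tens n lam"
  by (simp add: tens_def act_def)

lemma act_add: "act n lam g (\<lambda>x. u x + v x) = (\<lambda>x. act n lam g u x + act n lam g v x)"
  by (auto simp: act_def sum.distrib distrib_right)

lemma act_scale: "act n lam g (\<lambda>x. c * u x) = (\<lambda>x. c * act n lam g u x)"
  by (auto simp: act_def sum_distrib_left mult.assoc)

lemma act_sum: "act n lam g (\<lambda>x. \<Sum>i\<in>I. f i x) = (\<lambda>x. \<Sum>i\<in>I. act n lam g (f i) x)"
proof
  fix S show "act n lam g (\<lambda>x. \<Sum>i\<in>I. f i x) S = (\<Sum>i\<in>I. act n lam g (f i) S)"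
    by (cases "S \<in> fillings n lam") (simp_all add: act_def sum_distrib_right, rule sum.swap)
qed

lemma act_delta:
  assumes "is_partition n lam" "T \<in> fillings n lam"
  shows "act n lam g (delta T) S = (if S \<in> fillings n lam then \<Prod>b\<in>boxes lam. g (S b) (T b) else 0)"
  using assms finite_fillings[OF assms(1)]
  by (simp add: act_def delta_def if_distrib[of "\<lambda>x. x * _"] cong: if_cong)

lemma Phi_mult:
  assumes lam: "is_partition n lam"
  shows "Phi lam T (\<lambda>a q. \<Sum>c\<in>idxs n. g c a * M c q) = (\<Sum>S\<in>fillings n lam. (\<Prod>b\<in>boxes lam. g (S b) (T b)) * Phi lam S M)"
proof -
  define SS where "SS = (\<Pi>\<^sub>E j\<in>{1..ncols lam}. {\<sigma>. \<sigma> permutes {1..collen lam j}})"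
  define s :: "(nat \<Rightarrow> nat \<Rightarrow> nat) \<Rightarrow> complex" where "s \<sigma> = (\<Prod>j=1..ncols lam. of_int (sign (\<sigma> j)))" for \<sigma>
  define X where "X S = (\<Prod>b\<in>boxes lam. g (S b) (T b))" for S
  have "Phi lam T (\<lambda>a q. \<Sum>c\<in>idxs n. g c a * M c q)
     = (\<Sum>\<sigma>\<in>SS. s \<sigma> * (\<Prod>b\<in>boxes lam. \<Sum>c\<in>idxs n. g c (T b) * M c (\<sigma> (snd b) (fst b))))"
    unfolding Phi_expand[OF lam] SS_def s_def ..
  also have "\<dots> = (\<Sum>\<sigma>\<in>SS. \<Sum>S\<in>fillings n lam. X S * (s \<sigma> * (\<Prod>b\<in>boxes lam. M (S b) (\<sigma> (snd b) (fst b)))))"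
    unfolding prod_sum_fillings[OF lam] X_def
    by (intro sum.cong refl) (simp add: sum_distrib_left prod.distrib mult_ac)
  also have "\<dots> = (\<Sum>S\<in>fillings n lam. \<Sum>\<sigma>\<in>SS. X S * (s \<sigma> * (\<Prod>b\<in>boxes lam. M (S b) (\<sigma> (snd b) (fst b)))))"
    by (rule sum.swap)
  also have "\<dots> = (\<Sum>S\<in>fillings n lam. X S * Phi lam S M)"
    unfolding Phi_expand[OF lam] SS_def s_def sum_distrib_left ..
  finally show ?thesis by (simp add: X_def)
qed

text \<open>Tableaux serve as functions on frames, so \<open>g\<close> acts on the argument through
  its transpose.\<close>

lemma ev_act:
  assumes lam: "is_partition n lam"
  shows "ev n lam M (act n lam g \<phi>) = ev n lam (\<lambda>a q. \<Sum>c\<in>idxs n. g c a * M c q) \<phi>"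
proof -
  have "ev n lam M (act n lam g \<phi>) = (\<Sum>S\<in>fillings n lam. \<Sum>T\<in>fillings n lam. \<phi> T * ((\<Prod>b\<in>boxes lam. g (S b) (T b)) * Phi lam S M))"
    unfolding ev_def by (rule sum.cong[OF refl]) (simp add: act_def sum_distrib_right mult.assoc)
  also have "\<dots> = (\<Sum>T\<in>fillings n lam. \<Sum>S\<in>fillings n lam. \<phi> T * ((\<Prod>b\<in>boxes lam. g (S b) (T b)) * Phi lam S M))"
    by (rule sum.swap)
  finally show ?thesis unfolding ev_def Phi_mult[OF lam] sum_distrib_left .
qed

lemma csubspace_Wrel: "csubspace (Wrel n lam)"
  unfolding Wrel_def by (rule csubspace_cspan)

text \<open>The kernel of evaluation is invariant because the transpose of \<open>g\<close> carries
  isotropic frames to isotropic frames.\<close>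

lemma Wrel_invariant:
  assumes lam: "is_partition n lam" and g: "g \<in> Sp n" and \<phi>: "\<phi> \<in> Wrel n lam"
  shows "act n lam g \<phi> \<in> Wrel n lam"
proof (rule Wrel_eq_ker[OF lam act_in_tens])
  fix M assume "good_matrix n M"
  then have "good_matrix n (\<lambda>a q. \<Sum>c\<in>idxs n. g c a * M c q)"
    using good_matrix_Sp_mult[OF Sp_transpose[OF g]] by simp
  then show "ev n lam M (act n lam g \<phi>) = 0" unfolding ev_act[OF lam] by (rule ev_Wrel_zero[OF lam _ \<phi>])
qed

section \<open>The highest weight tableau and torus elements\<close>

definition hw_tab :: "nat list \<Rightarrow> nat \<times> nat \<Rightarrow> ix" where
  "hw_tab lam = (\<lambda>b. if b \<in> boxes lam then P (fst b) else P 0)"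

lemma hw_tab_filling: "is_partition n lam \<Longrightarrow> hw_tab lam \<in> fillings n lam"
  by (auto simp: fillings_def hw_tab_def boxes_eq_Sigma_rows)

lemma detp_std: "detp k (\<lambda>i. std_frame (P i)) = 1"
proof -
  have "detp k (\<lambda>i. std_frame (P i)) = (\<Sum>\<sigma>\<in>{\<sigma>. \<sigma> permutes {1..k}}. if \<sigma> = id then 1 else 0)"
    unfolding detp_def
  proof (rule sum.cong[OF refl])
    fix \<sigma> assume s: "\<sigma> \<in> {\<sigma>. \<sigma> permutes {1..k}}"
    show "of_int (sign \<sigma>) * (\<Prod>i=1..k. std_frame (P i) (\<sigma> i)) = (if \<sigma> = id then 1 else 0)"
    proof (cases "\<sigma> = id")
      case True then show ?thesis by (simp add: std_frame_def sign_id)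
    next
      case False
      then obtain i where i: "\<sigma> i \<noteq> i" by (auto simp: fun_eq_iff)
      then have "i \<in> {1..k}" using s permutes_not_in[of \<sigma> "{1..k}" i] by blast
      then have "(\<Prod>i=1..k. std_frame (P i) (\<sigma> i)) = 0" using i by (intro prod_zero) (auto simp: std_frame_def intro!: bexI[of _ i])
      then show ?thesis using False by simp
    qed
  qed
  also have "\<dots> = 1" using permutes_id[of "{1..k}"] finite_permutations[of "{1..k}"] by simp
  finally show ?thesis .
qed

lemma Phi_hw_tab:
  assumes lam: "is_partition n lam"
  shows "Phi lam (hw_tab lam) std_frame = 1"
proof -
  have "detp (collen lam j) (\<lambda>i. std_frame (hw_tab lam (i, j))) = detp (collen lam j) (\<lambda>i. std_frame (P i))"
    if "j \<in> {1..ncols lam}" for j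
    using that by (intro detp_cong) (simp add: hw_tab_def mem_boxes_iff[OF lam])
  then show ?thesis unfolding Phi_def plueck_column by (simp add: detp_std)
qed

lemma permutes_ge_imp_id:
  assumes \<sigma>: "\<sigma> permutes {1..k::nat}" and ge: "\<And>i. i \<in> {1..k} \<Longrightarrow> i \<le> \<sigma> i" and i: "i \<in> {1..k}"
  shows "\<sigma> i = i"
proof (rule ccontr)
  assume "\<sigma> i \<noteq> i"
  then have "i < \<sigma> i" using ge[OF i] by simp
  then have "(\<Sum>j=1..k. j) < (\<Sum>j=1..k. \<sigma> j)" using ge i by (intro sum_strict_mono_ex1) auto
  moreover have "(\<Sum>j=1..k. \<sigma> j) = (\<Sum>j=1..k. j)" using sum.permute[OF \<sigma>, of "\<lambda>j. j"] by (simp add: o_def)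
  ultimately show False by simp
qed

text \<open>A nonzero minor of the standard frame makes each column a permutation of
  \<open>P 1\<close>, \<open>P 2\<close> and so on. The symplectic condition puts an index of at
  least \<open>i\<close> into row \<open>i\<close>, and the only such permutation is the
  identity.\<close>

lemma Phi_std_frame_nonzero:
  assumes lam: "is_partition n lam" and T: "symplectic_tab n lam T" and nz: "Phi lam T std_frame \<noteq> 0"
  shows "T = hw_tab lam"
proof
  fix b :: "nat \<times> nat"
  obtain i j where b: "b = (i, j)" by (cases b)
  show "T b = hw_tab lam b"
  proof (cases "b \<in> boxes lam")
    case True
    then have j: "j \<in> {1..ncols lam}" "i \<in> {1..collen lam j}" by (auto simp: b mem_boxes_iff[OF lam])
    have "detp (collen lam j) (\<lambda>i. std_frame (T (i, j))) \<noteq> 0"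
      using nz j(1) unfolding Phi_def plueck_column by (simp add: prod_zero_iff)
    then obtain \<sigma> where \<sigma>: "\<sigma> permutes {1..collen lam j}" "(\<Prod>i=1..collen lam j. std_frame (T (i, j)) (\<sigma> i)) \<noteq> 0"
      unfolding detp_def by (metis (no_types, lifting) mem_Collect_eq mult_zero_right sum.neutral)
    have T\<sigma>: "T (i, j) = P (\<sigma> i)" if "i \<in> {1..collen lam j}" for i
      using \<sigma>(2) that by (auto simp: prod_zero_iff std_frame_def split: if_splits)
    have "i \<le> \<sigma> i" if i: "i \<in> {1..collen lam j}" for i
    proof -
      have "(i, j) \<in> boxes lam" using i j(1) by (auto simp: mem_boxes_iff[OF lam])
      then have "2 * i \<le> ixkey (T (i, j))" using T by (auto simp: symplectic_tab_def)
      then show ?thesis using T\<sigma>[OF i] by simp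
    qed
    then have "\<sigma> i = i" using permutes_ge_imp_id[OF \<sigma>(1) _ j(2)] by blast
    then show ?thesis using T\<sigma>[OF j(2)] True by (simp add: b hw_tab_def)
  next
    case False
    moreover have "T \<in> fillings n lam" using T by (simp add: symplectic_tab_def)
    ultimately show ?thesis using filling_outside[of T n lam b] by (simp add: hw_tab_def)
  qed
qed

lemma hw_notin_Wrel:
  assumes lam: "is_partition n lam"
  shows "delta (hw_tab lam) \<notin> Wrel n lam"
  using ev_Wrel_zero[OF lam good_std_frame, of "delta (hw_tab lam)"]
  by (auto simp: ev_delta[OF lam hw_tab_filling[OF lam]] Phi_hw_tab[OF lam])

text \<open>The torus element with \<open>x_k = 2\<close> and all other coordinates 1. Its entries
  are real so that the resulting scalars can be compared by \<open><\<close>.\<close>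

definition torus_wt :: "nat \<Rightarrow> ix \<Rightarrow> real" where
  "torus_wt k a = (if a = P k then 2 else if a = Q k then 1/2 else 1)"

definition torus_elt :: "nat \<Rightarrow> nat \<Rightarrow> ix \<Rightarrow> ix \<Rightarrow> complex" where
  "torus_elt n k a b = (if a = b \<and> a \<in> idxs n then of_real (torus_wt k a) else 0)"

lemma torus_elt_Sp: "torus_elt n k \<in> Sp n"
  unfolding Sp_iff
proof (intro conjI ballI)
  fix b c assume bc: "b \<in> idxs n" "c \<in> idxs n"
  have "fform n (\<lambda>a. torus_elt n k a b) (\<lambda>a. torus_elt n k a c)
      = (\<Sum>a\<in>idxs n. if a = b then sg b * of_real (torus_wt k b) * torus_elt n k (bar b) c else 0)"
    unfolding fform_eq_sum by (rule sum.cong) (auto simp: torus_elt_def)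
  also have "\<dots> = sg b * of_real (torus_wt k b) * torus_elt n k (bar b) c" using finite_idxs bc by simp
  also have "\<dots> = JJ b c" using bc by (cases b) (auto simp: JJ_def torus_elt_def torus_wt_def)
  finally show "fform n (\<lambda>a. torus_elt n k a b) (\<lambda>a. torus_elt n k a c) = JJ b c" .
qed (auto simp: torus_elt_def)

lemma act_torus_delta:
  assumes lam: "is_partition n lam" and T: "T \<in> fillings n lam"
  shows "act n lam (torus_elt n k) (delta T) S = of_real (\<Prod>b\<in>boxes lam. torus_wt k (T b)) * delta T S"
proof (cases "S = T")
  case True
  then show ?thesis using T fillings_entry[OF T] unfolding act_delta[OF lam T] by (simp add: torus_elt_def delta_def)
next
  case False
  have "(\<Prod>b\<in>boxes lam. torus_elt n k (S b) (T b)) = 0" if S: "S \<in> fillings n lam"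
  proof -
    obtain b where "S b \<noteq> T b" using False by blast
    moreover have "b \<in> boxes lam" using \<open>S b \<noteq> T b\<close> filling_outside[OF S, of b] filling_outside[OF T, of b] by metis
    ultimately show ?thesis using finite_boxes[OF lam] by (intro prod_zero) (auto simp: torus_elt_def intro!: bexI[of _ b])
  qed
  then show ?thesis using False unfolding act_delta[OF lam T] by (simp add: delta_def)
qed

text \<open>Take for \<open>k\<close> the first row in which \<open>T\<close> differs from the
  highest weight tableau. Earlier rows agree. Later rows have keys too large for \<open>P k\<close>
  and \<open>Q k\<close>, so their weight is 1. In row \<open>k\<close> the highest weight tableau
  has the maximal weight 2 in every box, and \<open>T\<close> falls short of it somewhere.\<close>

lemma torus_separates:
  assumes lam: "is_partition n lam" and T: "symplectic_tab n lam T" and ne: "T \<noteq> hw_tab lam"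
  shows "\<exists>k. (\<Prod>b\<in>boxes lam. torus_wt k (T b)) < (\<Prod>b\<in>boxes lam. torus_wt k (hw_tab lam b))"
proof -
  have TF: "T \<in> fillings n lam" using T by (simp add: symplectic_tab_def)
  define bad where "bad k \<longleftrightarrow> (\<exists>j. (k, j) \<in> boxes lam \<and> T (k, j) \<noteq> P k)" for k
  have "\<exists>k. bad k"
  proof -
    obtain b where b: "T b \<noteq> hw_tab lam b" using ne by blast
    have "b \<in> boxes lam"
    proof (rule ccontr)
      assume "b \<notin> boxes lam"
      then show False using b filling_outside[OF TF, of b] by (simp add: hw_tab_def)
    qed
    then show ?thesis using b unfolding bad_def hw_tab_def by (cases b) auto
  qed
  then obtain k where k: "bad k" "\<And>k'. k' < k \<Longrightarrow> \<not> bad k'" using exists_least_iff[of bad] by blast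
  then obtain j0 where j0: "(k, j0) \<in> boxes lam" "T (k, j0) \<noteq> P k" by (auto simp: bad_def)
  have pos: "0 < torus_wt k a" for a by (simp add: torus_wt_def)
  have le: "torus_wt k (T b) \<le> torus_wt k (hw_tab lam b)" if "b \<in> boxes lam" for b
  proof -
    obtain i j where b: "b = (i, j)" by (cases b)
    consider "i < k" | "i = k" | "k < i" by linarith
    then show ?thesis
    proof cases
      case 1
      then have "T b = P i" using k(2)[of i] that by (auto simp: bad_def b)
      then show ?thesis using that by (simp add: b hw_tab_def)
    next
      case 2 then show ?thesis using that by (simp add: b hw_tab_def torus_wt_def)
    next
      case 3
      have "2 * i \<le> ixkey (T b)" using T that by (auto simp: symplectic_tab_def b)
      then have "T b \<noteq> P k" "T b \<noteq> Q k" using 3 by auto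
      then show ?thesis using that 3 by (simp add: b hw_tab_def torus_wt_def)
    qed
  qed
  have fin: "finite (boxes lam)" by (rule finite_boxes[OF lam])
  have "(\<Prod>b\<in>boxes lam - {(k, j0)}. torus_wt k (T b)) \<le> (\<Prod>b\<in>boxes lam - {(k, j0)}. torus_wt k (hw_tab lam b))"
    using le pos by (intro prod_mono) (auto simp: less_imp_le)
  moreover have "0 < (\<Prod>b\<in>boxes lam - {(k, j0)}. torus_wt k (T b))" using pos by (intro prod_pos) auto
  moreover have "torus_wt k (T (k, j0)) < torus_wt k (hw_tab lam (k, j0))" using j0 by (auto simp: hw_tab_def torus_wt_def)
  ultimately have "torus_wt k (T (k, j0)) * (\<Prod>b\<in>boxes lam - {(k, j0)}. torus_wt k (T b))
     < torus_wt k (hw_tab lam (k, j0)) * (\<Prod>b\<in>boxes lam - {(k, j0)}. torus_wt k (hw_tab lam b))"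
    using pos by (intro mult_less_le_imp_less) (auto simp: less_imp_le)
  then show ?thesis unfolding prod.remove[OF fin j0(1)] by blast
qed

text \<open>Every other symplectic tableau is eliminated by a torus element acting on it and on the highest weight
  tableau by different scalars.\<close>
lemma hw_from_symplectic_sum:
  assumes lam: "is_partition n lam" and U: "csubspace U" and inv: "\<And>g \<phi>. g \<in> Sp n \<Longrightarrow> \<phi> \<in> U \<Longrightarrow> act n lam g \<phi> \<in> U"
    and F: "finite F" "\<And>T. T \<in> F \<Longrightarrow> symplectic_tab n lam T"
  shows "c (hw_tab lam) \<noteq> 0 \<Longrightarrow> hw_tab lam \<notin> F \<Longrightarrow> (\<lambda>S. \<Sum>T\<in>insert (hw_tab lam) F. c T * delta T S) \<in> U \<Longrightarrow> delta (hw_tab lam) \<in> U"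
  using F
proof (induction F arbitrary: c rule: finite_induct)
  case empty
  have "(\<lambda>S. inverse (c (hw_tab lam)) * (\<Sum>T\<in>insert (hw_tab lam) {}. c T * delta T S)) \<in> U"
    by (rule csubspace_scale[OF U empty(3)])
  moreover have "(\<lambda>S. inverse (c (hw_tab lam)) * (\<Sum>T\<in>insert (hw_tab lam) {}. c T * delta T S)) = delta (hw_tab lam)"
    using empty(1) by (simp add: fun_eq_iff mult.assoc[symmetric])
  ultimately show ?case by simp
next
  case (insert T1 F)
  let ?H = "hw_tab lam"
  define I where "I = insert ?H (insert T1 F)"
  define u where "u = (\<lambda>S. \<Sum>T\<in>I. c T * delta T S)"
  have u: "u \<in> U" using insert.prems(3) by (simp only: u_def I_def)
  have T1: "symplectic_tab n lam T1" "T1 \<noteq> ?H" using insert.prems by auto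
  obtain k where k: "(\<Prod>b\<in>boxes lam. torus_wt k (T1 b)) < (\<Prod>b\<in>boxes lam. torus_wt k (?H b))"
    using torus_separates[OF lam T1] by blast
  define \<chi> where "\<chi> T = complex_of_real (\<Prod>b\<in>boxes lam. torus_wt k (T b))" for T
  have IF: "T \<in> fillings n lam" if "T \<in> I" for T
    using that insert.prems(4) hw_tab_filling[OF lam] by (auto simp: I_def symplectic_tab_def)
  have au: "act n lam (torus_elt n k) u = (\<lambda>S. \<Sum>T\<in>I. c T * (\<chi> T * delta T S))"
    unfolding u_def act_sum act_scale
  proof
    fix S show "(\<Sum>T\<in>I. c T * act n lam (torus_elt n k) (delta T) S) = (\<Sum>T\<in>I. c T * (\<chi> T * delta T S))"
      by (rule sum.cong[OF refl]) (simp only: act_torus_delta[OF lam IF] \<chi>_def)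
  qed
  \<comment> \<open>This combination removes the term of \<open>T1\<close> and multiplies every
    other coefficient by the difference of the two scalars.\<close>
  have "(\<lambda>S. act n lam (torus_elt n k) u S - \<chi> T1 * u S) \<in> U"
    by (intro csubspace_diff[OF U] csubspace_scale[OF U] u inv[OF torus_elt_Sp])
  also have "(\<lambda>S. act n lam (torus_elt n k) u S - \<chi> T1 * u S) = (\<lambda>S. \<Sum>T\<in>I. c T * (\<chi> T - \<chi> T1) * delta T S)"
  proof
    fix S
    have "u S = (\<Sum>T\<in>I. c T * delta T S)" by (simp add: u_def)
    then show "act n lam (torus_elt n k) u S - \<chi> T1 * u S = (\<Sum>T\<in>I. c T * (\<chi> T - \<chi> T1) * delta T S)"
      unfolding au by (simp add: sum_distrib_left sum_subtractf[symmetric] algebra_simps)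
  qed
  also have "\<dots> = (\<lambda>S. \<Sum>T\<in>insert ?H F. c T * (\<chi> T - \<chi> T1) * delta T S)"
  proof
    fix S
    show "(\<Sum>T\<in>I. c T * (\<chi> T - \<chi> T1) * delta T S) = (\<Sum>T\<in>insert ?H F. c T * (\<chi> T - \<chi> T1) * delta T S)"
      using insert.hyps(1) by (intro sum.mono_neutral_right) (auto simp: I_def)
  qed
  finally have "(\<lambda>S. \<Sum>T\<in>insert ?H F. c T * (\<chi> T - \<chi> T1) * delta T S) \<in> U" .
  moreover have "\<chi> ?H \<noteq> \<chi> T1" unfolding \<chi>_def of_real_eq_iff using k by simp
  then have "c ?H * (\<chi> ?H - \<chi> T1) \<noteq> 0" using insert.prems(1) by simp
  ultimately show ?case using insert.IH[of "\<lambda>T. c T * (\<chi> T - \<chi> T1)"] insert.prems by blast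
qed

lemma hw_in_submodule:
  assumes lam: "is_partition n lam" and U: "csubspace U" and inv: "\<And>g \<phi>. g \<in> Sp n \<Longrightarrow> \<phi> \<in> U \<Longrightarrow> act n lam g \<phi> \<in> U"
    and sub: "Wrel n lam \<subseteq> U" "U \<subseteq> tens n lam" and ne: "U \<noteq> Wrel n lam"
  shows "delta (hw_tab lam) \<in> U"
proof -
  let ?X = "{T. symplectic_tab n lam T}"
  obtain \<phi> where \<phi>: "\<phi> \<in> U" "\<phi> \<notin> Wrel n lam" using sub(1) ne by blast
  then obtain c w where w: "w \<in> Wrel n lam" "\<phi> = (\<lambda>S. (\<Sum>T\<in>?X. c T * delta T S) + w S)"
    using symplectic_decomposition[OF lam, of \<phi>] sub(2) by blast
  have "\<exists>T. symplectic_tab n lam T \<and> c T \<noteq> 0"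
  proof (rule ccontr)
    assume "\<not> ?thesis"
    then have "\<phi> = w" unfolding w(2) by simp
    then show False using w(1) \<phi>(2) by simp
  qed
  then obtain T where T: "symplectic_tab n lam T" "c T \<noteq> 0" by blast
  obtain N e where N: "n < N" "2 \<le> N" and e: "e \<noteq> 0" "(\<Sum>T\<in>?X. c T * Phi lam T (degeneration.frame n N e)) \<noteq> 0"
    using frame_detects_symplectic_sum[of n lam T c] lam T by blast
  interpret degeneration n N using N by unfold_locales
  have ev\<phi>: "ev n lam (frame e) \<phi> \<noteq> 0"
    using e(2) unfolding w(2) ev_add ev_symplectic_sum[OF lam] ev_Wrel_zero[OF lam good_frame[OF e(1)] w(1)] by simp
  obtain g where g: "g \<in> Sp n" "\<And>a q. a \<in> idxs n \<Longrightarrow> q \<in> {1..n} \<Longrightarrow> g a (P q) = frame e a q"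
    using frame_in_Sp[OF e(1)] by blast
  \<comment> \<open>By \<open>ev_act\<close> the transpose of \<open>g\<close> makes the value of
    \<psi> at the standard frame equal to the value of \<phi> at the frame that detects it.\<close>
  define \<psi> where "\<psi> = act n lam (\<lambda>a b. g b a) \<phi>"
  have \<psi>U: "\<psi> \<in> U" unfolding \<psi>_def by (rule inv[OF Sp_transpose[OF g(1)] \<phi>(1)])
  have "ev n lam std_frame \<psi> = ev n lam (frame e) \<phi>"
    unfolding \<psi>_def ev_act[OF lam] by (rule ev_cong[OF lam]) (simp only: std_frame_mult g(2))
  then have \<psi>0: "ev n lam std_frame \<psi> \<noteq> 0" using ev\<phi> by simp
  have "\<psi> \<in> tens n lam" unfolding \<psi>_def by (rule act_in_tens)
  then obtain d z where z: "z \<in> Wrel n lam" "\<psi> = (\<lambda>S. (\<Sum>T\<in>?X. d T * delta T S) + z S)"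
    by (rule symplectic_decomposition[OF lam])
  have dU: "(\<lambda>S. \<Sum>T\<in>?X. d T * delta T S) \<in> U"
    using csubspace_diff[OF U \<psi>U, of z] z(1) sub(1) unfolding z(2) by auto
  have "(\<Sum>T\<in>?X. d T * Phi lam T std_frame) \<noteq> 0"
    using \<psi>0 unfolding z(2) ev_add ev_symplectic_sum[OF lam] ev_Wrel_zero[OF lam good_std_frame z(1)] by simp
  then obtain T' where T': "symplectic_tab n lam T'" "d T' * Phi lam T' std_frame \<noteq> 0"
    by (metis (mono_tags, lifting) mem_Collect_eq sum.neutral)
  then have T'H: "T' = hw_tab lam" using Phi_std_frame_nonzero[OF lam T'(1)] by simp
  then have XI: "insert (hw_tab lam) (?X - {hw_tab lam}) = ?X" using T'(1) by auto
  show ?thesis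
  proof (rule hw_from_symplectic_sum[OF lam U inv, of "?X - {hw_tab lam}" d])
    show "d (hw_tab lam) \<noteq> 0" using T'(2) T'H by auto
    show "(\<lambda>S. \<Sum>T\<in>insert (hw_tab lam) (?X - {hw_tab lam}). d T * delta T S) \<in> U" unfolding XI by (rule dU)
  qed (use finite_symplectic[OF lam] in auto)
qed

section \<open>Invariant complements and irreducibility\<close>

lemma act_adjoint:
  "(\<Sum>S\<in>fillings n lam. act n lam g v S * cnj (u S))
    = (\<Sum>T\<in>fillings n lam. v T * cnj (act n lam (\<lambda>a b. cnj (g b a)) u T))"
proof -
  have "(\<Sum>S\<in>fillings n lam. act n lam g v S * cnj (u S))
     = (\<Sum>S\<in>fillings n lam. \<Sum>T\<in>fillings n lam. v T * (\<Prod>b\<in>boxes lam. g (S b) (T b)) * cnj (u S))"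
    by (rule sum.cong[OF refl]) (simp add: act_def sum_distrib_right)
  also have "\<dots> = (\<Sum>T\<in>fillings n lam. \<Sum>S\<in>fillings n lam. v T * (\<Prod>b\<in>boxes lam. g (S b) (T b)) * cnj (u S))"
    by (rule sum.swap)
  also have "\<dots> = (\<Sum>T\<in>fillings n lam. v T * cnj (act n lam (\<lambda>a b. cnj (g b a)) u T))"
    by (intro sum.cong refl) (simp add: act_def sum_distrib_left mult_ac)
  finally show ?thesis .
qed

text \<open>A proper submodule \<open>U\<close> containing the highest weight tableau is excluded by the unitary trick:
  the orthogonal complement of \<open>U\<close> is again invariant, so modulo \<open>Wrel\<close> it would contain that tableau too.\<close>
lemma submodule_trivial:
  assumes lam: "is_partition n lam" and U: "csubspace U" and inv: "\<And>g \<phi>. g \<in> Sp n \<Longrightarrow> \<phi> \<in> U \<Longrightarrow> act n lam g \<phi> \<in> U"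
    and sub: "Wrel n lam \<subseteq> U" "U \<subseteq> tens n lam"
  shows "U = Wrel n lam \<or> U = tens n lam"
proof (rule ccontr)
  assume "\<not> ?thesis"
  then have ne: "U \<noteq> Wrel n lam" "U \<noteq> tens n lam" by auto
  have hwU: "delta (hw_tab lam) \<in> U" by (rule hw_in_submodule[OF lam U inv sub ne(1)])
  define H where "H = {v \<in> tens n lam. \<forall>u\<in>U. (\<Sum>T\<in>fillings n lam. v T * cnj (u T)) = 0}"
  have HU: "v = (\<lambda>S. 0)" if "v \<in> H" "v \<in> U" for v
  proof
    fix S
    have "(\<Sum>T\<in>fillings n lam. v T * cnj (v T)) = 0" using that by (auto simp: H_def)
    moreover have "complex_of_real (\<Sum>T\<in>fillings n lam. (cmod (v T))\<^sup>2) = (\<Sum>T\<in>fillings n lam. v T * cnj (v T))"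
      by (simp only: of_real_sum complex_norm_square)
    ultimately have "complex_of_real (\<Sum>T\<in>fillings n lam. (cmod (v T))\<^sup>2) = 0" by simp
    then have "(\<Sum>T\<in>fillings n lam. (cmod (v T))\<^sup>2) = 0" by (simp only: of_real_eq_0_iff)
    then have "\<forall>T\<in>fillings n lam. v T = 0" using finite_fillings[OF lam] by (simp add: sum_nonneg_eq_0_iff)
    then show "v S = 0" using that(1) by (auto simp: H_def tens_def)
  qed
  have Hs: "csubspace H"
    unfolding csubspace_def H_def using csubspace_tens[of n lam]
    by (auto simp: csubspace_def distrib_right sum.distrib mult.assoc sum_distrib_left[symmetric])
  have Hinv: "act n lam g v \<in> H" if g: "g \<in> Sp n" and v: "v \<in> H" for g v
  proof -
    have gs: "(\<lambda>a b. cnj (g b a)) \<in> Sp n" using Sp_conj[OF Sp_transpose[OF g]] .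
    show ?thesis using v inv[OF gs] by (auto simp: H_def act_in_tens act_adjoint)
  qed
  define U' where "U' = {(\<lambda>x. v x + w x) | v w. v \<in> H \<and> w \<in> Wrel n lam}"
  have U'I: "(\<lambda>x. v x + w x) \<in> U'" if "v \<in> H" "w \<in> Wrel n lam" for v w using that by (auto simp: U'_def)
  have Ws: "csubspace (Wrel n lam)" by (rule csubspace_Wrel)
  have U's: "csubspace U'"
    unfolding csubspace_def
  proof (intro conjI ballI allI)
    show "(\<lambda>x. 0) \<in> U'" using U'I[OF csubspace_zero[OF Hs] csubspace_zero[OF Ws]] by simp
    fix u assume "u \<in> U'"
    then obtain v w where u: "u = (\<lambda>x. v x + w x)" "v \<in> H" "w \<in> Wrel n lam" by (auto simp: U'_def)
    show "(\<lambda>x. a * u x) \<in> U'" for a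
      using U'I[OF csubspace_scale[OF Hs u(2), of a] csubspace_scale[OF Ws u(3), of a]] by (simp add: u(1) distrib_left)
    fix u' assume "u' \<in> U'"
    then obtain v' w' where u': "u' = (\<lambda>x. v' x + w' x)" "v' \<in> H" "w' \<in> Wrel n lam" by (auto simp: U'_def)
    show "(\<lambda>x. u x + u' x) \<in> U'"
      using U'I[OF csubspace_add[OF Hs u(2) u'(2)] csubspace_add[OF Ws u(3) u'(3)]] by (simp add: u(1) u'(1) add_ac)
  qed
  have U'inv: "act n lam g \<phi> \<in> U'" if g: "g \<in> Sp n" and \<phi>: "\<phi> \<in> U'" for g \<phi>
  proof -
    obtain v w where v: "\<phi> = (\<lambda>x. v x + w x)" "v \<in> H" "w \<in> Wrel n lam" using \<phi> by (auto simp: U'_def)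
    show ?thesis unfolding v(1) act_add by (rule U'I[OF Hinv[OF g v(2)] Wrel_invariant[OF lam g v(3)]])
  qed
  have WU': "Wrel n lam \<subseteq> U'" using U'I[OF csubspace_zero[OF Hs]] by auto
  have U't: "U' \<subseteq> tens n lam"
    using Wrel_subset_tens[OF lam] by (auto simp: U'_def H_def intro!: csubspace_add[OF csubspace_tens])
  have "\<exists>y. y \<in> H \<and> y \<notin> Wrel n lam"
  proof -
    obtain x where x: "x \<in> tens n lam" "x \<notin> U" using sub(2) ne(2) by blast
    obtain h where h: "\<And>u. u \<in> U \<Longrightarrow> (\<Sum>T\<in>fillings n lam. u T * h T) = 0" "(\<Sum>T\<in>fillings n lam. x T * h T) = 1"
      using separating_functional[OF U x(2) finite_fillings[OF lam]] sub(2) x(1) by (auto simp: tens_def)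
    \<comment> \<open>Conjugation turns a functional vanishing on \<open>U\<close> into a vector
      orthogonal to \<open>U\<close>. It is nonzero since the functional is 1 at \<open>x\<close>,
      so it cannot lie in \<open>U\<close>, nor in \<open>Wrel n lam\<close>.\<close>
    define y where "y T = (if T \<in> fillings n lam then cnj (h T) else 0)" for T
    have "(\<Sum>T\<in>fillings n lam. y T * cnj (u T)) = 0" if "u \<in> U" for u
    proof -
      have "(\<Sum>T\<in>fillings n lam. y T * cnj (u T)) = cnj (\<Sum>T\<in>fillings n lam. u T * h T)"
        unfolding cnj_sum by (rule sum.cong) (auto simp: y_def)
      then show ?thesis using h(1)[OF that] by simp
    qed
    then have yH: "y \<in> H" by (auto simp: H_def tens_def y_def)
    have "y \<notin> Wrel n lam"
    proof
      assume "y \<in> Wrel n lam"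
      then have "y = (\<lambda>S. 0)" using HU[OF yH] sub(1) by blast
      then have "y T = 0" for T by simp
      then have "h T = 0" if "T \<in> fillings n lam" for T using that by (metis y_def complex_cnj_zero_iff)
      then show False using h(2) by simp
    qed
    then show ?thesis using yH by blast
  qed
  then have "U' \<noteq> Wrel n lam" using U'I[OF _ csubspace_zero[OF Ws]] by fastforce
  then have "delta (hw_tab lam) \<in> U'" using hw_in_submodule[OF lam U's _ WU' U't] U'inv by simp
  then obtain v w where vw: "delta (hw_tab lam) = (\<lambda>x. v x + w x)" "v \<in> H" "w \<in> Wrel n lam" by (auto simp: U'_def)
  have "(\<lambda>x. delta (hw_tab lam) x - w x) \<in> U" using csubspace_diff[OF U hwU] vw(3) sub(1) by blast
  then have "v \<in> U" unfolding vw(1) by simp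
  then have "v = (\<lambda>S. 0)" by (rule HU[OF vw(2)])
  then have "delta (hw_tab lam) = w" using vw(1) by simp
  then show False using vw(3) hw_notin_Wrel[OF lam] by simp
qed

section \<open>The highest weight vector and the Borel subgroup\<close>

lemma delta_repeated_Wrel:
  assumes "T \<in> fillings n lam" "b \<in> boxes lam" "b' \<in> boxes lam" "b \<noteq> b'" "snd b = snd b'" "T b = T b'"
  shows "delta T \<in> Wrel n lam"
proof -
  have "(\<lambda>S. delta T S + delta (T(b := T b', b' := T b)) S) \<in> Wrel n lam"
    unfolding Wrel_def by (rule cspan_base) (use assms in \<open>unfold alt_rels_def, blast\<close>)
  moreover have "T(b := T b', b' := T b) = T" using assms(6) by auto
  ultimately have "(\<lambda>S. delta T S + delta T S) \<in> Wrel n lam" by simp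
  then have "(\<lambda>S. (1/2) * (delta T S + delta T S)) \<in> Wrel n lam" by (rule csubspace_scale[OF csubspace_Wrel])
  then show ?thesis by simp
qed

text \<open>An element of the Borel subgroup turns the entry \<open>P i\<close> into a combination
  of \<open>P m\<close> with \<open>m \<le> i\<close>. If such entries are distinct in each column,
  induction on the row shows that row \<open>i\<close> still holds \<open>P i\<close>. Every other
  tableau that occurs has a repeated entry in a column and is a relation.\<close>

lemma hw_Borel:
  assumes lam: "is_partition n lam" and g: "g \<in> Borel n"
  shows "(\<lambda>S. act n lam g (delta (hw_tab lam)) S - bchar lam g * delta (hw_tab lam) S) \<in> Wrel n lam"
proof -
  let ?H = "hw_tab lam"
  define co where "co S = (\<Prod>b\<in>boxes lam. g (S b) (?H b))" for S
  have HF: "?H \<in> fillings n lam" by (rule hw_tab_filling[OF lam])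
  have coH: "co ?H = bchar lam g"
  proof -
    have "co ?H = (\<Prod>b\<in>boxes lam. g (P (fst b)) (P (fst b)))"
      unfolding co_def by (rule prod.cong) (auto simp: hw_tab_def)
    also have "\<dots> = (\<Prod>i=1..n. \<Prod>j=1..lam ! (i - 1). g (P i) (P i))"
      unfolding boxes_eq_Sigma_rows[OF lam] by (subst prod.Sigma) (auto simp: case_prod_unfold)
    also have "\<dots> = bchar lam g" using lam by (simp add: bchar_def is_partition_def)
    finally show ?thesis .
  qed
  have act: "act n lam g (delta ?H) R = (\<Sum>S\<in>fillings n lam. co S * delta S R)" for R
    unfolding act_delta[OF lam HF] using finite_fillings[OF lam]
    by (simp add: co_def delta_def if_distrib[of "\<lambda>x. _ * x"] cong: if_cong)
  have "(\<lambda>R. act n lam g (delta ?H) R - bchar lam g * delta ?H R) = (\<lambda>R. \<Sum>S\<in>fillings n lam - {?H}. co S * delta S R)"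
    unfolding act using sum.remove[OF finite_fillings[OF lam] HF, of "\<lambda>S. co S * delta S _"] by (simp add: coH)
  also have "\<dots> \<in> Wrel n lam"
  proof (rule csubspace_sum[OF csubspace_Wrel])
    fix S assume S: "S \<in> fillings n lam - {?H}"
    show "(\<lambda>R. co S * delta S R) \<in> Wrel n lam"
    proof (cases "co S = 0")
      case True then show ?thesis using csubspace_zero[OF csubspace_Wrel] by simp
    next
      case False
      have SP: "\<exists>m. 1 \<le> m \<and> m \<le> i \<and> S (i, j) = P m" if b: "(i, j) \<in> boxes lam" for i j
      proof -
        have "g (S (i, j)) (?H (i, j)) \<noteq> 0" using False b finite_boxes[OF lam] by (auto simp: co_def prod_zero_iff)
        then have nz: "g (S (i, j)) (P i) \<noteq> 0" using b by (simp add: hw_tab_def)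
        have "i \<in> {1..n}" using b by (auto simp: boxes_eq_Sigma_rows[OF lam])
        then have "S (i, j) \<in> {P m | m. 1 \<le> m \<and> m \<le> i}" using g nz unfolding Borel_def by force
        then show ?thesis by auto
      qed
      have "\<exists>b b'. b \<in> boxes lam \<and> b' \<in> boxes lam \<and> b \<noteq> b' \<and> snd b = snd b' \<and> S b = S b'"
      proof (rule ccontr)
        assume inj: "\<not> ?thesis"
        have SPi: "(i, j) \<in> boxes lam \<Longrightarrow> S (i, j) = P i" for i j
        proof (induction i rule: less_induct)
          case (less i)
          obtain m where m: "1 \<le> m" "m \<le> i" "S (i, j) = P m" using SP[OF less.prems] by blast
          show ?case
          proof (cases "m = i")
            case False
            have "(m, j) \<in> boxes lam" using less.prems m by (auto simp: mem_boxes_iff[OF lam])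
            then have "S (m, j) = P m" using less.IH m False by simp
            then show ?thesis using inj less.prems \<open>(m, j) \<in> boxes lam\<close> m False by fastforce
          qed (use m in simp)
        qed
        have "S b = ?H b" for b
        proof (cases "b \<in> boxes lam")
          case True then show ?thesis using SPi[of "fst b" "snd b"] by (simp add: hw_tab_def)
        next
          case False then show ?thesis using S filling_outside[of S n lam b] by (simp add: hw_tab_def)
        qed
        then have "S = ?H" by (rule ext)
        then show False using S by simp
      qed
      then have "delta S \<in> Wrel n lam" using delta_repeated_Wrel S by blast
      then show ?thesis by (rule csubspace_scale[OF csubspace_Wrel])
    qed
  qed
  finally show ?thesis .
qed

lemma iso_to_V_lambda_partition:
  assumes lam: "is_partition n lam"
  shows "iso_to_V_lambda n lam"
  unfolding iso_to_V_lambda_def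
proof (intro conjI)
  have HT: "delta (hw_tab lam) \<in> tens n lam" by (simp add: delta_in_tens hw_tab_filling[OF lam])
  show "\<forall>g\<in>Sp n. \<forall>\<phi>\<in>Wrel n lam. act n lam g \<phi> \<in> Wrel n lam" using Wrel_invariant[OF lam] by blast
  show "Wrel n lam \<noteq> tens n lam" using HT hw_notin_Wrel[OF lam] by blast
  show "\<forall>U. csubspace U \<and> Wrel n lam \<subseteq> U \<and> U \<subseteq> tens n lam \<and> (\<forall>g\<in>Sp n. \<forall>\<phi>\<in>U. act n lam g \<phi> \<in> U)
          \<longrightarrow> U = Wrel n lam \<or> U = tens n lam" 
  proof (intro allI impI, elim conjE)
    fix U assume "csubspace U" "Wrel n lam \<subseteq> U" "U \<subseteq> tens n lam" "\<forall>g\<in>Sp n. \<forall>\<phi>\<in>U. act n lam g \<phi> \<in> U"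
    then show "U = Wrel n lam \<or> U = tens n lam" by (intro submodule_trivial[OF lam]) simp_all
  qed
  show "\<exists>v\<in>tens n lam. v \<notin> Wrel n lam \<and> (\<forall>g\<in>Borel n. (\<lambda>S. act n lam g v S - bchar lam g * v S) \<in> Wrel n lam)"
    by (intro bexI[OF _ HT] conjI ballI hw_notin_Wrel[OF lam] hw_Borel[OF lam])
qed

subsection \<open>Evaluation of polynomials\<close>

definition mval :: "(ix list \<Rightarrow>\<^sub>0 nat) \<Rightarrow> (ix \<Rightarrow> nat \<Rightarrow> complex) \<Rightarrow> complex" where
  "mval m M = (\<Prod>v\<in>Poly_Mapping.keys m. plueck v M ^ Poly_Mapping.lookup m v)"

lemma mval_superset:
  assumes "finite K" "Poly_Mapping.keys m \<subseteq> K"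
  shows "mval m M = (\<Prod>v\<in>K. plueck v M ^ Poly_Mapping.lookup m v)"
  unfolding mval_def using assms by (intro prod.mono_neutral_left) (auto simp: in_keys_iff)

lemma mval_add: "mval (m + m') M = mval m M * mval m' M"
proof -
  define K where "K = Poly_Mapping.keys m \<union> Poly_Mapping.keys m'"
  have K: "finite K" "Poly_Mapping.keys m \<subseteq> K" "Poly_Mapping.keys m' \<subseteq> K" "Poly_Mapping.keys (m + m') \<subseteq> K"
    using Poly_Mapping.keys_add[of m m'] by (auto simp: K_def)
  show ?thesis
    unfolding mval_superset[OF K(1,2)] mval_superset[OF K(1,3)] mval_superset[OF K(1,4)] prod.distrib[symmetric]
    by (simp add: lookup_add power_add)
qed

lemma mval_zero[simp]: "mval 0 M = 1" by (simp add: mval_def)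

text \<open>Monomials may cancel in a sum, so \<open>evalp_add\<close> compares all sums over a
  common finite set of monomials.\<close>

lemma evalp_superset:
  assumes "finite K" "Poly_Mapping.keys p \<subseteq> K"
  shows "evalp p M = (\<Sum>m\<in>K. Poly_Mapping.lookup p m * mval m M)"
  unfolding evalp_def mval_def[symmetric] using assms by (intro sum.mono_neutral_left) (auto simp: in_keys_iff)

lemma evalp_add: "evalp (p + q) M = evalp p M + evalp q M"
proof -
  define K where "K = Poly_Mapping.keys p \<union> Poly_Mapping.keys q"
  have K: "finite K" "Poly_Mapping.keys p \<subseteq> K" "Poly_Mapping.keys q \<subseteq> K" "Poly_Mapping.keys (p + q) \<subseteq> K"
    using Poly_Mapping.keys_add[of p q] by (auto simp: K_def)
  show ?thesis
    unfolding evalp_superset[OF K(1,2)] evalp_superset[OF K(1,3)] evalp_superset[OF K(1,4)] sum.distrib[symmetric]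
    by (simp add: lookup_add distrib_right)
qed

lemma evalp_zero[simp]: "evalp 0 M = 0" by (simp add: evalp_def)

lemma evalp_sum: "evalp (\<Sum>i\<in>I. f i) M = (\<Sum>i\<in>I. evalp (f i) M)"
  by (induction I rule: infinite_finite_induct) (simp_all add: evalp_add)

lemma evalp_single: "evalp (Poly_Mapping.single m c) M = c * mval m M"
  by (simp add: evalp_def mval_def[symmetric])

lemma sum_monomials: "(\<Sum>m\<in>Poly_Mapping.keys p. Poly_Mapping.single m (Poly_Mapping.lookup p m)) = p"
proof (rule poly_mapping_eqI)
  fix k
  have "Poly_Mapping.lookup (\<Sum>m\<in>Poly_Mapping.keys p. Poly_Mapping.single m (Poly_Mapping.lookup p m)) k
      = (\<Sum>m\<in>Poly_Mapping.keys p. if m = k then Poly_Mapping.lookup p m else 0)"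
    unfolding lookup_sum by (rule sum.cong) (auto simp: lookup_single)
  then show "Poly_Mapping.lookup (\<Sum>m\<in>Poly_Mapping.keys p. Poly_Mapping.single m (Poly_Mapping.lookup p m)) k = Poly_Mapping.lookup p k"
    by (simp add: in_keys_iff)
qed

lemma evalp_mult: "evalp (p * q) M = evalp p M * evalp q M"
proof -
  have "evalp (p * q) M = evalp ((\<Sum>m\<in>Poly_Mapping.keys p. Poly_Mapping.single m (Poly_Mapping.lookup p m))
      * (\<Sum>m\<in>Poly_Mapping.keys q. Poly_Mapping.single m (Poly_Mapping.lookup q m))) M"
    by (simp only: sum_monomials)
  also have "\<dots> = (\<Sum>m\<in>Poly_Mapping.keys p. \<Sum>m'\<in>Poly_Mapping.keys q. (Poly_Mapping.lookup p m * mval m M) * (Poly_Mapping.lookup q m' * mval m' M))"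
    unfolding sum_product evalp_sum mult_single evalp_single mval_add by (simp add: mult_ac)
  also have "\<dots> = evalp p M * evalp q M"
    unfolding evalp_def mval_def[symmetric] sum_product ..
  finally show ?thesis .
qed

lemma evalp_one[simp]: "evalp 1 M = 1"
  using evalp_single[of 0 1 M] by (simp add: single_one)

lemma evalp_prod: "evalp (\<Prod>i\<in>I. f i) M = (\<Prod>i\<in>I. evalp (f i) M)"
  by (induction I rule: infinite_finite_induct) (simp_all add: evalp_mult)

lemma evalp_pvar: "evalp (pvar a) M = plueck a M"
  by (simp add: pvar_def evalp_single mval_def)

lemma evalp_pconst: "evalp (pconst c) M = c"
  by (simp add: pconst_def evalp_single)

lemma evalp_xtab: "evalp (xtab lam T) M = Phi lam T M"
  by (simp add: xtab_def Phi_def evalp_prod evalp_pvar)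

lemma evalp_xrel: "evalp (xrel n lam \<rho>) M = ev n lam M \<rho>"
  by (simp add: xrel_def ev_def evalp_sum evalp_mult evalp_pconst evalp_xtab)

section \<open>Closure properties of the polynomial ring\<close>

lemma Rring_add: "p \<in> Rring n \<Longrightarrow> q \<in> Rring n \<Longrightarrow> p + q \<in> Rring n"
  unfolding Rring_def using Poly_Mapping.keys_add[of p q] by blast

lemma Rring_mult:
  assumes "p \<in> Rring n" "q \<in> Rring n"
  shows "p * q \<in> Rring n"
  unfolding Rring_def
proof safe
  fix m v assume m: "m \<in> Poly_Mapping.keys (p * q)" and v: "v \<in> Poly_Mapping.keys m"
  obtain a b where ab: "m = a + b" "a \<in> Poly_Mapping.keys p" "b \<in> Poly_Mapping.keys q"
    using Poly_Mapping.keys_mult[of p q] m by blast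
  have "v \<in> Poly_Mapping.keys a \<union> Poly_Mapping.keys b" using v Poly_Mapping.keys_add[of a b] ab(1) by blast
  then show "v \<in> pvars n" using ab assms unfolding Rring_def by blast
qed

lemma Rring_pconst: "pconst c \<in> Rring n"
  by (simp add: Rring_def pconst_def)

lemma pconst_one: "pconst 1 = 1" by (simp add: pconst_def single_one)
lemma pconst_zero: "pconst 0 = 0" by (simp add: pconst_def)
lemma pconst_add: "pconst (c + d) = pconst c + pconst d" by (simp add: pconst_def single_add)
lemma pconst_mult: "pconst (c * d) = pconst c * pconst d" by (simp add: pconst_def mult_single)

lemma Rring_one: "1 \<in> Rring n" using Rring_pconst[of 1 n] by (simp add: pconst_one)
lemma Rring_zero: "0 \<in> Rring n" using Rring_pconst[of 0 n] by (simp add: pconst_zero)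

lemma Rring_pvar: "a \<in> pvars n \<Longrightarrow> pvar a \<in> Rring n"
  by (auto simp: Rring_def pvar_def)

lemma Rring_prod: "(\<And>i. i \<in> I \<Longrightarrow> f i \<in> Rring n) \<Longrightarrow> (\<Prod>i\<in>I. f i) \<in> Rring n"
  by (induction I rule: infinite_finite_induct) (auto intro: Rring_mult Rring_one)

lemma Rring_sum: "(\<And>i. i \<in> I \<Longrightarrow> f i \<in> Rring n) \<Longrightarrow> (\<Sum>i\<in>I. f i) \<in> Rring n"
  by (induction I rule: infinite_finite_induct) (auto intro: Rring_add Rring_zero)

lemma column_in_pvars:
  assumes lam: "is_partition n lam" and T: "T \<in> fillings n lam" and j: "j \<in> {1..ncols lam}"
  shows "column lam T j \<in> pvars n"
proof -
  have "set (column lam T j) \<subseteq> idxs n"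
    using j fillings_entry[OF T] by (auto simp: column_def mem_boxes_iff[OF lam])
  then show ?thesis using j collen_pos[OF lam, of j] collen_le[OF lam, of j] by (simp add: pvars_def)
qed

lemma Rring_xtab: "is_partition n lam \<Longrightarrow> T \<in> fillings n lam \<Longrightarrow> xtab lam T \<in> Rring n"
  unfolding xtab_def by (intro Rring_prod Rring_pvar column_in_pvars)

lemma Rring_xrel: "is_partition n lam \<Longrightarrow> xrel n lam \<rho> \<in> Rring n"
  unfolding xrel_def by (intro Rring_sum Rring_mult Rring_pconst Rring_xtab)

subsection \<open>The ideal of quadratic relations\<close>

lemma gen_ideal_zero: "0 \<in> gen_ideal n G"
  unfolding gen_ideal_def by (rule CollectI, rule exI[of _ "{}"]) simp

text \<open>Two representations are merged over the union of their generators, each coefficient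
  function being extended by zero.\<close>

lemma gen_ideal_add:
  assumes "p \<in> gen_ideal n G" "p' \<in> gen_ideal n G"
  shows "p + p' \<in> gen_ideal n G"
proof -
  obtain F q where p: "p = (\<Sum>g\<in>F. q g * g)" "finite F" "F \<subseteq> G" "\<forall>g\<in>F. q g \<in> Rring n"
    using assms(1) by (auto simp: gen_ideal_def)
  obtain F' q' where p': "p' = (\<Sum>g\<in>F'. q' g * g)" "finite F'" "F' \<subseteq> G" "\<forall>g\<in>F'. q' g \<in> Rring n"
    using assms(2) by (auto simp: gen_ideal_def)
  define r where "r g = (if g \<in> F then q g else 0) + (if g \<in> F' then q' g else 0)" for g
  have "(\<Sum>g\<in>F \<union> F'. r g * g) = (\<Sum>g\<in>F \<union> F'. if g \<in> F then q g * g else 0) + (\<Sum>g\<in>F \<union> F'. if g \<in> F' then q' g * g else 0)"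
    unfolding sum.distrib[symmetric] by (rule sum.cong) (auto simp: r_def distrib_right)
  also have "(\<Sum>g\<in>F \<union> F'. if g \<in> F then q g * g else 0) = p"
    unfolding p(1) using p(2) p'(2) by (intro sum.mono_neutral_cong_right) auto
  also have "(\<Sum>g\<in>F \<union> F'. if g \<in> F' then q' g * g else 0) = p'"
    unfolding p'(1) using p(2) p'(2) by (intro sum.mono_neutral_cong_right) auto
  finally have "p + p' = (\<Sum>g\<in>F \<union> F'. r g * g)" by simp
  moreover have "\<forall>g\<in>F \<union> F'. r g \<in> Rring n" using p(4) p'(4) by (auto simp: r_def intro!: Rring_add Rring_zero)
  ultimately show ?thesis unfolding gen_ideal_def using p(2,3) p'(2,3) by blast
qed

lemma gen_ideal_mult:
  assumes "p \<in> gen_ideal n G" "r \<in> Rring n"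
  shows "r * p \<in> gen_ideal n G"
proof -
  obtain F q where p: "p = (\<Sum>g\<in>F. q g * g)" "finite F" "F \<subseteq> G" "\<forall>g\<in>F. q g \<in> Rring n"
    using assms(1) by (auto simp: gen_ideal_def)
  have "r * p = (\<Sum>g\<in>F. (r * q g) * g)" unfolding p(1) sum_distrib_left by (simp add: mult.assoc)
  moreover have "\<forall>g\<in>F. r * q g \<in> Rring n" using p(4) assms(2) by (auto intro: Rring_mult)
  ultimately show ?thesis unfolding gen_ideal_def using p(2,3) by (intro CollectI exI[of _ F] exI[of _ "\<lambda>g. r * q g"]) auto
qed

lemma gen_ideal_base: "g \<in> G \<Longrightarrow> g \<in> gen_ideal n G"
  unfolding gen_ideal_def by (intro CollectI exI[of _ "{g}"] exI[of _ "\<lambda>_. 1"]) (simp add: Rring_one)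

lemma gen_ideal_subset_flag_ideal: "gen_ideal n (quad_rels n) \<subseteq> flag_ideal n"
proof
  fix p assume "p \<in> gen_ideal n (quad_rels n)"
  then obtain F q where p: "p = (\<Sum>g\<in>F. q g * g)" "finite F" "F \<subseteq> quad_rels n" "\<forall>g\<in>F. q g \<in> Rring n"
    by (auto simp: gen_ideal_def)
  have g: "g \<in> Rring n \<and> (\<forall>M. good_matrix n M \<longrightarrow> evalp g M = 0)" if "g \<in> quad_rels n" for g
    using that ev_rels_zero Rring_xrel unfolding quad_rels_def by (fastforce simp: evalp_xrel)
  have "p \<in> Rring n" unfolding p(1) using p(3,4) g by (intro Rring_sum Rring_mult) auto
  moreover have "evalp p M = 0" if "good_matrix n M" for M
    unfolding p(1) evalp_sum evalp_mult using g p(3) that by (intro sum.neutral) auto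
  ultimately show "p \<in> flag_ideal n" by (simp add: flag_ideal_def)
qed

section \<open>Linearity of the passage from tensors to polynomials\<close>

lemma xrel_add: "xrel n lam (\<lambda>S. a S + b S) = xrel n lam a + xrel n lam b"
  by (simp add: xrel_def pconst_add distrib_right sum.distrib)

lemma xrel_scale: "xrel n lam (\<lambda>S. c * a S) = pconst c * xrel n lam a"
  by (simp add: xrel_def pconst_mult sum_distrib_left mult.assoc)

lemma xrel_zero: "xrel n lam (\<lambda>S. 0) = 0"
  by (simp add: xrel_def pconst_zero)

lemma xrel_diff: "xrel n lam (\<lambda>S. a S - b S) = xrel n lam a - xrel n lam b"
proof -
  have "pconst (- 1) = - 1" using pconst_add[of "-1" 1] by (simp add: pconst_one pconst_zero eq_neg_iff_add_eq_0)
  then show ?thesis using xrel_add[of n lam a "\<lambda>S. (-1) * b S"] xrel_scale[of n lam "-1" b] by simp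
qed

lemma xrel_sum: "xrel n lam (\<lambda>S. \<Sum>i\<in>I. f i S) = (\<Sum>i\<in>I. xrel n lam (f i))"
proof (induction I rule: infinite_finite_induct)
  case (insert i I)
  then show ?case using xrel_add[of n lam "f i" "\<lambda>S. \<Sum>i\<in>I. f i S"] by simp
qed (simp_all add: xrel_zero)

lemma xrel_delta:
  assumes "is_partition n lam" "T \<in> fillings n lam"
  shows "xrel n lam (delta T) = xtab lam T"
proof -
  have "xrel n lam (delta T) = (\<Sum>S\<in>fillings n lam. if S = T then xtab lam S else 0)"
    unfolding xrel_def by (rule sum.cong) (auto simp: delta_def pconst_one pconst_zero)
  then show ?thesis using assms finite_fillings[OF assms(1)] by simp
qed

section \<open>Restriction to one or two columns\<close>

definition shape_of_cols :: "nat \<Rightarrow> nat \<Rightarrow> (nat \<Rightarrow> nat) \<Rightarrow> nat list" where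
  "shape_of_cols n s cl = map (\<lambda>i. card {t \<in> {1..s}. i \<le> cl t}) [1..<n+1]"

text \<open>This is conjugation of partitions, padded with zero parts to length \<open>n\<close>. As
  the lengths decrease, the columns of length at least \<open>i\<close> are the first ones, so row
  \<open>i\<close> reaches column \<open>t\<close> exactly if \<open>i \<le> cl t\<close>.\<close>

lemma shape_of_cols:
  assumes n: "1 \<le> n" and anti: "\<And>t t'. 1 \<le> t \<Longrightarrow> t \<le> t' \<Longrightarrow> t' \<le> s \<Longrightarrow> cl t' \<le> cl t"
    and rng: "\<And>t. t \<in> {1..s} \<Longrightarrow> 1 \<le> cl t \<and> cl t \<le> n"
  shows "is_partition n (shape_of_cols n s cl)" "ncols (shape_of_cols n s cl) = s"
    "\<And>t. t \<in> {1..s} \<Longrightarrow> collen (shape_of_cols n s cl) t = cl t"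
proof -
  let ?mu = "shape_of_cols n s cl"
  have nth: "?mu ! k = card {t \<in> {1..s}. Suc k \<le> cl t}" if "k < n" for k
    using that by (simp add: shape_of_cols_def del: upt_Suc)
  have len: "length ?mu = n" by (simp add: shape_of_cols_def)
  show part: "is_partition n ?mu"
    unfolding is_partition_def sorted_wrt_iff_nth_less len
    by (auto simp: nth intro!: card_mono)
  have "?mu \<noteq> []" using len n by auto
  then have "ncols ?mu = ?mu ! 0" by (simp add: ncols_def hd_conv_nth)
  also have "\<dots> = card {t \<in> {1..s}. Suc 0 \<le> cl t}" using nth n by simp
  also have "{t \<in> {1..s}. Suc 0 \<le> cl t} = {1..s}" using rng by auto
  finally show "ncols ?mu = s" by simp
  fix t assume t: "t \<in> {1..s}"
  have seg: "{t \<in> {1..s}. i \<le> cl t} = {1..card {t \<in> {1..s}. i \<le> cl t}}" for i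
  proof (rule downward_closed_eq_interval)
    fix a b assume "a \<in> {t \<in> {1..s}. i \<le> cl t}" "1 \<le> b" "b \<le> a"
    then show "b \<in> {t \<in> {1..s}. i \<le> cl t}" using anti[of b a] by auto
  qed auto
  have "t \<le> card {t \<in> {1..s}. i \<le> cl t} \<longleftrightarrow> i \<le> cl t" for i
    using seg[of i] t by (metis (mono_tags, lifting) atLeastAtMost_iff mem_Collect_eq)
  then have "t \<le> ?mu ! (i - 1) \<longleftrightarrow> i \<le> cl t" if "1 \<le> i" "i \<le> n" for i
    using nth[of "i - 1"] that by simp
  then have "{i. 1 \<le> i \<and> i \<le> length ?mu \<and> t \<le> ?mu ! (i - 1)} = {1..cl t}"
    using rng[OF t] len by auto
  then show "collen ?mu t = cl t" by (simp add: collen_def)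
qed

text \<open>\<kappa> lists, from left to right, the one or two columns that a relation touches. All
  tableaux of the relation agree on the remaining columns, which split off as the common monomial
  \<open>rest T\<close>; what is left is the same kind of relation on the shape \<open>mu\<close> of
  the selected columns.\<close>

locale column_selection =
  fixes n :: nat and lam :: "nat list" and s :: nat and \<kappa> :: "nat \<Rightarrow> nat"
  assumes lam: "is_partition n lam" and s: "1 \<le> s" "s \<le> 2"
    and \<kappa>: "\<And>t t'. 1 \<le> t \<Longrightarrow> t < t' \<Longrightarrow> t' \<le> s \<Longrightarrow> \<kappa> t < \<kappa> t'" "\<And>t. t \<in> {1..s} \<Longrightarrow> \<kappa> t \<in> {1..ncols lam}"
begin

definition mu :: "nat list" where "mu = shape_of_cols n s (\<lambda>t. collen lam (\<kappa> t))"

lemma \<kappa>_le: "1 \<le> t \<Longrightarrow> t \<le> t' \<Longrightarrow> t' \<le> s \<Longrightarrow> \<kappa> t \<le> \<kappa> t'"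
  using \<kappa>(1)[of t t'] by (cases "t = t'") auto

lemma \<kappa>_inj: "inj_on \<kappa> {1..s}"
proof (rule inj_onI)
  fix x y assume "x \<in> {1..s}" "y \<in> {1..s}" "\<kappa> x = \<kappa> y"
  then show "x = y" using \<kappa>(1)[of x y] \<kappa>(1)[of y x] by (cases x y rule: linorder_cases) auto
qed

lemma mu: "is_partition n mu" "ncols mu = s" "\<And>t. t \<in> {1..s} \<Longrightarrow> collen mu t = collen lam (\<kappa> t)"
proof -
  have rng: "1 \<le> collen lam (\<kappa> t) \<and> collen lam (\<kappa> t) \<le> n" if "t \<in> {1..s}" for t
    using \<kappa>(2)[OF that] collen_pos[OF lam, of "\<kappa> t"] collen_le[OF lam, of "\<kappa> t"] by auto
  have n1: "1 \<le> n" using rng[of 1] s by simp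
  have anti: "collen lam (\<kappa> t') \<le> collen lam (\<kappa> t)" if "1 \<le> t" "t \<le> t'" "t' \<le> s" for t t'
    by (rule collen_antimono[OF lam \<kappa>_le[OF that]])
  show "is_partition n mu" "ncols mu = s" "\<And>t. t \<in> {1..s} \<Longrightarrow> collen mu t = collen lam (\<kappa> t)"
    unfolding mu_def by (rule shape_of_cols[OF n1 anti rng]; assumption)+
qed

lemma mem_boxes_mu: "(i, t) \<in> boxes mu \<longleftrightarrow> t \<in> {1..s} \<and> 1 \<le> i \<and> i \<le> collen lam (\<kappa> t)"
  using mu(3)[of t] by (auto simp: mem_boxes_iff[OF mu(1)] mu(2))

lemma box_lam: "(i, t) \<in> boxes mu \<Longrightarrow> (i, \<kappa> t) \<in> boxes lam"
  using \<kappa>(2)[of t] by (auto simp: mem_boxes_mu mem_boxes_iff[OF lam])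

lemma box_mu: "(i, \<kappa> t) \<in> boxes lam \<Longrightarrow> t \<in> {1..s} \<Longrightarrow> (i, t) \<in> boxes mu"
  by (auto simp: mem_boxes_mu mem_boxes_iff[OF lam])

definition res :: "(nat \<times> nat \<Rightarrow> ix) \<Rightarrow> nat \<times> nat \<Rightarrow> ix" where
  "res T = (\<lambda>(i, t). if (i, t) \<in> boxes mu then T (i, \<kappa> t) else P 0)"

definition rest :: "(nat \<times> nat \<Rightarrow> ix) \<Rightarrow> mpoly" where
  "rest T = (\<Prod>j\<in>{1..ncols lam} - \<kappa> ` {1..s}. pvar (column lam T j))"

lemma res_filling:
  assumes T: "T \<in> fillings n lam" shows "res T \<in> fillings n mu"
proof -
  have "res T b \<in> idxs n" if "b \<in> boxes mu" for b
    using that box_lam fillings_entry[OF T] by (cases b) (auto simp: res_def)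
  then show ?thesis by (auto simp: fillings_def res_def split: prod.split)
qed

lemma rest_Rring: "T \<in> fillings n lam \<Longrightarrow> rest T \<in> Rring n"
  unfolding rest_def by (intro Rring_prod Rring_pvar column_in_pvars[OF lam]) auto

lemma rest_cong:
  assumes "\<And>i j. j \<notin> \<kappa> ` {1..s} \<Longrightarrow> T (i, j) = T' (i, j)"
  shows "rest T = rest T'"
  unfolding rest_def using assms by (intro prod.cong refl arg_cong[where f = pvar]) (auto simp: column_def)

lemma xtab_split: "xtab lam T = rest T * xtab mu (res T)"
proof -
  have "column mu (res T) t = column lam T (\<kappa> t)" if t: "t \<in> {1..s}" for t
    unfolding column_def mu(3)[OF t] using t by (intro map_cong) (auto simp: res_def mem_boxes_mu)
  then have "xtab mu (res T) = (\<Prod>t=1..s. pvar (column lam T (\<kappa> t)))"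
    unfolding xtab_def mu(2) by (intro prod.cong refl arg_cong[where f = pvar]) blast
  also have "\<dots> = (\<Prod>j\<in>\<kappa> ` {1..s}. pvar (column lam T j))"
    by (subst prod.reindex[OF \<kappa>_inj]) simp
  finally show ?thesis unfolding xtab_def[of lam] rest_def
    using \<kappa>(2) by (subst prod.subset_diff[of "\<kappa> ` {1..s}"]) auto
qed

lemma rel_in_ideal:
  assumes T: "T \<in> fillings n lam" and \<rho>: "\<rho> \<in> alt_rels n mu \<union> exch_rels n mu \<union> symp_rels n mu"
  shows "rest T * xrel n mu \<rho> \<in> gen_ideal n (quad_rels n)"
proof (rule gen_ideal_mult[OF gen_ideal_base rest_Rring[OF T]])
  show "xrel n mu \<rho> \<in> quad_rels n" unfolding quad_rels_def
    by (intro CollectI exI[of _ mu] exI[of _ \<rho>]) (simp add: mu(1,2) s(2) \<rho>[simplified])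
qed

lemma xrel_alt_in_ideal:
  assumes T: "T \<in> fillings n lam" and b: "(i, \<kappa> t) \<in> boxes lam" "(i', \<kappa> t) \<in> boxes lam" "i \<noteq> i'" and t: "t \<in> {1..s}"
  shows "xrel n lam (\<lambda>S. delta T S + delta (T((i, \<kappa> t) := T (i', \<kappa> t), (i', \<kappa> t) := T (i, \<kappa> t))) S) \<in> gen_ideal n (quad_rels n)"
proof -
  define T' where "T' = T((i, \<kappa> t) := T (i', \<kappa> t), (i', \<kappa> t) := T (i, \<kappa> t))"
  have T': "T' \<in> fillings n lam" unfolding T'_def by (rule filling_swap[OF T b(1,2)])
  have rest: "rest T' = rest T" using t by (intro rest_cong) (auto simp: T'_def)
  have bm: "(i, t) \<in> boxes mu" "(i', t) \<in> boxes mu" using box_mu[OF _ t] b by auto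
  have res: "res T' = (res T)((i, t) := res T (i', t), (i', t) := res T (i, t))"
  proof
    fix c show "res T' c = ((res T)((i, t) := res T (i', t), (i', t) := res T (i, t))) c"
    proof (cases "c \<in> boxes mu")
      case True
      obtain r u where c: "c = (r, u)" by (cases c)
      \<comment> \<open>Injectivity of \<kappa> keeps a change in column \<open>\<kappa> t\<close>
        from appearing in the other selected column.\<close>
      have "\<kappa> u = \<kappa> t \<longleftrightarrow> u = t" using True t by (intro inj_on_eq_iff[OF \<kappa>_inj]) (auto simp: c mem_boxes_mu)
      then show ?thesis using True bm by (auto simp: res_def c T'_def)
    next
      case False
      then show ?thesis using bm by (cases c) (auto simp: res_def)
    qed
  qed
  have "xrel n lam (\<lambda>S. delta T S + delta T' S) = rest T * xrel n mu (\<lambda>S. delta (res T) S + delta (res T') S)"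
    unfolding xrel_add xrel_delta[OF lam T] xrel_delta[OF lam T'] xrel_delta[OF mu(1) res_filling[OF T]]
      xrel_delta[OF mu(1) res_filling[OF T']] xtab_split[of T] xtab_split[of T'] rest by (simp add: distrib_left)
  also have "\<dots> \<in> gen_ideal n (quad_rels n)"
  proof (rule rel_in_ideal[OF T], intro UnI1)
    show "(\<lambda>S. delta (res T) S + delta (res T') S) \<in> alt_rels n mu"
      unfolding alt_rels_def res using bm b(3) res_filling[OF T]
      by (intro CollectI exI[of _ "res T"] exI[of _ "(i, t)"] exI[of _ "(i', t)"]) simp
  qed
  finally show ?thesis by (simp only: T'_def)
qed

lemma xrel_symp_in_ideal:
  assumes T: "T \<in> fillings n lam" and b: "(i, \<kappa> t) \<in> boxes lam" "(i', \<kappa> t') \<in> boxes lam" "(i, t) \<noteq> (i', t')"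
    and t: "t \<in> {1..s}" "t' \<in> {1..s}"
  shows "xrel n lam (\<lambda>S. \<Sum>k=1..n. delta (T((i, \<kappa> t) := P k, (i', \<kappa> t') := Q k)) S - delta (T((i, \<kappa> t) := Q k, (i', \<kappa> t') := P k)) S)
    \<in> gen_ideal n (quad_rels n)"
proof -
  define U where "U a a' = T((i, \<kappa> t) := a, (i', \<kappa> t') := a')" for a a'
  define V where "V a a' = (res T)((i, t) := a, (i', t') := a')" for a a'
  have UF: "U a a' \<in> fillings n lam" if "a \<in> idxs n" "a' \<in> idxs n" for a a'
    unfolding U_def using that b by (intro filling_upd T)
  have bm: "(i, t) \<in> boxes mu" "(i', t') \<in> boxes mu" using box_mu t b by auto
  have VF: "V a a' \<in> fillings n mu" if "a \<in> idxs n" "a' \<in> idxs n" for a a'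
    unfolding V_def using that bm by (intro filling_upd res_filling[OF T])
  have rest: "rest (U a a') = rest T" for a a' using t by (intro rest_cong) (auto simp: U_def)
  have res: "res (U a a') = V a a'" for a a'
  proof
    fix c show "res (U a a') c = V a a' c"
    proof (cases "c \<in> boxes mu")
      case True
      obtain r u where c: "c = (r, u)" by (cases c)
      have "\<kappa> u = \<kappa> t \<longleftrightarrow> u = t" "\<kappa> u = \<kappa> t' \<longleftrightarrow> u = t'"
        using True t by (intro inj_on_eq_iff[OF \<kappa>_inj]; auto simp: c mem_boxes_mu)+
      then show ?thesis using True by (auto simp: res_def c U_def V_def)
    next
      case False
      then show ?thesis using bm by (cases c) (auto simp: res_def V_def)
    qed
  qed
  have one: "xrel n lam (delta (U a a')) = rest T * xrel n mu (delta (V a a'))" if "a \<in> idxs n" "a' \<in> idxs n" for a a'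
    unfolding xrel_delta[OF lam UF[OF that]] xrel_delta[OF mu(1) VF[OF that]] xtab_split[of "U a a'"] rest res ..
  have "xrel n lam (\<lambda>S. \<Sum>k=1..n. delta (U (P k) (Q k)) S - delta (U (Q k) (P k)) S)
      = rest T * xrel n mu (\<lambda>S. \<Sum>k=1..n. delta (V (P k) (Q k)) S - delta (V (Q k) (P k)) S)"
    unfolding xrel_sum xrel_diff sum_distrib_left right_diff_distrib
    by (intro sum.cong refl arg_cong2[where f = "(-)"] one) auto
  also have "\<dots> \<in> gen_ideal n (quad_rels n)"
  proof (rule rel_in_ideal[OF T], rule UnI2)
    show "(\<lambda>S. \<Sum>k=1..n. delta (V (P k) (Q k)) S - delta (V (Q k) (P k)) S) \<in> symp_rels n mu"
      unfolding symp_rels_def V_def using bm b(3) res_filling[OF T]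
      by (intro CollectI exI[of _ "res T"] exI[of _ "(i, t)"] exI[of _ "(i', t')"]) simp
  qed
  finally show ?thesis by (simp only: U_def)
qed

lemma xrel_exch_in_ideal:
  assumes T: "T \<in> fillings n lam" and s2: "s = 2" and k: "k \<le> collen lam (\<kappa> 2)"
  shows "xrel n lam (\<lambda>S. delta T S - (\<Sum>R\<in>{R. R \<subseteq> {1..collen lam (\<kappa> 1)} \<and> card R = k}. delta (exch_tab T (\<kappa> 1) (\<kappa> 2) R) S)) \<in> gen_ideal n (quad_rels n)"
proof -
  have k12: "\<kappa> 1 < \<kappa> 2" "1 \<le> \<kappa> 1" "\<kappa> 2 \<le> ncols lam" using \<kappa>(1)[of 1 2] \<kappa>(2)[of 1] \<kappa>(2)[of 2] s2 by auto
  have s12: "1 \<in> {1..s}" "2 \<in> {1..s}" using s2 by auto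
  have cm: "collen mu 1 = collen lam (\<kappa> 1)" "collen mu 2 = collen lam (\<kappa> 2)" using mu(3) s12 by auto
  have nm: "2 \<le> ncols mu" unfolding mu(2) using s2 by simp
  define Rs where "Rs = {R. R \<subseteq> {1..collen lam (\<kappa> 1)} \<and> card R = k}"
  have one: "xrel n lam (delta (exch_tab T (\<kappa> 1) (\<kappa> 2) R)) = rest T * xrel n mu (delta (exch_tab (res T) 1 2 R))" if R: "R \<in> Rs" for R
  proof -
    have R': "R \<subseteq> {1..collen lam (\<kappa> 1)}" "card R = k" using R by (auto simp: Rs_def)
    have fR: "finite R" using R'(1) finite_subset by blast
    have EF: "exch_tab T (\<kappa> 1) (\<kappa> 2) R \<in> fillings n lam"
      using R' k k12 by (intro filling_exch[OF lam T]) auto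
    have EFm: "exch_tab (res T) 1 2 R \<in> fillings n mu"
    proof (rule filling_exch[OF mu(1) res_filling[OF T] _ _ nm])
      show "R \<subseteq> {1..collen mu 1}" "card R \<le> collen mu 2" unfolding cm using R' k by auto
    qed simp_all
    have rest: "rest (exch_tab T (\<kappa> 1) (\<kappa> 2) R) = rest T"
      using s12 by (intro rest_cong exch_tab_other) blast+
    have res: "res (exch_tab T (\<kappa> 1) (\<kappa> 2) R) = exch_tab (res T) 1 2 R"
    proof
      fix c show "res (exch_tab T (\<kappa> 1) (\<kappa> 2) R) c = exch_tab (res T) 1 2 R c"
      proof (cases "c \<in> boxes mu")
        case True
        obtain r u where c: "c = (r, u)" by (cases c)
        have u: "u = 1 \<or> u = 2" using True s(2) by (auto simp: c mem_boxes_mu)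
        \<comment> \<open>The exchanged entries are read inside the restricted diagram, where
          \<open>res T\<close> returns entries of \<open>T\<close> and not the default
          \<open>P 0\<close>.\<close>
        have r1: "res T (sorted_list_of_set R ! (r - 1), 1) = T (sorted_list_of_set R ! (r - 1), \<kappa> 1)" if "1 \<le> r" "r \<le> card R"
          using sorted_nth_in_card_le[OF fR that] R'(1) s12 by (auto simp: res_def mem_boxes_mu)
        have r2: "res T (card {r' \<in> R. r' \<le> r}, 2) = T (card {r' \<in> R. r' \<le> r}, \<kappa> 2)" if "r \<in> R"
          using card_le_bounds[OF fR that] R'(2) k s12 by (auto simp: res_def mem_boxes_mu)
        have r3: "res X c = X (r, \<kappa> u)" for X using True by (simp add: res_def c)
        have ne12: "(1::nat) \<noteq> 2" by simp
        from u show ?thesis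
        proof
          assume u1: "u = 1"
          show ?thesis
            unfolding r3 u1 unfolding c u1 fun_cong[OF exch_tab_left[OF less_imp_neq[OF k12(1)]]]
              fun_cong[OF exch_tab_left[OF ne12]]
            using r2 r3[of T] by (simp add: exR_def c u1)
        next
          assume u2: "u = 2"
          show ?thesis
            unfolding r3 u2 unfolding c u2 fun_cong[OF exch_tab_right[OF less_imp_neq[OF k12(1)]]]
              fun_cong[OF exch_tab_right[OF ne12]]
            using r1 r3[of T] by (simp add: exL_def c u2)
        qed
      next
        case False
        then show ?thesis using filling_outside[OF EFm False] by (cases c) (simp add: res_def)
      qed
    qed
    show ?thesis unfolding xrel_delta[OF lam EF] xrel_delta[OF mu(1) EFm] xtab_split[of "exch_tab T (\<kappa> 1) (\<kappa> 2) R"] rest res ..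
  qed
  have "xrel n lam (\<lambda>S. delta T S - (\<Sum>R\<in>Rs. delta (exch_tab T (\<kappa> 1) (\<kappa> 2) R) S))
      = rest T * xrel n mu (\<lambda>S. delta (res T) S - (\<Sum>R\<in>Rs. delta (exch_tab (res T) 1 2 R) S))"
    unfolding xrel_sum xrel_diff right_diff_distrib sum_distrib_left
      xrel_delta[OF lam T] xrel_delta[OF mu(1) res_filling[OF T]] xtab_split[of T]
    by (rule arg_cong2[where f = "(-)", OF refl sum.cong[OF refl one]])
  also have "\<dots> \<in> gen_ideal n (quad_rels n)"
  proof (rule rel_in_ideal[OF T], rule UnI1, rule UnI2)
    show "(\<lambda>S. delta (res T) S - (\<Sum>R\<in>Rs. delta (exch_tab (res T) 1 2 R) S)) \<in> exch_rels n mu"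
      unfolding exch_rels_def Rs_def cm(1)[symmetric] using k nm res_filling[OF T]
      by (intro CollectI exI[of _ "res T"] exI[of _ 1] exI[of _ 2] exI[of _ k]) (simp add: cm(2))
  qed
  finally show ?thesis by (simp only: Rs_def)
qed

end

lemma xrel_rels_in_ideal:
  assumes lam: "is_partition n lam" and \<rho>: "\<rho> \<in> alt_rels n lam \<union> exch_rels n lam \<union> symp_rels n lam"
  shows "xrel n lam \<rho> \<in> gen_ideal n (quad_rels n)"
  using \<rho>
proof (elim UnE)
  assume "\<rho> \<in> alt_rels n lam"
  then obtain T b b' where r: "\<rho> = (\<lambda>S. delta T S + delta (T(b := T b', b' := T b)) S)"
    "T \<in> fillings n lam" "b \<in> boxes lam" "b' \<in> boxes lam" "b \<noteq> b'" "snd b = snd b'"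
    unfolding alt_rels_def by blast
  obtain i i' j where b: "b = (i, j)" "b' = (i', j)" using r(6) by (cases b; cases b') auto
  interpret column_selection n lam 1 "\<lambda>_. j"
    using lam r(3) by unfold_locales (auto simp: b mem_boxes_iff[OF lam])
  show ?thesis using xrel_alt_in_ideal[where T = T and i = i and i' = i' and t = 1] r unfolding b by simp
next
  assume "\<rho> \<in> exch_rels n lam"
  then obtain T j1 j2 k where r: "\<rho> = (\<lambda>S. delta T S - (\<Sum>R\<in>{R. R \<subseteq> {1..collen lam j1} \<and> card R = k}. delta (exch_tab T j1 j2 R) S))"
    "T \<in> fillings n lam" "1 \<le> j1" "j1 < j2" "j2 \<le> ncols lam" "k \<le> collen lam j2"
    unfolding exch_rels_def by blast
  define \<kappa> where "\<kappa> t = (if t = 1 then j1 else j2)" for t :: nat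
  interpret column_selection n lam 2 \<kappa>
    using lam r(3-5) by unfold_locales (auto simp: \<kappa>_def)
  have "\<kappa> 1 = j1" "\<kappa> 2 = j2" by (simp_all add: \<kappa>_def)
  then show ?thesis using xrel_exch_in_ideal[of T k] r by simp
next
  assume "\<rho> \<in> symp_rels n lam"
  then obtain T B B' where r: "\<rho> = (\<lambda>S. \<Sum>i=1..n. delta (T(B := P i, B' := Q i)) S - delta (T(B := Q i, B' := P i)) S)"
    "T \<in> fillings n lam" "B \<in> boxes lam" "B' \<in> boxes lam" "B \<noteq> B'"
    unfolding symp_rels_def by blast
  obtain i j i' j' where b: "B = (i, j)" "B' = (i', j')" by (cases B; cases B')
  have bb: "(i, j) \<in> boxes lam" "(i', j') \<in> boxes lam" "(i, j) \<noteq> (i', j')" using r b by auto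
  have jb: "j \<in> {1..ncols lam}" "j' \<in> {1..ncols lam}" using bb by (auto simp: mem_boxes_iff[OF lam])
  \<comment> \<open>A selection is increasing while the two boxes come in any order, possibly in one
    column; \<open>t\<close> and \<open>t'\<close> record which selected column belongs to which
    box.\<close>
  have "\<exists>s \<kappa> t t'. column_selection n lam s \<kappa> \<and> t \<in> {1..s} \<and> t' \<in> {1..s} \<and> \<kappa> t = j \<and> \<kappa> t' = j'"
  proof (cases j j' rule: linorder_cases)
    case less
    have "column_selection n lam 2 (\<lambda>t. if t = 1 then j else j')"
      using lam jb less by unfold_locales auto
    then show ?thesis
      by (intro exI[of _ 2] exI[of _ "\<lambda>t. if t = 1 then j else j'"] exI[of _ 1] exI[of _ "2::nat"]) auto
  next
    case equal
    have "column_selection n lam 1 (\<lambda>_. j)" using lam jb by unfold_locales auto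
    then show ?thesis using equal by (intro exI[of _ 1] exI[of _ "\<lambda>_. j"]) auto
  next
    case greater
    have "column_selection n lam 2 (\<lambda>t. if t = 1 then j' else j)"
      using lam jb greater by unfold_locales auto
    then show ?thesis
      by (intro exI[of _ 2] exI[of _ "\<lambda>t. if t = 1 then j' else j"] exI[of _ "2::nat"] exI[of _ "1::nat"]) auto
  qed
  then obtain s \<kappa> t t' where c: "column_selection n lam s \<kappa>" "t \<in> {1..s}" "t' \<in> {1..s}" "\<kappa> t = j" "\<kappa> t' = j'" by blast
  interpret column_selection n lam s \<kappa> by (rule c(1))
  have "(i, t) \<noteq> (i', t')" using bb(3) c(4,5) by auto
  then show ?thesis using xrel_symp_in_ideal[OF r(2) _ _ _ c(2,3), of i i'] bb unfolding r(1) b c(4,5) by blast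
qed

lemma xrel_Wrel_in_ideal:
  assumes lam: "is_partition n lam" and w: "w \<in> Wrel n lam"
  shows "xrel n lam w \<in> gen_ideal n (quad_rels n)"
proof -
  have "csubspace {w. xrel n lam w \<in> gen_ideal n (quad_rels n)}"
    unfolding csubspace_def by (auto simp: xrel_add xrel_scale xrel_zero intro: gen_ideal_zero gen_ideal_add gen_ideal_mult Rring_pconst)
  then have "Wrel n lam \<subseteq> {w. xrel n lam w \<in> gen_ideal n (quad_rels n)}"
    unfolding Wrel_def using xrel_rels_in_ideal[OF lam] by (intro cspan_minimal) blast+
  then show ?thesis using w by blast
qed

section \<open>Straightening of polynomials\<close>

lemma pvar_power: "pvar v ^ k = Poly_Mapping.single (Poly_Mapping.single v k) 1"
  by (induction k) (simp_all add: pvar_def mult_single single_add[symmetric] single_one)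

lemma single_eq_prod_pvar: "Poly_Mapping.single m (1::complex) = (\<Prod>v\<in>Poly_Mapping.keys m. pvar v ^ Poly_Mapping.lookup m v)"
proof -
  have "(\<Prod>v\<in>K. Poly_Mapping.single (f v) (1::complex)) = Poly_Mapping.single (\<Sum>v\<in>K. f v) 1" for K and f :: "ix list \<Rightarrow> (ix list \<Rightarrow>\<^sub>0 nat)"
    by (induction K rule: infinite_finite_induct) (simp_all add: mult_single single_one)
  then show ?thesis unfolding pvar_power by (simp only: sum_monomials)
qed

text \<open>The variables of a monomial, repeated according to their exponents and arranged by
  decreasing length, are the columns of a tableau. This brings tableaux of arbitrary shape to bear
  on arbitrary polynomials.\<close>

lemma monomial_eq_xtab:
  assumes n: "1 \<le> n" and m: "Poly_Mapping.keys m \<subseteq> pvars n"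
  shows "\<exists>lam T. is_partition n lam \<and> T \<in> fillings n lam \<and> xtab lam T = Poly_Mapping.single m 1"
proof -
  have "finite K \<Longrightarrow> \<exists>xs. set xs \<subseteq> K \<and> prod_list (map pvar xs) = (\<Prod>v\<in>K. pvar v ^ e v)" for K and e :: "ix list \<Rightarrow> nat"
  proof (induction K rule: finite_induct)
    case (insert v K)
    then obtain xs where xs: "set xs \<subseteq> K" "prod_list (map pvar xs) = (\<Prod>v\<in>K. pvar v ^ e v)" by blast
    show ?case
      by (rule exI[of _ "replicate (e v) v @ xs"]) (use xs insert in \<open>auto simp: map_replicate prod_list_replicate\<close>)
  qed auto
  from this[of "Poly_Mapping.keys m" "Poly_Mapping.lookup m"] obtain xs where
    xs: "set xs \<subseteq> pvars n" "prod_list (map pvar xs) = Poly_Mapping.single m 1"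
    using m by (auto simp: single_eq_prod_pvar)
  \<comment> \<open>Lengths are at most \<open>n\<close>, so sorting by \<open>n - length a\<close>
    puts the longest columns first.\<close>
  define ys where "ys = sort_key (\<lambda>a. n - length a) xs"
  have ys: "set ys \<subseteq> pvars n" "prod_list (map pvar ys) = Poly_Mapping.single m 1"
    using xs by (simp_all add: ys_def prod_mset_prod_list[symmetric] del: prod_mset_prod_list)
  define s where "s = length ys"
  define cl where "cl t = length (ys ! (t - 1))" for t
  have yn: "ys ! (t - 1) \<in> pvars n" if "t \<in> {1..s}" for t
    using that ys(1) nth_mem[of "t - 1" ys] by (auto simp: s_def)
  have rng: "1 \<le> cl t \<and> cl t \<le> n" if "t \<in> {1..s}" for t using yn[OF that] by (auto simp: cl_def pvars_def)
  have anti: "cl t' \<le> cl t" if tt: "1 \<le> t" "t \<le> t'" "t' \<le> s" for t t'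
  proof -
    have "sorted (map (\<lambda>a. n - length a) ys)" by (simp add: ys_def)
    then have "n - length (ys ! (t - 1)) \<le> n - length (ys ! (t' - 1))"
      using tt sorted_nth_mono[of "map (\<lambda>a. n - length a) ys" "t - 1" "t' - 1"] by (auto simp: s_def)
    moreover have "length (ys ! (t' - 1)) \<le> n" using rng[of t'] tt by (simp add: cl_def)
    ultimately show ?thesis unfolding cl_def by linarith
  qed
  define lam where "lam = shape_of_cols n s cl"
  have sh: "is_partition n lam" "ncols lam = s" "\<And>t. t \<in> {1..s} \<Longrightarrow> collen lam t = cl t"
    unfolding lam_def by (rule shape_of_cols[OF n anti rng]; assumption)+
  define T where "T = (\<lambda>(i, t). if (i, t) \<in> boxes lam then ys ! (t - 1) ! (i - 1) else P 0)"
  have bx: "(i, t) \<in> boxes lam \<longleftrightarrow> t \<in> {1..s} \<and> 1 \<le> i \<and> i \<le> cl t" for i t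
    unfolding mem_boxes_iff[OF sh(1)] sh(2) using sh(3)[of t] by auto
  have "T b \<in> idxs n" if "b \<in> boxes lam" for b
  proof -
    obtain i t where b: "b = (i, t)" by (cases b)
    have it: "t \<in> {1..s}" "i - 1 < length (ys ! (t - 1))" using that by (auto simp: b bx cl_def)
    have "ys ! (t - 1) ! (i - 1) \<in> set (ys ! (t - 1))" using it(2) by (rule nth_mem)
    then have "ys ! (t - 1) ! (i - 1) \<in> idxs n" using yn[OF it(1)] by (auto simp: pvars_def)
    then show ?thesis using that by (simp add: T_def b)
  qed
  then have TF: "T \<in> fillings n lam" by (auto simp: fillings_def T_def split: prod.split)
  have "column lam T t = ys ! (t - 1)" if t: "t \<in> {1..s}" for t
  proof (rule nth_equalityI)
    show "length (column lam T t) = length (ys ! (t - 1))" using sh(3)[OF t] by (simp add: cl_def)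
    fix i assume "i < length (column lam T t)"
    then have i: "Suc i \<in> {1..collen lam t}" by simp
    have "column lam T t ! (Suc i - 1) = T (Suc i, t)" by (rule nth_column[OF i])
    also have "\<dots> = ys ! (t - 1) ! i" using i t sh(3)[OF t] by (simp add: T_def bx)
    finally show "column lam T t ! i = ys ! (t - 1) ! i" by simp
  qed
  then have "xtab lam T = (\<Prod>t=1..s. pvar (ys ! (t - 1)))"
    unfolding xtab_def sh(2) by (intro prod.cong refl arg_cong[where f = pvar]) blast
  also have "\<dots> = (\<Prod>t<s. pvar (ys ! t))"
    by (rule prod.reindex_bij_witness[of _ Suc "\<lambda>t. t - 1"]) auto
  also have "\<dots> = prod_list (map pvar ys)"
    unfolding s_def by (simp add: prod.list_conv_set_nth atLeast0LessThan)
  finally show ?thesis using ys(2) sh(1) TF by auto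
qed

definition straightened :: "nat \<Rightarrow> mpoly set" where
  "straightened n = {(\<Sum>x\<in>I. pconst (d x) * xtab (fst x) (snd x)) + r | I d r.
     finite I \<and> (\<forall>(lam, T)\<in>I. is_partition n lam \<and> symplectic_tab n lam T) \<and> r \<in> gen_ideal n (quad_rels n)}"

lemma straightenedI:
  "finite I \<Longrightarrow> (\<And>lam T. (lam, T) \<in> I \<Longrightarrow> is_partition n lam \<and> symplectic_tab n lam T) \<Longrightarrow> r \<in> gen_ideal n (quad_rels n)
    \<Longrightarrow> (\<Sum>x\<in>I. pconst (d x) * xtab (fst x) (snd x)) + r \<in> straightened n"
  unfolding straightened_def by blast

lemma straightenedE:
  assumes "p \<in> straightened n"
  obtains I d r where "p = (\<Sum>x\<in>I. pconst (d x) * xtab (fst x) (snd x)) + r" "finite I"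
    "\<And>lam T. (lam, T) \<in> I \<Longrightarrow> is_partition n lam \<and> symplectic_tab n lam T" "r \<in> gen_ideal n (quad_rels n)"
  using assms unfolding straightened_def by blast

lemma straightened_add:
  assumes "p \<in> straightened n" "q \<in> straightened n"
  shows "p + q \<in> straightened n"
proof -
  obtain I d r where p: "p = (\<Sum>x\<in>I. pconst (d x) * xtab (fst x) (snd x)) + r" "finite I"
    "\<And>lam T. (lam, T) \<in> I \<Longrightarrow> is_partition n lam \<and> symplectic_tab n lam T" "r \<in> gen_ideal n (quad_rels n)"
    by (rule straightenedE[OF assms(1)]) blast
  obtain I' d' r' where q: "q = (\<Sum>x\<in>I'. pconst (d' x) * xtab (fst x) (snd x)) + r'" "finite I'"
    "\<And>lam T. (lam, T) \<in> I' \<Longrightarrow> is_partition n lam \<and> symplectic_tab n lam T" "r' \<in> gen_ideal n (quad_rels n)"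
    by (rule straightenedE[OF assms(2)]) blast
  define D where "D x = (if x \<in> I then d x else 0) + (if x \<in> I' then d' x else 0)" for x
  have "(\<Sum>x\<in>I \<union> I'. pconst (D x) * xtab (fst x) (snd x))
      = (\<Sum>x\<in>I \<union> I'. if x \<in> I then pconst (d x) * xtab (fst x) (snd x) else 0) + (\<Sum>x\<in>I \<union> I'. if x \<in> I' then pconst (d' x) * xtab (fst x) (snd x) else 0)"
    unfolding sum.distrib[symmetric] by (rule sum.cong) (auto simp: D_def pconst_add pconst_zero distrib_right)
  also have "(\<Sum>x\<in>I \<union> I'. if x \<in> I then pconst (d x) * xtab (fst x) (snd x) else 0) = (\<Sum>x\<in>I. pconst (d x) * xtab (fst x) (snd x))"
    using p(2) q(2) by (intro sum.mono_neutral_cong_right) auto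
  also have "(\<Sum>x\<in>I \<union> I'. if x \<in> I' then pconst (d' x) * xtab (fst x) (snd x) else 0) = (\<Sum>x\<in>I'. pconst (d' x) * xtab (fst x) (snd x))"
    using p(2) q(2) by (intro sum.mono_neutral_cong_right) auto
  finally have "p + q = (\<Sum>x\<in>I \<union> I'. pconst (D x) * xtab (fst x) (snd x)) + (r + r')"
    unfolding p(1) q(1) by (simp add: add_ac)
  also have "\<dots> \<in> straightened n"
    using p(2-4) q(2-4) by (intro straightenedI gen_ideal_add) auto
  finally show ?thesis .
qed

lemma straightened_scale:
  assumes "p \<in> straightened n"
  shows "pconst c * p \<in> straightened n"
proof -
  obtain I d r where p: "p = (\<Sum>x\<in>I. pconst (d x) * xtab (fst x) (snd x)) + r" "finite I"
    "\<And>lam T. (lam, T) \<in> I \<Longrightarrow> is_partition n lam \<and> symplectic_tab n lam T" "r \<in> gen_ideal n (quad_rels n)"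
    by (rule straightenedE[OF assms]) blast
  have "pconst c * p = (\<Sum>x\<in>I. pconst (c * d x) * xtab (fst x) (snd x)) + pconst c * r"
    unfolding p(1) by (simp add: distrib_left sum_distrib_left pconst_mult mult.assoc)
  also have "\<dots> \<in> straightened n"
    using p(2-4) by (intro straightenedI gen_ideal_mult Rring_pconst)
  finally show ?thesis .
qed

lemma straightened_zero: "0 \<in> straightened n"
  using straightenedI[of "{}" n 0] gen_ideal_zero by simp

lemma xtab_straightened:
  assumes lam: "is_partition n lam" and T: "T \<in> fillings n lam"
  shows "xtab lam T \<in> straightened n"
proof -
  let ?X = "{T. symplectic_tab n lam T}"
  have "delta T \<in> tens n lam" using T by (simp add: delta_in_tens)
  then obtain c w where w: "w \<in> Wrel n lam" "delta T = (\<lambda>S. (\<Sum>T\<in>?X. c T * delta T S) + w S)"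
    by (rule symplectic_decomposition[OF lam])
  have "xtab lam T = xrel n lam (delta T)" by (rule xrel_delta[OF lam T, symmetric])
  also have "\<dots> = (\<Sum>T\<in>?X. pconst (c T) * xrel n lam (delta T)) + xrel n lam w"
    unfolding w(2) xrel_add xrel_sum xrel_scale ..
  also have "(\<Sum>T\<in>?X. pconst (c T) * xrel n lam (delta T)) = (\<Sum>T\<in>?X. pconst (c T) * xtab lam T)"
    by (rule sum.cong[OF refl]) (simp add: xrel_delta[OF lam] symplectic_tab_def)
  also have "\<dots> = (\<Sum>x\<in>Pair lam ` ?X. pconst (c (snd x)) * xtab (fst x) (snd x))"
    by (subst sum.reindex) (auto simp: inj_on_def)
  also have "\<dots> + xrel n lam w \<in> straightened n"
  proof (rule straightenedI)
    show "finite (Pair lam ` ?X)" using finite_symplectic[OF lam] by simp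
    show "is_partition n mu \<and> symplectic_tab n mu S" if "(mu, S) \<in> Pair lam ` ?X" for mu S using that lam by auto
  qed (rule xrel_Wrel_in_ideal[OF lam w(1)])
  finally show ?thesis .
qed

lemma Rring_straightened:
  assumes n: "1 \<le> n" and p: "p \<in> Rring n"
  shows "p \<in> straightened n"
proof -
  have "Poly_Mapping.single m (Poly_Mapping.lookup p m) \<in> straightened n" if "m \<in> Poly_Mapping.keys p" for m
  proof -
    have "Poly_Mapping.keys m \<subseteq> pvars n" using p that by (simp add: Rring_def)
    then obtain lam T where "is_partition n lam" "T \<in> fillings n lam" "xtab lam T = Poly_Mapping.single m 1"
      using monomial_eq_xtab[OF n] by blast
    then have "Poly_Mapping.single m (1::complex) \<in> straightened n" using xtab_straightened by metis
    then have "pconst (Poly_Mapping.lookup p m) * Poly_Mapping.single m 1 \<in> straightened n" by (rule straightened_scale)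
    then show ?thesis by (simp add: pconst_def mult_single)
  qed
  moreover have "(\<Sum>i\<in>I. f i) \<in> straightened n" if "\<And>i. i \<in> I \<Longrightarrow> f i \<in> straightened n" for I :: "(ix list \<Rightarrow>\<^sub>0 nat) set" and f
    using that by (induction I rule: infinite_finite_induct) (auto intro: straightened_zero straightened_add)
  ultimately have "(\<Sum>m\<in>Poly_Mapping.keys p. Poly_Mapping.single m (Poly_Mapping.lookup p m)) \<in> straightened n" by simp
  then show ?thesis by (simp only: sum_monomials)
qed

text \<open>After straightening, \<open>p\<close> and the remainder \<open>r\<close> both vanish on
  the frames, so the symplectic part vanishes there as well. Independence across all shapes then
  kills its coefficients and leaves \<open>p = r\<close>.\<close>

lemma flag_ideal_subset_gen_ideal:
  assumes n: "1 \<le> n"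
  shows "flag_ideal n \<subseteq> gen_ideal n (quad_rels n)"
proof
  fix p assume p: "p \<in> flag_ideal n"
  then have "p \<in> straightened n" by (intro Rring_straightened[OF n]) (simp add: flag_ideal_def)
  then obtain I d r where r: "p = (\<Sum>x\<in>I. pconst (d x) * xtab (fst x) (snd x)) + r" "finite I"
    "\<And>lam T. (lam, T) \<in> I \<Longrightarrow> is_partition n lam \<and> symplectic_tab n lam T" "r \<in> gen_ideal n (quad_rels n)"
    by (rule straightenedE) blast
  obtain N where N: "n < N" "2 \<le> N"
    "\<And>c. (\<And>e. e \<noteq> 0 \<Longrightarrow> (\<Sum>(lam, T)\<in>I. c (lam, T) * Phi lam T (degeneration.frame n N e)) = 0) \<Longrightarrow> \<forall>x\<in>I. c x = 0"
    using symplectic_Phi_independent[of I n] r(2,3) by blast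
  interpret degeneration n N using N by unfold_locales
  have "(\<Sum>(lam, T)\<in>I. d (lam, T) * Phi lam T (frame e)) = 0" if e: "e \<noteq> 0" for e
  proof -
    have "evalp p (frame e) = 0" "evalp r (frame e) = 0"
      using p r(4) good_frame[OF e] gen_ideal_subset_flag_ideal by (auto simp: flag_ideal_def)
    then show ?thesis unfolding r(1) evalp_add evalp_sum evalp_mult evalp_pconst evalp_xtab by (simp add: case_prod_unfold)
  qed
  then have "\<forall>x\<in>I. d x = 0" by (rule N(3))
  then have "p = r" unfolding r(1) by (simp add: pconst_zero)
  then show "p \<in> gen_ideal n (quad_rels n)" using r(4) by simp
qed

theorem theorem1:
  fixes n :: nat and lam :: "nat list"
  assumes "1 \<le> n" and "is_partition n lam"
  shows "(cspan ({delta T | T. symplectic_tab n lam T} \<union> Wrel n lam) = tens n lam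
          \<and> (\<forall>c. (\<lambda>S. \<Sum>T\<in>{T. symplectic_tab n lam T}. c T * delta T S) \<in> Wrel n lam
                 \<longrightarrow> (\<forall>T. symplectic_tab n lam T \<longrightarrow> c T = 0)))
       \<and> iso_to_V_lambda n lam
       \<and> flag_ideal n = gen_ideal n (quad_rels n)"
proof (intro conjI allI impI)
  show "cspan ({delta T | T. symplectic_tab n lam T} \<union> Wrel n lam) = tens n lam"
    by (rule symplectic_spanning[OF assms(2)])
  show "c T = 0" if "(\<lambda>S. \<Sum>T\<in>{T. symplectic_tab n lam T}. c T * delta T S) \<in> Wrel n lam" "symplectic_tab n lam T" for c T
    by (rule symplectic_independent[OF assms(2) that])
  show "iso_to_V_lambda n lam"
    by (rule iso_to_V_lambda_partition[OF assms(2)])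
  show "flag_ideal n = gen_ideal n (quad_rels n)"
    using flag_ideal_subset_gen_ideal[OF assms(1)] gen_ideal_subset_flag_ideal by blast
qed

end
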